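(* Let $\mathbf k$ be a field of characteristic $0$, $n\ge1$, $0\le p\le n-1$, let $V$ be the $n$-dimensional space of linear combinations of the coordinate functions $z_1,\dots,z_n$ on $\mathbb A^n$, and consider the $GL_n=GL(V)$-module $A^p_{[n]}$ (degree $p$ part of the Jouanolou model of $R\Gamma(\mathbb A^n-\{0\},\mathcal O)$). (a) $A^p_{[n]}$ has simple spectrum as a $GL_n$-module: each irreducible representation $\Sigma^\alpha(V)$ enters into the irreducible decomposition of $A^p_{[n]}$ no more than once. (b) More precisely, $\Sigma^\alpha(V)$, $\alpha=(\alpha_1\ge\cdots\ge\alpha_n)\in\mathbb Z^n$, enters into $A^p_{[n]}$ if and only if $$\alpha_1\ge0\ge\alpha_2\ge0\ge\cdots\ge0\ge\alpha_{n-p}\ge-1\ge\alpha_{n-p+1}\ge-1\ge\cdots\ge-1\ge\alpha_n ,$$ where the numbers separating consecutive $\alpha_i$'s are, in order, $n-1-p$ zeros followed by $p$ copies of $-1$.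
   Context: Introduce dual variables $z_1^*,\dots,z_n^*$ (coordinates on the dual affine space $\check{\mathbb A}^n$) and write $zz^*=\sum_\nu z_\nu z^*_\nu$. The Jouanolou torsor is $J=\{(z,[z^*])\in\mathbb A^n\times\check{\mathbb P}^{n-1}: zz^*\ne0\}\simeq\{(z,z^* )\in \mathbb A^n\times\check{\mathbb A}^n: zz^*=1\}$, with projection $\pi:J\to\mathbb A^n-\{0\}$ (a Zariski locally trivial bundle of affine spaces). The commutative dg-algebra $A^\bullet_{[n]}$ is $\Gamma(J,\Omega^\bullet_{J/(\mathbb A^n-\{0\})})$ with the relative de Rham differential $\bar\partial$; it is a model of $R\Gamma(\mathbb A^n-\{0\},\mathcal O)$. Explicitly $A^p_{[n]}$ is the space of forms $\sum f_{i_1,\dots,i_p}(z,z^* )\,dz^*_{i_1}\cdots dz^*_{i_p}$ with $f_{i_1,\dots,i_p}\in\mathbf k[z,z^*][(zz^* )^{-1}]$, homogeneous of total degree $0$ in $(z^*,dz^* )$ and annihilated by contraction with $\sum_\nu z^*_\nu\,\partial/\partial z^*_\nu$. $GL(V)$ acts naturally ($\mathbb A^n=\operatorname{Spec}S^\bullet(V)$, with the $z_\nu^*$ transforming as the dual basis in $V^*$). $\Sigma^\alpha(V)$ is the irreducible representation of $GL(V)$ with highest weight $\alpha$, a non-increasing sequence of (possibly negative) integers; e.g. $\Sigma^{1,0,\dots,0}(V)=V$. *)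

theory Defs
  imports
    Complex_Main
    "HOL-Library.Poly_Mapping"
    "HOL-Library.Function_Algebras"
    "HOL-Computational_Algebra.Fraction_Field"
    "Jordan_Normal_Form.Determinant"
    "Jordan_Normal_Form.Gauss_Jordan_Elimination"
begin

section \<open>Representations of the algebraic group \<open>GL\<^sub>n\<close>\<close>

definition GL :: "nat \<Rightarrow> 'k::field mat set" where
  "GL n = {g \<in> carrier_mat n n. invertible_mat g}"

definition mat_inv :: "'k::field mat \<Rightarrow> 'k mat" where
  "mat_inv g = the (mat_inverse g)"

text \<open>
  The coordinate algebra \<open>k[g\<^sub>i\<^sub>j, det(g)\<^sup>-\<^sup>1]\<close>, realised by functions. Their values
  outside \<open>GL n\<close> are junk and are never used.
\<close>
inductive_set GL_regular :: "nat \<Rightarrow> ('k::field mat \<Rightarrow> 'k) set" for n :: nat where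
  const: "(\<lambda>_. a) \<in> GL_regular n"
| entry: "i < n \<Longrightarrow> j < n \<Longrightarrow> (\<lambda>g. g $$ (i, j)) \<in> GL_regular n"
| inv_det: "(\<lambda>g. inverse (det g)) \<in> GL_regular n"
| add: "\<phi> \<in> GL_regular n \<Longrightarrow> \<psi> \<in> GL_regular n \<Longrightarrow> (\<lambda>g. \<phi> g + \<psi> g) \<in> GL_regular n"
| mult: "\<phi> \<in> GL_regular n \<Longrightarrow> \<psi> \<in> GL_regular n \<Longrightarrow> (\<lambda>g. \<phi> g * \<psi> g) \<in> GL_regular n"

text \<open>
  In what follows \<open>s\<close> is the scalar multiplication of an ambient \<open>k\<close>-vector space \<open>'v\<close>,
  and \<open>\<rho>\<close> an action of \<open>GL n\<close> on it. Modules are subspaces of \<open>'v\<close>. For \<open>k\<close> infinite,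
  the \<open>k\<close>-points of \<open>GL\<^sub>n\<close> are Zariski dense, so for rational modules stability under the
  group \<open>GL n\<close> of \<open>k\<close>-points is stability under the algebraic group.
\<close>

definition gl_submodule ::
    "nat \<Rightarrow> ('k::field \<Rightarrow> 'v::ab_group_add \<Rightarrow> 'v) \<Rightarrow> ('k mat \<Rightarrow> 'v \<Rightarrow> 'v) \<Rightarrow> 'v set \<Rightarrow> bool" where
  "gl_submodule n s \<rho> W \<longleftrightarrow> module.subspace s W \<and> (\<forall>g\<in>GL n. \<forall>w\<in>W. \<rho> g w \<in> W)"

definition gl_rational ::
    "nat \<Rightarrow> ('k::field \<Rightarrow> 'v::ab_group_add \<Rightarrow> 'v) \<Rightarrow> ('k mat \<Rightarrow> 'v \<Rightarrow> 'v) \<Rightarrow> 'v set \<Rightarrow> bool" where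
  "gl_rational n s \<rho> W \<longleftrightarrow> gl_submodule n s \<rho> W \<and>
     (\<forall>w\<in>W. \<exists>B c. finite B \<and> B \<subseteq> W \<and> (\<forall>b\<in>B. c b \<in> GL_regular n) \<and>
        (\<forall>g\<in>GL n. \<rho> g w = (\<Sum>b\<in>B. s (c b g) b)))"

definition gl_irreducible ::
    "nat \<Rightarrow> ('k::field \<Rightarrow> 'v::ab_group_add \<Rightarrow> 'v) \<Rightarrow> ('k mat \<Rightarrow> 'v \<Rightarrow> 'v) \<Rightarrow> 'v set \<Rightarrow> bool" where
  "gl_irreducible n s \<rho> W \<longleftrightarrow> gl_submodule n s \<rho> W \<and> W \<noteq> {0} \<and>
     (\<forall>U. gl_submodule n s \<rho> U \<and> U \<subseteq> W \<longrightarrow> U = {0} \<or> U = W)"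

definition gl_isomorphic ::
    "nat \<Rightarrow> ('k::field \<Rightarrow> 'v::ab_group_add \<Rightarrow> 'v) \<Rightarrow> ('k mat \<Rightarrow> 'v \<Rightarrow> 'v) \<Rightarrow> 'v set \<Rightarrow> 'v set \<Rightarrow> bool"
  where
  "gl_isomorphic n s \<rho> W W' \<longleftrightarrow>
     (\<exists>f. bij_betw f W W' \<and>
          (\<forall>v\<in>W. \<forall>w\<in>W. f (v + w) = f v + f w) \<and>
          (\<forall>a. \<forall>w\<in>W. f (s a w) = s a (f w)) \<and>
          (\<forall>g\<in>GL n. \<forall>w\<in>W. f (\<rho> g w) = \<rho> g (f w)))"

definition dominant_weight :: "nat \<Rightarrow> int list \<Rightarrow> bool" where
  "dominant_weight n \<alpha> \<longleftrightarrow> length \<alpha> = n \<and> sorted_wrt (\<ge>) \<alpha>"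

text \<open>
  Highest weight vectors are taken with respect to the Borel subgroup of upper triangular matrices,
  which for the action on \<open>V\<close> below fixes the line of the first basis vector; the standard
  representation \<open>V\<close> thus has highest weight \<open>(1,0,\<dots>,0)\<close>.
\<close>
definition has_highest_weight ::
    "nat \<Rightarrow> ('k::field \<Rightarrow> 'v::ab_group_add \<Rightarrow> 'v) \<Rightarrow> ('k mat \<Rightarrow> 'v \<Rightarrow> 'v) \<Rightarrow> int list \<Rightarrow> 'v set \<Rightarrow> bool"
  where
  "has_highest_weight n s \<rho> \<alpha> W \<longleftrightarrow>
     (\<exists>w\<in>W. w \<noteq> 0 \<and>
        (\<forall>g\<in>GL n. upper_triangular g \<longrightarrow> \<rho> g w = s (\<Prod>i<n. (g $$ (i, i)) powi (\<alpha> ! i)) w))"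

text \<open>\<open>W\<close> is a copy of \<open>\<Sigma>\<^sup>\<alpha>(V)\<close>, the irreducible representation with highest weight \<open>\<alpha>\<close>.\<close>
definition is_Sigma ::
    "nat \<Rightarrow> ('k::field \<Rightarrow> 'v::ab_group_add \<Rightarrow> 'v) \<Rightarrow> ('k mat \<Rightarrow> 'v \<Rightarrow> 'v) \<Rightarrow> int list \<Rightarrow> 'v set \<Rightarrow> bool"
  where
  "is_Sigma n s \<rho> \<alpha> W \<longleftrightarrow>
     dominant_weight n \<alpha> \<and> gl_irreducible n s \<rho> W \<and> gl_rational n s \<rho> W \<and>
     has_highest_weight n s \<rho> \<alpha> W"

text \<open>
  \<open>M\<close> is the internal direct sum of the irreducible submodules in \<open>\<D>\<close>. Isomorphic summands
  are different subspaces, so a set of subspaces records multiplicities.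
\<close>
definition irreducible_decomposition ::
    "nat \<Rightarrow> ('k::field \<Rightarrow> 'v::ab_group_add \<Rightarrow> 'v) \<Rightarrow> ('k mat \<Rightarrow> 'v \<Rightarrow> 'v) \<Rightarrow> 'v set \<Rightarrow> 'v set set \<Rightarrow> bool"
  where
  "irreducible_decomposition n s \<rho> M \<D> \<longleftrightarrow>
     (\<forall>W\<in>\<D>. gl_irreducible n s \<rho> W) \<and>
     module.span s (\<Union>\<D>) = M \<and>
     (\<forall>W\<in>\<D>. W \<inter> module.span s (\<Union>(\<D> - {W})) = {0})"

definition simple_spectrum ::
    "nat \<Rightarrow> ('k::field \<Rightarrow> 'v::ab_group_add \<Rightarrow> 'v) \<Rightarrow> ('k mat \<Rightarrow> 'v \<Rightarrow> 'v) \<Rightarrow> 'v set \<Rightarrow> bool" where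
  "simple_spectrum n s \<rho> M \<longleftrightarrow>
     (\<exists>\<D>. irreducible_decomposition n s \<rho> M \<D>) \<and>
     (\<forall>\<D>. irreducible_decomposition n s \<rho> M \<D> \<longrightarrow>
        (\<forall>W\<in>\<D>. \<forall>W'\<in>\<D>. gl_isomorphic n s \<rho> W W' \<longrightarrow> W = W'))"

section \<open>Polynomials and rational functions\<close>

text \<open>
  Polynomials in variables indexed by \<open>nat\<close>. For fixed \<open>n\<close>, variable \<open>i < n\<close> is
  \<open>z\<^sub>i\<close> and variable \<open>n + i\<close> (\<open>i < n\<close>) is the dual variable \<open>z\<^sub>i\<^sup>*\<close>; indices start at 0.
\<close>
type_synonym 'k mpoly = "(nat \<Rightarrow>\<^sub>0 nat) \<Rightarrow>\<^sub>0 'k"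

definition Const :: "'k::field \<Rightarrow> 'k mpoly" where
  "Const a = Poly_Mapping.single 0 a"

definition Var :: "nat \<Rightarrow> 'k::field mpoly" where
  "Var v = Poly_Mapping.single (Poly_Mapping.single v 1) 1"

definition poly_subst :: "(nat \<Rightarrow> 'k::field mpoly) \<Rightarrow> 'k mpoly \<Rightarrow> 'k mpoly" where
  "poly_subst \<sigma> P =
     (\<Sum>m\<in>Poly_Mapping.keys P. Const (Poly_Mapping.lookup P m) *
        (\<Prod>v\<in>Poly_Mapping.keys m. \<sigma> v ^ Poly_Mapping.lookup m v))"

text \<open>The map on fraction fields induced by an injective ring endomorphism \<open>\<phi>\<close>.\<close>
definition fract_map :: "('a::idom \<Rightarrow> 'a) \<Rightarrow> 'a fract \<Rightarrow> 'a fract" where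
  "fract_map \<phi> x = (THE y. \<exists>P Q. Q \<noteq> 0 \<and> x = Fract P Q \<and> y = Fract (\<phi> P) (\<phi> Q))"

lemma fract_map_Fract:
  assumes "inj \<phi>" "\<phi> 0 = 0" "\<And>a b. \<phi> (a * b) = \<phi> a * \<phi> b" "Q \<noteq> 0"
  shows "fract_map \<phi> (Fract P Q) = Fract (\<phi> P) (\<phi> Q)"
proof -
  have nz: "\<phi> R \<noteq> 0" if "R \<noteq> 0" for R
    using that assms(1,2) by (metis injD)
  have "Fract (\<phi> P') (\<phi> Q') = Fract (\<phi> P) (\<phi> Q)"
    if "Q' \<noteq> 0" "Fract P Q = Fract P' Q'" for P' Q'
  proof -
    have "P * Q' = P' * Q"
      using that assms(4) by (simp add: eq_fract)
    then have "\<phi> P * \<phi> Q' = \<phi> P' * \<phi> Q"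
      by (metis assms(3))
    then show ?thesis
      using nz that(1) assms(4) by (simp add: eq_fract)
  qed
  then show ?thesis
    unfolding fract_map_def using assms(4) by (intro the_equality) blast+
qed

definition zz_dual :: "nat \<Rightarrow> 'k::field mpoly" where
  "zz_dual n = (\<Sum>i<n. Var i * Var (n + i))"

definition poly_zzd :: "nat \<Rightarrow> 'k::field mpoly set" where
  "poly_zzd n = {P. \<forall>m\<in>Poly_Mapping.keys P. Poly_Mapping.keys m \<subseteq> {..<2 * n}}"

definition dual_homogeneous :: "nat \<Rightarrow> int \<Rightarrow> 'k::field mpoly \<Rightarrow> bool" where
  "dual_homogeneous n d P \<longleftrightarrow>
     (\<forall>m\<in>Poly_Mapping.keys P. int (\<Sum>i<n. Poly_Mapping.lookup m (n + i)) = d)"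

text \<open>
  The elements of \<open>k[z,z\<^sup>*][(zz\<^sup>*)\<^sup>-\<^sup>1]\<close> that are homogeneous of degree \<open>d\<close> in \<open>z\<^sup>*\<close>. As
  \<open>zz\<^sup>*\<close> has degree 1, the numerator over \<open>(zz\<^sup>*)\<^sup>r\<close> has degree \<open>d + r\<close>.
\<close>
definition jouanolou_ring_deg :: "nat \<Rightarrow> int \<Rightarrow> 'k::field mpoly fract set" where
  "jouanolou_ring_deg n d =
     {Fract P (zz_dual n ^ r) | P r. P \<in> poly_zzd n \<and> dual_homogeneous n (d + int r) P}"

section \<open>The relative differential forms on the Jouanolou torsor\<close>

text \<open>
  A \<open>p\<close>-form \<open>\<Sum>\<^bsub>i\<^sub>1<\<dots><i\<^sub>p\<^esub> f\<^bsub>i\<^sub>1\<dots>i\<^sub>p\<^esub> dz\<^sup>*\<^bsub>i\<^sub>1\<^esub>\<dots>dz\<^sup>*\<^bsub>i\<^sub>p\<^esub>\<close> is encoded by its antisymmetric family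
  of components \<open>\<omega> [i\<^sub>1,\<dots>,i\<^sub>p] = f\<^bsub>i\<^sub>1\<dots>i\<^sub>p\<^esub>\<close>, extended by 0 to all other lists of indices.
\<close>
type_synonym 'k form = "nat list \<Rightarrow> 'k mpoly fract"

definition form_scale :: "'k::field \<Rightarrow> 'k form \<Rightarrow> 'k form" where
  "form_scale a \<omega> = (\<lambda>I. Fract (Const a) 1 * \<omega> I)"

lemma vector_space_form_scale: "vector_space (form_scale :: 'k::field \<Rightarrow> _)"
proof
  fix a b :: 'k and \<omega> \<eta> :: "'k form"
  have "Const (a + b) = Const a + Const b" "Const (a * b) = Const a * Const b" and one: "Const 1 = (1 :: 'k mpoly)"
    by (simp_all add: Const_def single_add mult_single)
  then have *: "Fract (Const (a + b)) 1 = Fract (Const a) 1 + Fract (Const b) 1"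
   and **: "Fract (Const (a * b)) 1 = Fract (Const a) 1 * Fract (Const b) 1"
    by (simp_all add: add_fract mult_fract)
  show "form_scale a (\<omega> + \<eta>) = form_scale a \<omega> + form_scale a \<eta>"
    unfolding form_scale_def plus_fun_def distrib_left ..
  show "form_scale (a + b) \<omega> = form_scale a \<omega> + form_scale b \<omega>"
    unfolding form_scale_def plus_fun_def * distrib_right ..
  show "form_scale a (form_scale b \<omega>) = form_scale (a * b) \<omega>"
    unfolding form_scale_def ** mult.assoc ..
  show "form_scale 1 \<omega> = \<omega>"
    unfolding form_scale_def one One_fract_def[symmetric] mult_1_left ..
qed

definition antisymmetric_form :: "nat \<Rightarrow> nat \<Rightarrow> 'k::field form \<Rightarrow> bool" where
  "antisymmetric_form n p \<omega> \<longleftrightarrow>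
     (\<forall>I. \<not> (length I = p \<and> set I \<subseteq> {..<n} \<and> distinct I) \<longrightarrow> \<omega> I = 0) \<and>
     (\<forall>I i j. i < j \<and> j < length I \<longrightarrow> \<omega> (I[i := I ! j, j := I ! i]) = - \<omega> I)"

text \<open>Contraction with \<open>\<Sum>\<^sub>\<nu> z\<^sub>\<nu>\<^sup>* \<partial>/\<partial>z\<^sub>\<nu>\<^sup>*\<close>; it is 0 on 0-forms, which vanish on nonempty lists.\<close>
definition euler_contraction :: "nat \<Rightarrow> 'k::field form \<Rightarrow> 'k form" where
  "euler_contraction n \<omega> = (\<lambda>I. \<Sum>\<nu><n. Fract (Var (n + \<nu>)) 1 * \<omega> (\<nu> # I))"

text \<open>Each \<open>dz\<^sub>i\<^sup>*\<close> has degree 1, so total degree 0 means coefficients of degree \<open>-p\<close> in \<open>z\<^sup>*\<close>.\<close>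
definition jouanolou_forms :: "nat \<Rightarrow> nat \<Rightarrow> 'k::field form set" where
  "jouanolou_forms n p =
     {\<omega>. antisymmetric_form n p \<omega> \<and>
         (\<forall>I. \<omega> I \<in> jouanolou_ring_deg n (- int p)) \<and>
         euler_contraction n \<omega> = 0}"

text \<open>
  \<open>g\<close> sends \<open>z\<^sub>j\<close> to \<open>\<Sum>\<^sub>i g\<^sub>i\<^sub>j z\<^sub>i\<close> and \<open>z\<^sub>j\<^sup>*\<close> to \<open>\<Sum>\<^sub>i (g\<^sup>-\<^sup>1)\<^sub>j\<^sub>i z\<^sub>i\<^sup>*\<close> (the contragredient action on the
  dual basis), so that \<open>zz\<^sup>*\<close> is invariant; \<open>dz\<^sub>j\<^sup>*\<close> transforms like \<open>z\<^sub>j\<^sup>*\<close>. The unused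
  variables are fixed.
\<close>
definition gl_var :: "nat \<Rightarrow> 'k::field mat \<Rightarrow> nat \<Rightarrow> 'k mpoly" where
  "gl_var n g v =
     (if v < n then \<Sum>i<n. Const (g $$ (i, v)) * Var i
      else if v < 2 * n then \<Sum>i<n. Const (mat_inv g $$ (v - n, i)) * Var (n + i)
      else Var v)"

definition gl_fun :: "nat \<Rightarrow> 'k::field mat \<Rightarrow> 'k mpoly fract \<Rightarrow> 'k mpoly fract" where
  "gl_fun n g = fract_map (poly_subst (gl_var n g))"

definition gl_form :: "nat \<Rightarrow> 'k::field mat \<Rightarrow> 'k form \<Rightarrow> 'k form" where
  "gl_form n g \<omega> = (\<lambda>I.
     if set I \<subseteq> {..<n} then
       \<Sum>J\<in>{J. set J \<subseteq> {..<n} \<and> length J = length I}.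
         Fract (Const (\<Prod>t<length I. mat_inv g $$ (J ! t, I ! t))) 1 * gl_fun n g (\<omega> J)
     else 0)"

section \<open>The interlacing condition\<close>

text \<open>The numbers separating consecutive \<open>\<alpha>\<^sub>i\<close>: \<open>n - 1 - p\<close> zeros, then \<open>p\<close> copies of \<open>-1\<close>.\<close>
definition separators :: "nat \<Rightarrow> nat \<Rightarrow> int list" where
  "separators n p = replicate (n - 1 - p) 0 @ replicate p (- 1)"

definition interlaces :: "nat \<Rightarrow> nat \<Rightarrow> int list \<Rightarrow> bool" where
  "interlaces n p \<alpha> \<longleftrightarrow>
     (\<forall>i < n - 1. \<alpha> ! i \<ge> separators n p ! i \<and> separators n p ! i \<ge> \<alpha> ! Suc i)"

end

theory Submission
  imports Defs
begin

text \<open>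
  Clearing the denominator \<open>(zz\<^sup>*) ^ r\<close> exhausts the module by finite-dimensional spaces of polynomial
  forms. On these consider the bilinear form for which monomials \<open>m\<close> are orthogonal with square \<open>m!\<close>:
  a matrix and its transpose are adjoint, and a nonzero vector with integral coefficients has
  positive square. Every nonzero submodule contains a highest weight vector, so complete
  reducibility and the simple spectrum follow once highest weight vectors are unique up to a scalar
  and can be scaled to have integral coefficients.

  A highest weight vector is determined by its value at one point of the open orbit of the Borel
  subgroup on the Jouanolou torsor, where the torus stabiliser and the contraction condition leave a
  single component. Comparing this with a second point gives the interlacing inequalities.
  Conversely, \<open>z\<^sub>0 ^ a * (z\<^sup>*\<^bsub>n-1\<^esub>) ^ b\<close> times a minor of size \<open>p + 1\<close> of the vectors \<open>z\<^sup>*\<close>, \<open>e\<^bsub>i1\<^esub>\<close>, \<open>\<dots>\<close>,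
  \<open>e\<^bsub>ip\<^esub>\<close>, divided by a power of \<open>zz\<^sup>*\<close>, realises every interlacing weight.
\<close>

section \<open>Linear algebra\<close>

text \<open>Over a general field of characteristic 0 no positivity is available: for
  \<open>n \<ge> 2\<close> the vector \<open>z_0 + i z_1\<close> is isotropic as soon as the field
  contains a square root \<open>i\<close> of -1. Orthogonal complements can therefore be controlled
  only through highest weight vectors, whose integrality has a single source. For every weight that
  occurs an explicit vector built from minors has an integral numerator; by uniqueness a given
  highest weight vector is proportional to it once both have the same denominator, and the extra
  powers of \<open>zz_dual\<close> can be cancelled without leaving the integers because
  \<open>zz_dual\<close> is primitive. The explicit vectors thus serve twice: they realise the
  interlacing weights and they make complete reducibility work. The group is present only through
  its points over the field; the diagonal matrices with a single entry 2 take the place of the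
  torus. A point of the torsor says nothing about a weight entry at an index where the coordinates
  of both vectors are nonzero. This happens at the last index for the first point and at index 0 for
  the second, so that together the two points see every entry.\<close>

context vector_space
begin

text \<open>Induction on the functionals: restrict to the kernel of \<open>\<phi> j\<close> and
  correct by a multiple of \<open>\<phi> j\<close>. Linearity is demanded on \<open>W\<close> alone
  because the forms \<open>\<beta> j\<close> of the later locale are bilinear only on
  \<open>K j\<close>.\<close>

lemma functional_in_span:
  fixes \<phi> :: "'i \<Rightarrow> 'b \<Rightarrow> 'a" and \<psi> :: "'b \<Rightarrow> 'a"
  assumes "finite I"
    and "subspace W"
    and "\<And>i x y. i \<in> I \<Longrightarrow> x \<in> W \<Longrightarrow> y \<in> W \<Longrightarrow> \<phi> i (x + y) = \<phi> i x + \<phi> i y"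
    and "\<And>i c x. i \<in> I \<Longrightarrow> x \<in> W \<Longrightarrow> \<phi> i (scale c x) = c * \<phi> i x"
    and "\<And>x y. x \<in> W \<Longrightarrow> y \<in> W \<Longrightarrow> \<psi> (x + y) = \<psi> x + \<psi> y"
    and "\<And>c x. x \<in> W \<Longrightarrow> \<psi> (scale c x) = c * \<psi> x"
    and "\<And>x. x \<in> W \<Longrightarrow> \<forall>i\<in>I. \<phi> i x = 0 \<Longrightarrow> \<psi> x = 0"
  shows "\<exists>a. \<forall>x\<in>W. \<psi> x = (\<Sum>i\<in>I. a i * \<phi> i x)"
  using assms
proof (induction I arbitrary: W rule: finite_induct)
  case empty
  then show ?case by auto
next
  case (insert j I)
  note W = \<open>subspace W\<close>
  note \<phi>_add = insert.prems(2) and \<phi>_scale = insert.prems(3)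
    and \<psi>_add = insert.prems(4) and \<psi>_scale = insert.prems(5) and ker = insert.prems(6)
  define W' where "W' = {x \<in> W. \<phi> j x = 0}"
  have "W' \<subseteq> W" by (auto simp: W'_def)
  have W': "subspace W'"
    unfolding W'_def using W \<phi>_add[of j] \<phi>_scale[of j]
    by (auto simp: subspace_def) (metis mult_zero_left scale_zero_left)
  obtain a where a: "\<forall>x\<in>W'. \<psi> x = (\<Sum>i\<in>I. a i * \<phi> i x)"
  proof -
    have "\<exists>a. \<forall>x\<in>W'. \<psi> x = (\<Sum>i\<in>I. a i * \<phi> i x)"
      by (rule insert.IH[OF W']) (use \<open>W' \<subseteq> W\<close> insert.prems in \<open>auto simp: W'_def\<close>)
    then show ?thesis using that by blast
  qed
  show ?case
  proof (cases "\<exists>w\<in>W. \<phi> j w \<noteq> 0")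
    case False
    then have "W' = W" by (auto simp: W'_def)
    then have "\<forall>x\<in>W. \<psi> x = (\<Sum>i\<in>insert j I. (a(j := 0)) i * \<phi> i x)"
      using a insert.hyps by (auto intro!: sum.cong)
    then show ?thesis by blast
  next
    case True
    then obtain w0 where w0: "w0 \<in> W" "\<phi> j w0 \<noteq> 0" by blast
    define w where "w = scale (inverse (\<phi> j w0)) w0"
    have w: "w \<in> W" "\<phi> j w = 1"
      using w0 W \<phi>_scale[of j w0 "inverse (\<phi> j w0)"] by (auto simp: w_def subspace_scale)
    define b where "b = \<psi> w - (\<Sum>i\<in>I. a i * \<phi> i w)"
    have "\<psi> x = (\<Sum>i\<in>insert j I. (a(j := b)) i * \<phi> i x)" if x: "x \<in> W" for x
    proof -
      let ?c = "- \<phi> j x"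
      define y where "y = x + scale ?c w"
      have cw: "scale ?c w \<in> W" using w W subspace_scale by blast
      then have yW: "y \<in> W" using x W subspace_add unfolding y_def by blast
      have \<phi>y: "\<phi> i y = \<phi> i x - \<phi> j x * \<phi> i w" if "i \<in> insert j I" for i
        using \<phi>_add[OF that x cw] \<phi>_scale[OF that w(1), of ?c] by (simp add: y_def)
      have "y \<in> W'" using yW \<phi>y[of j] w by (simp add: W'_def)
      then have "\<psi> y = (\<Sum>i\<in>I. a i * \<phi> i y)" using a by blast
      also have "\<dots> = (\<Sum>i\<in>I. a i * \<phi> i x) - \<phi> j x * (\<Sum>i\<in>I. a i * \<phi> i w)"
        unfolding sum_distrib_left sum_subtractf[symmetric]
        by (intro sum.cong refl) (simp add: \<phi>y algebra_simps del: add_diff_eq diff_diff_eq2)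
      finally have "\<psi> x - \<phi> j x * \<psi> w = (\<Sum>i\<in>I. a i * \<phi> i x) - \<phi> j x * (\<Sum>i\<in>I. a i * \<phi> i w)"
        using \<psi>_add[OF x cw] \<psi>_scale[OF w(1), of ?c] by (simp add: y_def)
      then have "\<psi> x = (\<Sum>i\<in>I. a i * \<phi> i x) + \<phi> j x * b"
        by (simp add: b_def algebra_simps)
      also have "(\<Sum>i\<in>I. a i * \<phi> i x) = (\<Sum>i\<in>I. (a(j := b)) i * \<phi> i x)"
        using insert.hyps by (auto intro!: sum.cong)
      finally show ?thesis using insert.hyps by (simp add: algebra_simps)
    qed
    then show ?thesis by blast
  qed
qed

text \<open>The last hypothesis is the solvability criterion of a linear system: the right-hand side
  satisfies every linear relation among the functionals. In the induction, either some vector kills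
  the earlier functionals but not \<open>\<phi> j\<close> and corrects the value, or
  \<open>\<phi> j\<close> depends on the others and the relation forces its value.\<close>

lemma solve_functionals:
  fixes \<phi> :: "'i \<Rightarrow> 'b \<Rightarrow> 'a" and c :: "'i \<Rightarrow> 'a"
  assumes "finite I" and W: "subspace W"
    and "\<And>i x y. i \<in> I \<Longrightarrow> x \<in> W \<Longrightarrow> y \<in> W \<Longrightarrow> \<phi> i (x + y) = \<phi> i x + \<phi> i y"
    and "\<And>i r x. i \<in> I \<Longrightarrow> x \<in> W \<Longrightarrow> \<phi> i (scale r x) = r * \<phi> i x"
    and "\<And>a. \<forall>x\<in>W. (\<Sum>i\<in>I. a i * \<phi> i x) = 0 \<Longrightarrow> (\<Sum>i\<in>I. a i * c i) = 0"
  shows "\<exists>w\<in>W. \<forall>i\<in>I. \<phi> i w = c i"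
  using assms(1,3,4,5)
proof (induction I rule: finite_induct)
  case empty
  then show ?case using W subspace_0 by auto
next
  case (insert j I)
  note add = insert.prems(1) and scl = insert.prems(2) and rel = insert.prems(3)
  have "\<exists>w\<in>W. \<forall>i\<in>I. \<phi> i w = c i"
  proof (rule insert.IH)
    fix a assume a: "\<forall>x\<in>W. (\<Sum>i\<in>I. a i * \<phi> i x) = 0"
    have *: "(\<Sum>i\<in>insert j I. (a(j := 0)) i * f i) = (\<Sum>i\<in>I. a i * f i)" for f
      using insert.hyps by (auto intro!: sum.cong)
    show "(\<Sum>i\<in>I. a i * c i) = 0"
      using rel[of "a(j := 0)"] a unfolding * by blast
  qed (use add scl in auto)
  then obtain w1 where w1: "w1 \<in> W" "\<forall>i\<in>I. \<phi> i w1 = c i" by blast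
  show ?case
  proof (cases "\<exists>w\<in>W. (\<forall>i\<in>I. \<phi> i w = 0) \<and> \<phi> j w \<noteq> 0")
    case True
    then obtain w0 where w0: "w0 \<in> W" "\<forall>i\<in>I. \<phi> i w0 = 0" "\<phi> j w0 \<noteq> 0" by blast
    let ?r = "(c j - \<phi> j w1) / \<phi> j w0"
    have rw: "scale ?r w0 \<in> W" using w0 W subspace_scale by blast
    have "\<phi> i (w1 + scale ?r w0) = c i" if "i \<in> insert j I" for i
      using add[OF that w1(1) rw] scl[OF that w0(1), of ?r] w0 w1 that by auto
    moreover have "w1 + scale ?r w0 \<in> W" using rw w1 W subspace_add by blast
    ultimately show ?thesis by blast
  next
    case False
    then have "\<exists>a. \<forall>x\<in>W. \<phi> j x = (\<Sum>i\<in>I. a i * \<phi> i x)"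
      using functional_in_span[OF insert.hyps(1) W, of \<phi> "\<phi> j"] add scl by blast
    then obtain a where a: "\<forall>x\<in>W. \<phi> j x = (\<Sum>i\<in>I. a i * \<phi> i x)" by blast
    have *: "(\<Sum>i\<in>insert j I. (a(j := - 1)) i * f i) = (\<Sum>i\<in>I. a i * f i) - f j" for f
    proof -
      have "(\<Sum>i\<in>I. (a(j := - 1)) i * f i) = (\<Sum>i\<in>I. a i * f i)"
        using insert.hyps by (auto intro!: sum.cong)
      then show ?thesis using insert.hyps by simp
    qed
    have "(\<Sum>i\<in>I. a i * c i) - c j = 0"
      using rel[of "a(j := - 1)"] a unfolding * by simp
    moreover have "\<phi> j w1 = (\<Sum>i\<in>I. a i * c i)" using a w1 by simp
    ultimately show ?thesis using w1 by auto
  qed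
qed

lemma finite_spanning_subset:
  assumes "subspace W" "W \<subseteq> span E" "finite E"
  obtains B where "finite B" "B \<subseteq> W" "W = span B" "independent B"
proof -
  obtain B where B: "B \<subseteq> W" "independent B" "W \<subseteq> span B"
    using maximal_independent_subset by blast
  then have "finite B" using independent_span_bound[OF assms(3)] assms(2) by blast
  moreover have "span B \<subseteq> W" using B(1) assms(1) span_minimal by blast
  ultimately show ?thesis using that B by blast
qed

text \<open>Existence of the orthogonal projection of \<open>x\<close> to \<open>W\<close>. By
  nondegeneracy a relation among the functionals \<open>\<beta> b\<close> on \<open>W\<close> comes
  from a vanishing combination of the vectors \<open>b\<close>, so it holds at \<open>x\<close> too
  and the system is solvable. As \<open>x\<close> may lie outside \<open>W\<close>, linearity on the
  left is also asked at \<open>x\<close>.\<close>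

lemma orthogonal_complement:
  assumes W: "subspace W" "W \<subseteq> span E" "finite E"
    and add_r: "\<And>u x y. u \<in> W \<Longrightarrow> x \<in> W \<Longrightarrow> y \<in> W \<Longrightarrow> \<beta> u (x + y) = \<beta> u x + \<beta> u y"
    and scl_r: "\<And>u c x. u \<in> W \<Longrightarrow> x \<in> W \<Longrightarrow> \<beta> u (scale c x) = c * \<beta> u x"
    and add_l: "\<And>u v y. u \<in> W \<Longrightarrow> v \<in> W \<Longrightarrow> y \<in> insert x W \<Longrightarrow> \<beta> (u + v) y = \<beta> u y + \<beta> v y"
    and scl_l: "\<And>u c y. u \<in> W \<Longrightarrow> y \<in> insert x W \<Longrightarrow> \<beta> (scale c u) y = c * (\<beta> u y :: 'a)"
    and nondeg: "\<And>u. u \<in> W \<Longrightarrow> \<forall>w\<in>W. \<beta> u w = 0 \<Longrightarrow> u = 0"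
  shows "\<exists>w\<in>W. \<forall>u\<in>W. \<beta> u w = \<beta> u x"
proof -
  obtain B where B: "finite B" "B \<subseteq> W" "W = span B"
    using finite_spanning_subset[OF W] by metis
  have comb: "(\<Sum>b\<in>B. scale (a b) b) \<in> W" for a
    unfolding B(3) by (intro span_sum span_scale span_base)
  have \<beta>0: "\<beta> 0 y = 0" if "y \<in> insert x W" for y
    using scl_l[OF subspace_0[OF W(1)] that, of 0] by simp
  have sum: "\<beta> (\<Sum>b\<in>C. scale (a b) b) y = (\<Sum>b\<in>C. a b * \<beta> b y)"
    if y: "y \<in> insert x W" and "finite C" "C \<subseteq> B" for a C y
    using that(2,3)
  proof (induction rule: finite_induct)
    case (insert b C)
    have "b \<in> W" if "b \<in> B" for b using that B(2) by blast
    then have "(\<Sum>b\<in>C. scale (a b) b) \<in> W" "b \<in> W"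
      using insert.prems W(1) by (auto intro!: subspace_sum subspace_scale)
    then show ?case
      using insert add_l[OF _ _ y] scl_l[OF _ y] W by (simp add: subspace_scale)
  qed (use \<beta>0 y in auto)
  have "\<exists>w\<in>W. \<forall>b\<in>B. \<beta> b w = \<beta> b x"
  proof (rule solve_functionals[OF B(1) W(1)])
    fix a assume a: "\<forall>w\<in>W. (\<Sum>b\<in>B. a b * \<beta> b w) = 0"
    have "(\<Sum>b\<in>B. scale (a b) b) = 0"
      using nondeg[OF comb[of a]] sum[OF _ B(1)] a by auto
    then show "(\<Sum>b\<in>B. a b * \<beta> b x) = 0"
      using sum[of x B a] B(1) \<beta>0 by simp
  qed (use B add_r scl_r in auto)
  then obtain w where w: "w \<in> W" "\<forall>b\<in>B. \<beta> b w = \<beta> b x" by blast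
  have "\<beta> u w = \<beta> u x" if u: "u \<in> W" for u
  proof -
    obtain a where "u = (\<Sum>b\<in>B. scale (a b) b)"
      using u unfolding B(3) span_finite[OF B(1)] by blast
    then show ?thesis using sum[of w B a] sum[of x B a] w B(1) by simp
  qed
  then show ?thesis using w by blast
qed

lemma dim_less:
  assumes "subspace U" "subspace W" "U \<subset> W" "W \<subseteq> span E" "finite E"
  shows "dim U < dim W"
proof -
  obtain B where B: "finite B" "B \<subseteq> U" "U = span B" "independent B"
    using finite_spanning_subset[of U E] assms by blast
  obtain C where C: "B \<subseteq> C" "C \<subseteq> W" "independent C" "W \<subseteq> span C"
    using maximal_independent_subset_extend[of B W] B assms by (metis order_trans less_imp_le)
  have fC: "finite C" using independent_span_bound[OF assms(5) C(3)] C assms(4) by blast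
  have "B \<noteq> C" using assms(3) B C by auto
  then have "card B < card C" using C(1) fC by (simp add: psubset_card_mono psubset_eq)
  moreover have "dim U = card B" using B dim_eq_card_independent dim_span by metis
  moreover have "dim W = card C"
    using C basis_card_eq_dim by metis
  ultimately show ?thesis by simp
qed

end

section \<open>Modules with contravariant forms\<close>

definition hw_vector ::
    "nat \<Rightarrow> ('k::field \<Rightarrow> 'v::ab_group_add \<Rightarrow> 'v) \<Rightarrow> ('k mat \<Rightarrow> 'v \<Rightarrow> 'v) \<Rightarrow> int list \<Rightarrow> 'v \<Rightarrow> bool"
  where
  "hw_vector n s \<rho> \<alpha> w \<longleftrightarrow> dominant_weight n \<alpha> \<and> w \<noteq> 0 \<and>
     (\<forall>g\<in>GL n. upper_triangular g \<longrightarrow> \<rho> g w = s (\<Prod>i<n. (g $$ (i, i)) powi (\<alpha> ! i)) w)"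

text \<open>
  The finite-dimensional submodules \<open>K j\<close> exhaust \<open>M\<close>. A form \<open>\<beta> j\<close> for which \<open>g\<close> and its transpose
  are adjoint turns orthogonal complements of submodules into submodules; as every nonzero submodule
  contains a highest weight vector and these are not isotropic, a submodule meets its orthogonal
  complement only in 0.
\<close>
locale contravariant_module = vector_space s
  for s :: "'k::field \<Rightarrow> 'v::ab_group_add \<Rightarrow> 'v" +
  fixes n :: nat and \<rho> :: "'k mat \<Rightarrow> 'v \<Rightarrow> 'v" and M :: "'v set"
    and K :: "'j \<Rightarrow> 'v set" and \<beta> :: "'j \<Rightarrow> 'v \<Rightarrow> 'v \<Rightarrow> 'k"
  assumes transpose_GL: "g \<in> GL n \<Longrightarrow> transpose_mat g \<in> GL n"
    and submodule_M: "gl_submodule n s \<rho> M"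
    and \<rho>_add: "g \<in> GL n \<Longrightarrow> x \<in> M \<Longrightarrow> y \<in> M \<Longrightarrow> \<rho> g (x + y) = \<rho> g x + \<rho> g y"
    and \<rho>_scale: "g \<in> GL n \<Longrightarrow> x \<in> M \<Longrightarrow> \<rho> g (s c x) = s c (\<rho> g x)"
    and submodule_K: "gl_submodule n s \<rho> (K j)"
    and K_le_M: "K j \<subseteq> M"
    and K_directed: "finite X \<Longrightarrow> X \<subseteq> M \<Longrightarrow> \<exists>j. X \<subseteq> K j"
    and K_finite: "\<exists>E. finite E \<and> K j \<subseteq> span E"
    and \<beta>_add_left: "x \<in> K j \<Longrightarrow> y \<in> K j \<Longrightarrow> z \<in> K j \<Longrightarrow> \<beta> j (x + y) z = \<beta> j x z + \<beta> j y z"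
    and \<beta>_scale_left: "x \<in> K j \<Longrightarrow> y \<in> K j \<Longrightarrow> \<beta> j (s c x) y = c * \<beta> j x y"
    and \<beta>_commute: "x \<in> K j \<Longrightarrow> y \<in> K j \<Longrightarrow> \<beta> j x y = \<beta> j y x"
    and contravariant:
      "g \<in> GL n \<Longrightarrow> x \<in> K j \<Longrightarrow> y \<in> K j \<Longrightarrow> \<beta> j (\<rho> g x) y = \<beta> j x (\<rho> (transpose_mat g) y)"
    and hw_exists: "gl_submodule n s \<rho> W \<Longrightarrow> W \<subseteq> M \<Longrightarrow> W \<noteq> {0} \<Longrightarrow> \<exists>\<alpha>. \<exists>w\<in>W. hw_vector n s \<rho> \<alpha> w"
    and hw_unique: "v \<in> M \<Longrightarrow> w \<in> M \<Longrightarrow> hw_vector n s \<rho> \<alpha> v \<Longrightarrow> hw_vector n s \<rho> \<alpha> w \<Longrightarrow> \<exists>c. w = s c v"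
    and hw_anisotropic: "w \<in> K j \<Longrightarrow> hw_vector n s \<rho> \<alpha> w \<Longrightarrow> \<beta> j w w \<noteq> 0"
begin

abbreviation sub :: "'v set \<Rightarrow> bool" where "sub W \<equiv> gl_submodule n s \<rho> W"
abbreviation irr :: "'v set \<Rightarrow> bool" where "irr W \<equiv> gl_irreducible n s \<rho> W"
abbreviation hw :: "int list \<Rightarrow> 'v \<Rightarrow> bool" where "hw \<equiv> hw_vector n s \<rho>"

lemma sub_subspace: "sub W \<Longrightarrow> subspace W"
  by (simp add: gl_submodule_def)

lemma sub_\<rho>: "sub W \<Longrightarrow> g \<in> GL n \<Longrightarrow> w \<in> W \<Longrightarrow> \<rho> g w \<in> W"
  by (simp add: gl_submodule_def)

lemma sub_Int: "sub U \<Longrightarrow> sub W \<Longrightarrow> sub (U \<inter> W)"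
  by (auto simp: gl_submodule_def subspace_inter)

lemma sub_span:
  assumes "\<And>W. W \<in> \<D> \<Longrightarrow> sub W" "\<And>W. W \<in> \<D> \<Longrightarrow> W \<subseteq> M"
  shows "sub (span (\<Union>\<D>))"
proof -
  have le: "span (\<Union>\<D>) \<subseteq> M"
    using assms(2) sub_subspace[OF submodule_M] by (intro span_minimal) auto
  have "\<rho> g w \<in> span (\<Union>\<D>)" if g: "g \<in> GL n" and w: "w \<in> span (\<Union>\<D>)" for g w
  proof -
    have "\<rho> g 0 = 0"
      using \<rho>_scale[OF g, of 0 0] sub_subspace[OF submodule_M] subspace_0 by simp
    then have "subspace {w \<in> M. \<rho> g w \<in> span (\<Union>\<D>)}"
      using sub_subspace[OF submodule_M]
      by (auto simp: subspace_def \<rho>_add[OF g] \<rho>_scale[OF g] span_zero span_add span_scale)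
    moreover have "\<Union>\<D> \<subseteq> {w \<in> M. \<rho> g w \<in> span (\<Union>\<D>)}"
      using assms sub_\<rho>[OF _ g] by (blast intro: span_base)
    ultimately have "span (\<Union>\<D>) \<subseteq> {w \<in> M. \<rho> g w \<in> span (\<Union>\<D>)}" by (rule span_minimal[rotated])
    then show ?thesis using w by blast
  qed
  then show ?thesis by (simp add: gl_submodule_def)
qed

lemma \<beta>_add_right: "x \<in> K j \<Longrightarrow> y \<in> K j \<Longrightarrow> z \<in> K j \<Longrightarrow> \<beta> j z (x + y) = \<beta> j z x + \<beta> j z y"
  using \<beta>_add_left[of x j y z] \<beta>_commute[of z j] subspace_add[OF sub_subspace[OF submodule_K], of x j y]
  by simp

lemma \<beta>_scale_right: "x \<in> K j \<Longrightarrow> y \<in> K j \<Longrightarrow> \<beta> j y (s c x) = c * \<beta> j y x"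
  using \<beta>_scale_left[of x j y c] \<beta>_commute[of y j] subspace_scale[OF sub_subspace[OF submodule_K], of x j c]
  by simp

section \<open>Orthogonal complements of submodules\<close>

definition orth :: "'j \<Rightarrow> 'v set \<Rightarrow> 'v set" where
  "orth j W = {y \<in> K j. \<forall>u\<in>W. \<beta> j u y = 0}"

lemma sub_orth:
  assumes W: "sub W" "W \<subseteq> K j"
  shows "sub (orth j W)"
proof -
  have "\<beta> j u 0 = 0" if "u \<in> W" for u
    using \<beta>_scale_right[of 0 j u 0] that W sub_subspace[OF submodule_K] subspace_0 by auto
  then have "subspace (orth j W)"
    unfolding subspace_def orth_def
    using sub_subspace[OF submodule_K, of j] W(2)
    by (auto simp: subspace_0 subspace_add subspace_scale \<beta>_add_right \<beta>_scale_right subset_iff)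
  moreover have "\<rho> g y \<in> orth j W" if g: "g \<in> GL n" and y: "y \<in> orth j W" for g y
  proof -
    have yK: "y \<in> K j" using y by (simp add: orth_def)
    have "\<beta> j u (\<rho> g y) = 0" if u: "u \<in> W" for u
    proof -
      have "\<beta> j (\<rho> (transpose_mat g) u) y = \<beta> j u (\<rho> g y)"
        using contravariant[OF transpose_GL[OF g], of u j y] u W yK by auto
      moreover have "\<rho> (transpose_mat g) u \<in> W" using u W transpose_GL[OF g] sub_\<rho> by blast
      ultimately show ?thesis using y by (simp add: orth_def)
    qed
    then show ?thesis using sub_\<rho>[OF submodule_K g yK] by (simp add: orth_def)
  qed
  ultimately show ?thesis by (simp add: gl_submodule_def)
qed

lemma orth_Int:
  assumes W: "sub W" "W \<subseteq> K j"
  shows "W \<inter> orth j W = {0}"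
proof (rule ccontr)
  assume ne: "W \<inter> orth j W \<noteq> {0}"
  have "W \<inter> orth j W \<subseteq> M" using W K_le_M by blast
  then obtain \<alpha> w where w: "w \<in> W" "w \<in> orth j W" "hw \<alpha> w"
    using hw_exists[OF sub_Int[OF W(1) sub_orth[OF W]] _ ne] by blast
  then have "\<beta> j w w = 0" by (simp add: orth_def)
  then show False using hw_anisotropic w W by blast
qed

lemma orth_decomp:
  assumes W: "sub W" "W \<subseteq> K j" and x: "x \<in> K j"
  obtains w y where "w \<in> W" "y \<in> orth j W" "x = w + y"
proof -
  obtain E where E: "finite E" "K j \<subseteq> span E" using K_finite by blast
  have "\<exists>w\<in>W. \<forall>u\<in>W. \<beta> j u w = \<beta> j u x"
  proof (rule orthogonal_complement[OF sub_subspace[OF W(1)] _ E(1)])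
    fix u assume u: "u \<in> W" and *: "\<forall>w\<in>W. \<beta> j u w = 0"
    then have "u \<in> orth j W" using W(2) \<beta>_commute[of u j] by (auto simp: orth_def subset_iff)
    then show "u = 0" using u orth_Int[OF W] by blast
  qed (use E W x in \<open>auto simp: subset_iff \<beta>_add_right \<beta>_scale_right \<beta>_add_left \<beta>_scale_left\<close>)
  then obtain w where w: "w \<in> W" "\<forall>u\<in>W. \<beta> j u w = \<beta> j u x" by blast
  have K: "subspace (K j)" using sub_subspace submodule_K by blast
  have wK: "w \<in> K j" "s (-1) w \<in> K j" using w W(2) K subspace_scale by blast+
  have "\<beta> j u (x + s (-1) w) = 0" if "u \<in> W" for u
    using \<beta>_add_right[OF x wK(2), of u] \<beta>_scale_right[OF wK(1), of u "-1"] that w W by auto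
  then have "x - w \<in> orth j W"
    using x wK K by (auto simp: orth_def subspace_diff)
  then show ?thesis using that[of w "x - w"] w by simp
qed

text \<open>The splitting of \<open>K j\<close> into \<open>W\<close> and its complement is
  invariant, so the component of \<open>w\<close> in \<open>W\<close> is an eigenvector for the same
  character. If it were nonzero, uniqueness would make \<open>w\<close> a multiple of it and put
  \<open>w\<close> into \<open>W\<close>.\<close>

lemma hw_orth:
  assumes W: "sub W" "W \<subseteq> K j" and w: "w \<in> K j" "hw \<alpha> w" "w \<notin> W"
  shows "w \<in> orth j W"
proof -
  obtain u y where uy: "u \<in> W" "y \<in> orth j W" "w = u + y"
    using orth_decomp[OF W w(1)] by blast
  have uM: "u \<in> M" "y \<in> M" "u \<in> K j" "y \<in> K j" using uy W K_le_M by (auto simp: orth_def)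
  have "\<rho> g u = s (\<Prod>i<n. (g $$ (i, i)) powi (\<alpha> ! i)) u"
    if g: "g \<in> GL n" "upper_triangular g" for g
  proof -
    let ?c = "\<Prod>i<n. (g $$ (i, i)) powi (\<alpha> ! i)"
    have "\<rho> g w = s ?c w" using w(2) g by (simp add: hw_vector_def)
    then have "\<rho> g u + \<rho> g y = s ?c u + s ?c y"
      using \<rho>_add[OF g(1) uM(1,2)] uy(3) by (simp add: scale_right_distrib)
    then have eq: "\<rho> g u - s ?c u = s ?c y - \<rho> g y" by (simp add: algebra_simps)
    have "\<rho> g u - s ?c u \<in> W"
      using sub_\<rho>[OF W(1) g(1)] uy sub_subspace[OF W(1)] subspace_diff subspace_scale by blast
    moreover have "s ?c y - \<rho> g y \<in> orth j W"
      using sub_\<rho>[OF sub_orth[OF W] g(1)] uy sub_subspace[OF sub_orth[OF W]] subspace_diff subspace_scale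
      by blast
    ultimately have "\<rho> g u - s ?c u = 0" using orth_Int[OF W] eq by (metis IntI singletonD)
    then show ?thesis by simp
  qed
  then have "u = 0 \<or> hw \<alpha> u" using w(2) by (auto simp: hw_vector_def)
  moreover have "\<not> hw \<alpha> u"
  proof
    assume "hw \<alpha> u"
    then obtain c where "w = s c u" using hw_unique[OF uM(1), of w \<alpha>] w K_le_M by blast
    then show False using w(3) uy(1) sub_subspace[OF W(1)] subspace_scale by blast
  qed
  ultimately show ?thesis using uy by simp
qed

section \<open>Irreducible submodules and decompositions\<close>

lemma irr_Int_sub:
  assumes "irr W" "sub U" "w \<in> W" "w \<in> U" "w \<noteq> 0"
  shows "W \<subseteq> U"
proof -
  have "sub (W \<inter> U)" using assms sub_Int by (simp add: gl_irreducible_def)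
  then have "W \<inter> U = {0} \<or> W \<inter> U = W" using assms(1) by (auto simp: gl_irreducible_def)
  then show ?thesis using assms by blast
qed

lemma irr_hw:
  assumes "irr W" "W \<subseteq> M"
  obtains \<alpha> w where "w \<in> W" "hw \<alpha> w"
  using hw_exists[of W] assms by (auto simp: gl_irreducible_def)

lemma irr_sub: "irr W \<Longrightarrow> sub W"
  by (simp add: gl_irreducible_def)

lemma irr_eqI: "irr W \<Longrightarrow> irr W' \<Longrightarrow> w \<in> W \<Longrightarrow> w \<in> W' \<Longrightarrow> w \<noteq> 0 \<Longrightarrow> W = W'"
  using irr_Int_sub irr_sub by (metis subset_antisym)

lemma irr_eq_hw:
  assumes "irr W" "irr W'" "W \<subseteq> M" "W' \<subseteq> M" "w \<in> W" "w' \<in> W'" "hw \<alpha> w" "hw \<alpha> w'"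
  shows "W = W'"
proof -
  obtain c where c: "w' = s c w" using hw_unique assms by blast
  then have "w' \<in> W" using assms irr_sub sub_subspace subspace_scale by blast
  then show ?thesis using irr_eqI[of W W' w'] assms by (simp add: hw_vector_def)
qed

text \<open>A highest weight vector of \<open>W'\<close> lies outside \<open>W\<close>, as otherwise
  the two would coincide. It is then orthogonal to \<open>W\<close>, and by irreducibility so is all
  of \<open>W'\<close>. It is enough that the two differ as subspaces, whatever their
  weights.\<close>

lemma irr_orth:
  assumes "irr W" "irr W'" "W \<subseteq> K j" "W' \<subseteq> K j" "W \<noteq> W'"
  shows "W' \<subseteq> orth j W"
proof -
  have "W' \<subseteq> M" using assms(4) K_le_M by (rule subset_trans)
  then obtain \<alpha> w where w: "w \<in> W'" "hw \<alpha> w" using irr_hw[OF assms(2)] by metis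
  then have nz: "w \<noteq> 0" by (simp add: hw_vector_def)
  have "w \<notin> W" using irr_eqI assms w nz by blast
  then have "w \<in> orth j W" using hw_orth[OF irr_sub[OF assms(1)] assms(3)] w assms by blast
  then show ?thesis using irr_Int_sub[OF assms(2) sub_orth[OF irr_sub[OF assms(1)] assms(3)]] w nz by blast
qed

lemma irr_exists:
  assumes W: "sub W" "W \<subseteq> K j" "W \<noteq> {0}"
  obtains U where "irr U" "U \<subseteq> W"
proof -
  obtain E where E: "finite E" "K j \<subseteq> span E" using K_finite by blast
  define P where "P U \<longleftrightarrow> sub U \<and> U \<subseteq> W \<and> U \<noteq> {0}" for U
  have "P W" using W by (simp add: P_def)
  then obtain U where U: "P U" "\<forall>U'. P U' \<longrightarrow> dim U \<le> dim U'"
    using ex_has_least_nat[of P W dim] by blast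
  have "U' = U" if "sub U'" "U' \<subseteq> U" "U' \<noteq> {0}" for U'
  proof (rule ccontr)
    assume "U' \<noteq> U"
    then have "dim U' < dim U"
      using dim_less[of U' U E] that U(1) E W by (auto simp: P_def sub_subspace)
    moreover have "P U'" using that U(1) by (auto simp: P_def)
    ultimately show False using U(2) by fastforce
  qed
  then have "irr U" using U(1) by (auto simp: gl_irreducible_def P_def)
  then show ?thesis using that U(1) by (auto simp: P_def)
qed

text \<open>If the span \<open>S\<close> of all irreducibles did not fill the level
  \<open>K j\<close>, the complement of \<open>S\<close> in \<open>K j\<close> would contain a
  further irreducible, which would lie in \<open>S\<close> as well.\<close>

lemma irr_span: "span (\<Union>{W. irr W \<and> W \<subseteq> M}) = M"
proof
  let ?D = "{W. irr W \<and> W \<subseteq> M}"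
  have subD: "sub (span (\<Union>?D))" by (rule sub_span) (auto simp: irr_sub)
  show "span (\<Union>?D) \<subseteq> M"
    using sub_subspace[OF submodule_M] by (intro span_minimal) auto
  show "M \<subseteq> span (\<Union>?D)"
  proof
    fix x assume "x \<in> M"
    then obtain j where j: "x \<in> K j" using K_directed[of "{x}"] by auto
    define S where "S = K j \<inter> span (\<Union>?D)"
    have S: "sub S" "S \<subseteq> K j" using subD submodule_K sub_Int by (auto simp: S_def)
    have "orth j S = {0}"
    proof (rule ccontr)
      assume "orth j S \<noteq> {0}"
      then obtain U where U: "irr U" "U \<subseteq> orth j S"
        using irr_exists[OF sub_orth[OF S]] by (metis (no_types, lifting) orth_def mem_Collect_eq subsetI)
      then have "U \<subseteq> K j" by (auto simp: orth_def)
      moreover have "U \<subseteq> \<Union>?D" using U(1) \<open>U \<subseteq> K j\<close> K_le_M[of j] by blast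
      ultimately have "U \<subseteq> S" using span_superset[of "\<Union>?D"] unfolding S_def by blast
      then have "U \<subseteq> {0}" using U orth_Int[OF S] by blast
      moreover have "0 \<in> U" using U irr_sub sub_subspace subspace_0 by blast
      ultimately show False using U by (auto simp: gl_irreducible_def)
    qed
    then have "x \<in> S" using orth_decomp[OF S j] by (metis add.right_neutral singletonD)
    then show "x \<in> span (\<Union>?D)" by (simp add: S_def)
  qed
qed

text \<open>Puts each irreducible submodule inside one finite-dimensional level, where a form is
  available.\<close>

lemma irr_le_K:
  assumes "irr W" "w \<in> W" "w \<noteq> 0" "w \<in> K j"
  shows "W \<subseteq> K j"
  using irr_Int_sub[OF assms(1) submodule_K] assms by blast

lemma irr_nonzero:
  assumes "irr W" obtains w where "w \<in> W" "w \<noteq> 0"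
  using assms sub_subspace subspace_0 by (auto simp: gl_irreducible_def)

lemma span_finite_subset: "x \<in> span S \<Longrightarrow> \<exists>T. finite T \<and> T \<subseteq> S \<and> x \<in> span T"
  unfolding span_explicit by blast

lemma irr_orth_span:
  assumes W: "irr W" "W \<subseteq> K j" and \<D>: "\<And>W. W \<in> \<D> \<Longrightarrow> irr W" "W \<notin> \<D>"
    and T: "T \<subseteq> \<Union>\<D>" "T \<subseteq> K j"
  shows "span T \<subseteq> orth j W"
proof (rule span_minimal)
  have subO: "subspace (orth j W)" using sub_subspace sub_orth irr_sub W by blast
  show "T \<subseteq> orth j W"
  proof
    fix t assume "t \<in> T"
    then obtain W' where W': "W' \<in> \<D>" "t \<in> W'" "t \<in> K j" using T by blast
    show "t \<in> orth j W"
    proof (cases "t = 0")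
      case True
      then show ?thesis using subO subspace_0 by simp
    next
      case False
      then have "W' \<subseteq> K j" using irr_le_K W' \<D>(1) by blast
      then show ?thesis using irr_orth[of W W' j] W' W \<D> by blast
    qed
  qed
  show "subspace (orth j W)" by (fact subO)
qed

text \<open>A linear relation involves finitely many vectors, hence takes place in one level, and
  there distinct irreducibles are orthogonal.\<close>

lemma irr_independent:
  assumes \<D>: "\<And>W. W \<in> \<D> \<Longrightarrow> irr W" "\<And>W. W \<in> \<D> \<Longrightarrow> W \<subseteq> M" and W: "W \<in> \<D>"
  shows "W \<inter> span (\<Union>(\<D> - {W})) = {0}"
proof -
  have "x = 0" if x: "x \<in> W" "x \<in> span (\<Union>(\<D> - {W}))" for x
  proof -
    obtain T where T: "finite T" "T \<subseteq> \<Union>(\<D> - {W})" "x \<in> span T" using span_finite_subset x(2) by blast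
    obtain w where w: "w \<in> W" "w \<noteq> 0" using irr_nonzero \<D> W by blast
    have "insert w T \<subseteq> M" using w W \<D> T by blast
    then obtain j where j: "insert w T \<subseteq> K j" using K_directed[of "insert w T"] T(1) by blast
    have WK: "W \<subseteq> K j" using irr_le_K[OF \<D>(1)[OF W] w] j by blast
    have "x \<in> orth j W"
      using irr_orth_span[of W j "\<D> - {W}" T] \<D> W WK T j by blast
    then show ?thesis using orth_Int[OF irr_sub[OF \<D>(1)[OF W]] WK] x by blast
  qed
  moreover have "0 \<in> W" using \<D> W irr_sub sub_subspace subspace_0 by blast
  ultimately show ?thesis using span_zero by blast
qed

text \<open>A highest weight vector is never spread over several summands: outside all of them it
  would be orthogonal to each, hence to their span, hence to itself.\<close>

lemma hw_in_decomposition: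
  assumes \<D>: "irreducible_decomposition n s \<rho> M \<D>" and w: "w \<in> M" "hw \<alpha> w"
  obtains W where "W \<in> \<D>" "w \<in> W"
proof -
  have irrD: "irr W" "W \<subseteq> M" if "W \<in> \<D>" for W
    using \<D> that by (auto simp: irreducible_decomposition_def intro: span_base)
  have "w \<in> span (\<Union>\<D>)" using \<D> w by (simp add: irreducible_decomposition_def)
  then obtain T where T: "finite T" "T \<subseteq> \<Union>\<D>" "w \<in> span T" using span_finite_subset by blast
  then have "insert w T \<subseteq> M" using w irrD by blast
  then obtain j where j: "insert w T \<subseteq> K j" using K_directed[of "insert w T"] T(1) by blast
  have "\<exists>W\<in>\<D>. w \<in> W"
  proof (rule ccontr)
    assume no: "\<not> ?thesis"
    have "t \<in> {t \<in> K j. \<beta> j w t = 0}" if t: "t \<in> T" for t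
    proof -
      obtain W where W: "W \<in> \<D>" "t \<in> W" using t T by blast
      have tK: "t \<in> K j" using t j by blast
      show ?thesis
      proof (cases "t = 0")
        case True
        then show ?thesis using \<beta>_scale_right[of 0 j w 0] j tK by auto
      next
        case False
        then have WK: "W \<subseteq> K j" using irr_le_K irrD W tK by blast
        have "w \<in> orth j W" using hw_orth[OF irr_sub[OF irrD(1)[OF W(1)]] WK _ w(2)] j no W(1) by blast
        then have "\<beta> j t w = 0" using W(2) by (simp add: orth_def)
        then show ?thesis using \<beta>_commute j tK by auto
      qed
    qed
    moreover have "subspace {t \<in> K j. \<beta> j w t = 0}"
      using sub_subspace[OF submodule_K, of j] j \<beta>_scale_right[of 0 j w 0]
      by (auto simp: subspace_def \<beta>_add_right \<beta>_scale_right)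
    ultimately have "span T \<subseteq> {t \<in> K j. \<beta> j w t = 0}" by (intro span_minimal) auto
    then have "\<beta> j w w = 0" using T(3) by blast
    then show False using hw_anisotropic w(2) j by blast
  qed
  then show ?thesis using that by blast
qed

lemma isomorphic_hw:
  assumes W: "sub W" "sub W'" and iso: "gl_isomorphic n s \<rho> W W'" and w: "w \<in> W" "hw \<alpha> w"
  shows "\<exists>w'\<in>W'. hw \<alpha> w'"
proof -
  obtain f where f: "bij_betw f W W'" "\<forall>a. \<forall>w\<in>W. f (s a w) = s a (f w)"
      "\<forall>g\<in>GL n. \<forall>w\<in>W. f (\<rho> g w) = \<rho> g (f w)"
    using iso unfolding gl_isomorphic_def by blast
  have "0 \<in> W" using W sub_subspace subspace_0 by blast
  then have "f 0 = 0" using f(2) by (metis scale_zero_left)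
  then have "f w \<noteq> 0" using f(1) w \<open>0 \<in> W\<close> by (metis bij_betw_imp_inj_on hw_vector_def inj_onD)
  moreover have "f w \<in> W'" using f(1) w bij_betwE by blast
  moreover have "\<rho> g (f w) = s (\<Prod>i<n. (g $$ (i, i)) powi (\<alpha> ! i)) (f w)"
    if "g \<in> GL n" "upper_triangular g" for g
  proof -
    have "\<rho> g w = s (\<Prod>i<n. (g $$ (i, i)) powi (\<alpha> ! i)) w" using w(2) that by (simp add: hw_vector_def)
    then show ?thesis using f(2,3) w(1) that(1) by metis
  qed
  ultimately show ?thesis using w(2) by (auto simp: hw_vector_def)
qed

theorem simple_spectrum: "simple_spectrum n s \<rho> M"
  unfolding simple_spectrum_def
proof (intro conjI allI impI ballI)
  \<comment> \<open>The set of all irreducible submodules is itself a decomposition, since distinct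
    ones are independent.\<close>
  have "irreducible_decomposition n s \<rho> M {W. irr W \<and> W \<subseteq> M}"
    unfolding irreducible_decomposition_def using irr_span irr_independent[of "{W. irr W \<and> W \<subseteq> M}"] by blast
  then show "\<exists>\<D>. irreducible_decomposition n s \<rho> M \<D>" by blast
next
  fix \<D> W W'
  assume \<D>: "irreducible_decomposition n s \<rho> M \<D>" and W: "W \<in> \<D>" "W' \<in> \<D>"
    and iso: "gl_isomorphic n s \<rho> W W'"
  have irrD: "irr W" "W \<subseteq> M" if "W \<in> \<D>" for W
    using \<D> that by (auto simp: irreducible_decomposition_def intro: span_base)
  obtain \<alpha> w where w: "w \<in> W" "hw \<alpha> w" using irr_hw[OF irrD[OF W(1)]] by metis
  then show "W = W'"
    using isomorphic_hw[OF irr_sub irr_sub iso w] irr_eq_hw[of W W' w] irrD W by blast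
qed

lemma is_Sigma_iff:
  "is_Sigma n s \<rho> \<alpha> W \<longleftrightarrow> irr W \<and> gl_rational n s \<rho> W \<and> (\<exists>w\<in>W. hw \<alpha> w)"
  by (auto simp: is_Sigma_def has_highest_weight_def hw_vector_def)

theorem decomposition_weights:
  assumes \<D>: "irreducible_decomposition n s \<rho> M \<D>"
    and rational: "\<And>W. sub W \<Longrightarrow> W \<subseteq> M \<Longrightarrow> gl_rational n s \<rho> W"
  shows "\<lbrakk>W \<in> \<D>; W' \<in> \<D>; is_Sigma n s \<rho> \<alpha> W; is_Sigma n s \<rho> \<alpha> W'\<rbrakk> \<Longrightarrow> W = W'"
    and "(\<exists>W\<in>\<D>. is_Sigma n s \<rho> \<alpha> W) \<longleftrightarrow> (\<exists>w\<in>M. hw \<alpha> w)"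
proof -
  have irrD: "irr W" "W \<subseteq> M" if "W \<in> \<D>" for W
    using \<D> that by (auto simp: irreducible_decomposition_def intro: span_base)
  show "W = W'" if "W \<in> \<D>" "W' \<in> \<D>" "is_Sigma n s \<rho> \<alpha> W" "is_Sigma n s \<rho> \<alpha> W'"
  proof -
    obtain w w' where "w \<in> W" "hw \<alpha> w" "w' \<in> W'" "hw \<alpha> w'"
      using \<open>is_Sigma n s \<rho> \<alpha> W\<close> \<open>is_Sigma n s \<rho> \<alpha> W'\<close> unfolding is_Sigma_iff by auto
    then show ?thesis using irr_eq_hw[of W W' w w' \<alpha>] irrD that(1,2) by simp
  qed
  show "(\<exists>W\<in>\<D>. is_Sigma n s \<rho> \<alpha> W) \<longleftrightarrow> (\<exists>w\<in>M. hw \<alpha> w)"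
  proof
    assume "\<exists>W\<in>\<D>. is_Sigma n s \<rho> \<alpha> W"
    then show "\<exists>w\<in>M. hw \<alpha> w" using irrD(2) unfolding is_Sigma_iff by fast
  next
    assume "\<exists>w\<in>M. hw \<alpha> w"
    then obtain w where w: "w \<in> M" "hw \<alpha> w" by auto
    then obtain W where W: "W \<in> \<D>" "w \<in> W" using hw_in_decomposition[OF \<D>] by metis
    then have "is_Sigma n s \<rho> \<alpha> W"
      using irrD[OF W(1)] rational[OF irr_sub] w(2) unfolding is_Sigma_iff by auto
    then show "\<exists>W\<in>\<D>. is_Sigma n s \<rho> \<alpha> W" using W(1) by auto
  qed
qed

end

section \<open>Polynomials\<close>

abbreviation "lookup \<equiv> Poly_Mapping.lookup"
abbreviation "keys \<equiv> Poly_Mapping.keys"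
abbreviation "single \<equiv> Poly_Mapping.single"

lemma poly_mapping_sum_single:
  fixes P :: "'a \<Rightarrow>\<^sub>0 'b::comm_monoid_add"
  shows "(\<Sum>m\<in>keys P. single m (lookup P m)) = P"
proof (rule poly_mapping_eqI)
  fix k
  show "lookup (\<Sum>m\<in>keys P. single m (lookup P m)) k = lookup P k"
    by (simp add: lookup_sum lookup_single when_def in_keys_iff)
qed

lemma monomial_induct [case_names zero add]:
  fixes m :: "nat \<Rightarrow>\<^sub>0 nat"
  assumes "Q 0" "\<And>m v. Q m \<Longrightarrow> Q (m + single v 1)"
  shows "Q m"
proof (induction "\<Sum>v\<in>keys m. lookup m v" arbitrary: m)
  case 0
  then have "m = 0" by (auto simp: poly_mapping_eq_iff fun_eq_iff in_keys_iff)
  then show ?case using assms(1) by simp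
next
  case (Suc d)
  then obtain v where v: "v \<in> keys m" by fastforce
  define m' where "m' = m - single v 1"
  have m: "m = m' + single v 1"
    by (rule poly_mapping_eqI)
       (use v in \<open>auto simp: m'_def lookup_add lookup_minus lookup_single when_def in_keys_iff\<close>)
  have "(\<Sum>u\<in>keys m. lookup m u) = (\<Sum>u\<in>keys m. lookup m' u) + (\<Sum>u\<in>keys m. lookup (single v 1) u)"
    unfolding sum.distrib[symmetric] by (subst m) (simp add: lookup_add)
  also have "(\<Sum>u\<in>keys m. lookup (single v 1) u) = 1"
    using v by (simp add: lookup_single when_def)
  also have "(\<Sum>u\<in>keys m. lookup m' u) = (\<Sum>u\<in>keys m'. lookup m' u)"
    by (rule sum.mono_neutral_right) (auto simp: m lookup_add in_keys_iff)
  finally have "d = (\<Sum>u\<in>keys m'. lookup m' u)" using Suc.hyps(2) by simp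
  then show ?case using Suc.hyps(1) assms(2) m by metis
qed

text \<open>The first case offers only monomials of \<open>P\<close>, so a condition on the support
  of \<open>P\<close> need not be carried through the sums.\<close>

lemma mpoly_add_induct [case_names single add]:
  fixes P :: "'a \<Rightarrow>\<^sub>0 'b::comm_monoid_add"
  assumes "\<And>m c. m \<in> keys P \<Longrightarrow> Q (single m c)"
    and "\<And>A B. Q A \<Longrightarrow> Q B \<Longrightarrow> Q (A + B)" and "Q 0"
  shows "Q P"
proof -
  have "Q (\<Sum>m\<in>S. single m (lookup P m))" if "finite S" "S \<subseteq> keys P" for S
    using that by (induction rule: finite_induct) (auto intro: assms)
  then show ?thesis using poly_mapping_sum_single[of P] by (metis finite_keys subset_refl)
qed

lemma Const_simps [simp]:
  "Const 0 = 0" "Const 1 = 1"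
  "Const (a + b) = Const a + Const b" "Const (a * b) = Const a * Const b"
  "Const (- a) = - Const a" "Const (a - b) = Const a - Const b"
  by (simp_all add: Const_def single_add mult_single single_uminus single_diff)

lemma Const_sum: "Const (\<Sum>i\<in>A. f i) = (\<Sum>i\<in>A. Const (f i))"
  by (induction A rule: infinite_finite_induct) auto

lemma Const_prod: "Const (\<Prod>i\<in>A. f i) = (\<Prod>i\<in>A. Const (f i))"
  by (induction A rule: infinite_finite_induct) auto

lemma Const_power: "Const (a ^ k) = Const a ^ k"
  by (induction k) auto

lemma lookup_Const_mult [simp]: "lookup (Const c * P) m = c * lookup P m"
  unfolding Const_def mult_map_scale_conv_mult[symmetric] by (simp add: Poly_Mapping.map.rep_eq when_def)

lemma single_add_Var: "single (m + single v 1) c = Var v * single m c"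
  by (simp add: Var_def mult_single add.commute)

lemma single_0_Const: "single 0 c = Const c"
  by (simp add: Const_def)

definition poly_over :: "nat set \<Rightarrow> 'k::field mpoly set" where
  "poly_over V = {P. \<forall>m\<in>keys P. keys m \<subseteq> V}"

lemma poly_zzd_poly_over: "poly_zzd n = poly_over {..<2 * n}"
  by (simp add: poly_zzd_def poly_over_def)

lemma keys_add_nat: "keys (m + m' :: nat \<Rightarrow>\<^sub>0 nat) = keys m \<union> keys m'"
  by (auto simp: in_keys_iff lookup_add)

lemma mpoly_Var_induct [consumes 1, case_names Const add Var]:
  fixes P :: "'k::field mpoly"
  assumes P: "P \<in> poly_over V"
    and "\<And>c. Q (Const c)" "\<And>A B. Q A \<Longrightarrow> Q B \<Longrightarrow> Q (A + B)" "\<And>v A. v \<in> V \<Longrightarrow> Q A \<Longrightarrow> Q (Var v * A)"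
  shows "Q P"
proof (induction P rule: mpoly_add_induct)
  case (single m c)
  then have "keys m \<subseteq> V" using P by (auto simp: poly_over_def)
  then show ?case
  proof (induction m rule: monomial_induct)
    case zero
    then show ?case using assms(2) by (simp add: single_0_Const)
  next
    case (add m v)
    then show ?case unfolding single_add_Var by (intro assms(4)) (auto simp: keys_add_nat)
  qed
qed (use assms(2)[of 0] assms(3) in auto)

subsection \<open>Evaluation and substitution\<close>

definition mono_val :: "(nat \<Rightarrow> 'b::comm_monoid_mult) \<Rightarrow> (nat \<Rightarrow>\<^sub>0 nat) \<Rightarrow> 'b" where
  "mono_val x m = (\<Prod>v\<in>keys m. x v ^ lookup m v)"

lemma mono_val_superset:
  "finite S \<Longrightarrow> keys m \<subseteq> S \<Longrightarrow> mono_val x m = (\<Prod>v\<in>S. x v ^ lookup m v)"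
  unfolding mono_val_def by (rule prod.mono_neutral_left) (auto simp: in_keys_iff)

lemma mono_val_0 [simp]: "mono_val x 0 = 1"
  by (simp add: mono_val_def)

lemma mono_val_add: "mono_val x (m + m') = mono_val x m * mono_val x m'"
proof -
  have "finite (keys m \<union> keys m')" by simp
  note * = mono_val_superset[OF this]
  show ?thesis
    by (subst (1 2 3) *) (auto simp: keys_add_nat lookup_add power_add prod.distrib)
qed

lemma mono_val_single [simp]: "mono_val x (single v k) = x v ^ k"
  by (cases "k = 0") (simp_all add: mono_val_def)

text \<open>One notion for two uses: \<open>\<phi> = id\<close> gives evaluation at a point,
  \<open>\<phi> = Const\<close> gives substitution of polynomials.\<close>

definition coeff_eval :: "('k::field \<Rightarrow> 'b::comm_ring_1) \<Rightarrow> (nat \<Rightarrow> 'b) \<Rightarrow> 'k mpoly \<Rightarrow> 'b" where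
  "coeff_eval \<phi> x P = (\<Sum>m\<in>keys P. \<phi> (lookup P m) * mono_val x m)"

locale coeff_hom =
  fixes \<phi> :: "'k::field \<Rightarrow> 'b::comm_ring_1"
  assumes hom_0: "\<phi> 0 = 0" and hom_1: "\<phi> 1 = 1"
    and hom_add: "\<phi> (a + b) = \<phi> a + \<phi> b" and hom_mult: "\<phi> (a * b) = \<phi> a * \<phi> b"
begin

lemma eval_superset:
  "finite S \<Longrightarrow> keys P \<subseteq> S \<Longrightarrow> coeff_eval \<phi> x P = (\<Sum>m\<in>S. \<phi> (lookup P m) * mono_val x m)"
  unfolding coeff_eval_def by (rule sum.mono_neutral_left) (auto simp: in_keys_iff hom_0)

lemma eval_add: "coeff_eval \<phi> x (P + Q) = coeff_eval \<phi> x P + coeff_eval \<phi> x Q"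
proof -
  have "finite (keys P \<union> keys Q)" by simp
  note * = eval_superset[OF this]
  show ?thesis
    by (subst (1 2 3) *) (auto simp: lookup_add hom_add ring_distribs sum.distrib keys_add)
qed

lemma eval_0: "coeff_eval \<phi> x 0 = 0"
  by (simp add: coeff_eval_def)

lemma eval_single: "coeff_eval \<phi> x (single m c) = \<phi> c * mono_val x m"
  by (cases "c = 0") (simp_all add: coeff_eval_def hom_0)

lemma eval_Const: "coeff_eval \<phi> x (Const c) = \<phi> c"
  by (simp add: Const_def eval_single)

lemma eval_Var: "coeff_eval \<phi> x (Var v) = x v"
  by (simp add: Var_def eval_single hom_1)

lemma eval_mult: "coeff_eval \<phi> x (P * Q) = coeff_eval \<phi> x P * coeff_eval \<phi> x Q"
proof (induction P rule: mpoly_add_induct)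
  case (single m c)
  show ?case
  proof (induction Q rule: mpoly_add_induct)
    case (single m' c')
    show ?case by (simp add: mult_single eval_single hom_mult mono_val_add mult_ac)
  qed (simp_all add: ring_distribs eval_add eval_0)
qed (simp_all add: ring_distribs eval_add eval_0)

lemma eval_1: "coeff_eval \<phi> x 1 = 1"
  using eval_Const[of x 1] hom_1 by simp

lemma eval_sum: "coeff_eval \<phi> x (\<Sum>i\<in>A. f i) = (\<Sum>i\<in>A. coeff_eval \<phi> x (f i))"
  by (induction A rule: infinite_finite_induct) (auto simp: eval_0 eval_add)

lemma eval_prod: "coeff_eval \<phi> x (\<Prod>i\<in>A. f i) = (\<Prod>i\<in>A. coeff_eval \<phi> x (f i))"
  by (induction A rule: infinite_finite_induct) (auto simp: eval_1 eval_mult)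

lemma eval_power: "coeff_eval \<phi> x (P ^ k) = coeff_eval \<phi> x P ^ k"
  by (induction k) (auto simp: eval_1 eval_mult)

lemma eval_uminus: "coeff_eval \<phi> x (- P) = - coeff_eval \<phi> x P"
  using eval_add[of x P "- P"] by (simp add: eval_0 add_eq_0_iff)

lemma eval_diff: "coeff_eval \<phi> x (P - Q) = coeff_eval \<phi> x P - coeff_eval \<phi> x Q"
  using eval_add[of x P "- Q"] by (simp add: eval_uminus)

lemmas eval_simps = eval_0 eval_1 eval_add eval_mult eval_uminus eval_diff eval_Const eval_Var
  eval_sum eval_prod eval_power

end

definition eval :: "(nat \<Rightarrow> 'k::field) \<Rightarrow> 'k mpoly \<Rightarrow> 'k" where
  "eval x P = coeff_eval id x P"

interpretation hom_id: coeff_hom "id :: 'k::field \<Rightarrow> 'k"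
  by unfold_locales auto

interpretation hom_Const: coeff_hom "Const :: 'k::field \<Rightarrow> 'k mpoly"
  by unfold_locales auto

lemma poly_subst_coeff_eval: "poly_subst \<sigma> P = coeff_eval Const \<sigma> P"
  by (simp add: poly_subst_def coeff_eval_def mono_val_def)

lemmas eval_simps [simp] = hom_id.eval_simps[folded eval_def, unfolded id_apply]
lemmas subst_simps [simp] = hom_Const.eval_simps[folded poly_subst_coeff_eval]
lemmas eval_single = hom_id.eval_single[folded eval_def, unfolded id_apply]
lemmas subst_single = hom_Const.eval_single[folded poly_subst_coeff_eval]

lemma poly_over_UNIV: "P \<in> poly_over UNIV"
  by (simp add: poly_over_def)

lemma eval_subst: "eval x (poly_subst \<sigma> P) = eval (\<lambda>v. eval x (\<sigma> v)) P"
  by (induction P rule: mpoly_Var_induct[OF poly_over_UNIV]) auto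

lemma subst_subst: "poly_subst \<tau> (poly_subst \<sigma> P) = poly_subst (\<lambda>v. poly_subst \<tau> (\<sigma> v)) P"
  by (induction P rule: mpoly_Var_induct[OF poly_over_UNIV]) auto

lemma subst_Var: "poly_subst Var P = P"
  by (induction P rule: mpoly_Var_induct[OF poly_over_UNIV]) auto

lemma eval_cong: "P \<in> poly_over V \<Longrightarrow> (\<And>v. v \<in> V \<Longrightarrow> x v = y v) \<Longrightarrow> eval x P = eval y P"
  by (induction P rule: mpoly_Var_induct) auto

lemma lookup_diag_subst:
  "lookup (poly_subst (\<lambda>v. Const (c v) * Var v) P) m = mono_val c m * lookup P m"
proof -
  have *: "mono_val (\<lambda>v. Const (c v) * Var v) m = single m (mono_val c m)" for m
  proof (induction m rule: monomial_induct)
    case zero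
    then show ?case by simp
  next
    case (add m v)
    then show ?case
      by (simp add: mono_val_add Const_def Var_def mult_single add.commute mult.commute)
  qed
  have "poly_subst (\<lambda>v. Const (c v) * Var v) P = (\<Sum>m\<in>keys P. Const (lookup P m) * single m (mono_val c m))"
    by (simp add: poly_subst_coeff_eval coeff_eval_def *)
  then show ?thesis
    by (simp add: lookup_sum lookup_single when_def if_distrib[of "(*) _"] in_keys_iff cong: if_cong)
qed

subsection \<open>Gradings\<close>

text \<open>Degrees lie in an arbitrary commutative monoid, so that the same lemmas serve integers,
  natural numbers and functions of the variables.\<close>

locale grading =
  fixes deg :: "(nat \<Rightarrow>\<^sub>0 nat) \<Rightarrow> 'd::comm_monoid_add"
  assumes deg_0: "deg 0 = 0" and deg_add: "deg (a + b) = deg a + deg b"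
begin

definition hom :: "'d \<Rightarrow> 'k::field mpoly \<Rightarrow> bool" where
  "hom d P \<longleftrightarrow> (\<forall>m\<in>keys P. deg m = d)"

lemma hom_mult: "hom d P \<Longrightarrow> hom e Q \<Longrightarrow> hom (d + e) (P * Q)"
  unfolding hom_def using keys_mult[of P Q] by (fastforce simp: deg_add)

lemma hom_add: "hom d P \<Longrightarrow> hom d Q \<Longrightarrow> hom d (P + Q)"
  unfolding hom_def using keys_add[of P Q] by blast

lemma hom_0: "hom d 0"
  by (simp add: hom_def)

lemma hom_sum: "(\<And>i. i \<in> A \<Longrightarrow> hom d (f i)) \<Longrightarrow> hom d (\<Sum>i\<in>A. f i)"
  by (induction A rule: infinite_finite_induct) (auto simp: hom_0 hom_add)

lemma hom_Const: "hom 0 (Const c)"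
  by (cases "c = 0") (simp_all add: Const_def hom_def deg_0)

lemma hom_Const_mult: "hom d P \<Longrightarrow> hom d (Const c * P)"
  using hom_mult[OF hom_Const] by force

lemma hom_Var: "hom (deg (single v 1)) (Var v)"
  by (simp add: Var_def hom_def)

lemma hom_mono_val:
  assumes "\<And>v. hom (deg (single v 1)) (\<sigma> v)"
  shows "hom (deg m) (mono_val \<sigma> m)"
proof (induction m rule: monomial_induct)
  case zero
  then show ?case using hom_Const[of 1] by (simp add: deg_0)
next
  case (add m v)
  then show ?case using assms by (simp add: mono_val_add deg_add hom_mult)
qed

text \<open>Stated for each monomial of the result rather than for homogeneous \<open>P\<close>, so
  that it preserves degree bounds as well as homogeneity.\<close>

lemma keys_subst:
  assumes "\<And>v. hom (deg (single v 1)) (\<sigma> v)" and "m' \<in> keys (poly_subst \<sigma> P)"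
  shows "\<exists>m\<in>keys P. deg m' = deg m"
proof -
  have "keys (poly_subst \<sigma> P) \<subseteq> (\<Union>m\<in>keys P. keys (Const (lookup P m) * mono_val \<sigma> m))"
    unfolding poly_subst_coeff_eval coeff_eval_def by (rule keys_sum)
  then obtain m where m: "m \<in> keys P" "m' \<in> keys (Const (lookup P m) * mono_val \<sigma> m)"
    using assms(2) by blast
  then have "deg m' = deg m"
    using hom_Const_mult[OF hom_mono_val[OF assms(1)]] unfolding hom_def by blast
  then show ?thesis using m by blast
qed

end

subsection \<open>Graded pieces\<close>

text \<open>Characteristic 0 enters the separation of weights here: 2 has infinite order in the
  multiplicative group of the field.\<close>

lemma two_powi_inj: "(2 :: 'k::field_char_0) powi a = 2 powi b \<longleftrightarrow> a = b"
proof -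
  have *: "a = b" if "(2 :: 'k) powi a = 2 powi b" "a \<le> b" for a b :: int
  proof -
    have "(2 :: 'k) powi (b - a) = 1" using that(1) by (simp add: power_int_diff)
    then have "(2 :: 'k) ^ nat (b - a) = 1" using that(2) by (simp add: power_int_def)
    then have "(of_nat (2 ^ nat (b - a)) :: 'k) = of_nat 1" by simp
    then have "(2 :: nat) ^ nat (b - a) = 1" by (simp only: of_nat_eq_iff)
    then show ?thesis using that(2) by simp
  qed
  show ?thesis using *[of a b] *[of b a] by (metis linear)
qed

text \<open>The eigenvalues \<open>2 powi d\<close> of a rescaling are distinct, so eigencomponents are polynomials in it.\<close>
lemma graded_component:
  fixes W :: "('x \<Rightarrow> 'k::field_char_0) set" and deg :: "'x \<Rightarrow> int"
  assumes add: "\<And>f g. f \<in> W \<Longrightarrow> g \<in> W \<Longrightarrow> (\<lambda>x. f x + g x) \<in> W"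
    and scl: "\<And>a f. f \<in> W \<Longrightarrow> (\<lambda>x. a * f x) \<in> W"
    and D: "\<And>f. f \<in> W \<Longrightarrow> (\<lambda>x. 2 powi deg x * f x) \<in> W"
    and f: "f \<in> W" "finite {x. f x \<noteq> 0}"
  shows "(\<lambda>x. if deg x = c then f x else 0) \<in> W"
proof -
  have *: "\<exists>h. (\<lambda>x. h (deg x) * f x) \<in> W \<and> h c = 1 \<and> (\<forall>e\<in>C. h e = 0)" if "finite C" "c \<notin> C" for C
    using that
  proof (induction rule: finite_induct)
    case empty
    then show ?case using f by (intro exI[of _ "\<lambda>_. 1"]) simp
  next
    case (insert e C)
    then obtain h where h: "(\<lambda>x. h (deg x) * f x) \<in> W" "h c = 1" "\<forall>e\<in>C. h e = 0" by auto
    have ne: "(2 :: 'k) powi c - 2 powi e \<noteq> 0" using insert.prems two_powi_inj[of c e] by auto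
    \<comment> \<open>One more Lagrange factor: it is 1 at \<open>c\<close> and 0 at
      \<open>e\<close>.\<close>
    let ?h = "\<lambda>d. (2 powi d - 2 powi e) / (2 powi c - 2 powi e) * h d"
    have "(\<lambda>x. inverse (2 powi c - 2 powi e) *
        (2 powi deg x * (h (deg x) * f x) + - (2 powi e) * (h (deg x) * f x))) \<in> W"
      by (intro scl add D h)
    also have "(\<lambda>x. inverse (2 powi c - 2 powi e) *
        (2 powi deg x * (h (deg x) * f x) + - (2 powi e) * (h (deg x) * f x))) = (\<lambda>x. ?h (deg x) * f x)"
      by (simp add: fun_eq_iff field_simps)
    finally show ?case using h ne by (intro exI[of _ ?h]) auto
  qed
  let ?C = "deg ` {x. f x \<noteq> 0} - {c}"
  obtain h where h: "(\<lambda>x. h (deg x) * f x) \<in> W" "h c = 1" "\<forall>e\<in>?C. h e = 0"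
    using *[of ?C] f(2) by auto
  have "(\<lambda>x. h (deg x) * f x) = (\<lambda>x. if deg x = c then f x else 0)"
  proof
    show "h (deg x) * f x = (if deg x = c then f x else 0)" for x
      using h(2,3) by (cases "f x = 0") auto
  qed
  then show ?thesis using h(1) by simp
qed

lemma multigraded_component:
  fixes W :: "('x \<Rightarrow> 'k::field_char_0) set" and deg :: "'i \<Rightarrow> 'x \<Rightarrow> int"
  assumes add: "\<And>f g. f \<in> W \<Longrightarrow> g \<in> W \<Longrightarrow> (\<lambda>x. f x + g x) \<in> W"
    and scl: "\<And>a f. f \<in> W \<Longrightarrow> (\<lambda>x. a * f x) \<in> W"
    and "finite V"
    and D: "\<And>v f. v \<in> V \<Longrightarrow> f \<in> W \<Longrightarrow> (\<lambda>x. 2 powi deg v x * f x) \<in> W"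
    and f: "f \<in> W" "finite {x. f x \<noteq> 0}"
  shows "(\<lambda>x. if \<forall>v\<in>V. deg v x = c v then f x else 0) \<in> W"
  using assms(3,4)
proof (induction rule: finite_induct)
  case empty
  then show ?case using f by simp
next
  case (insert v V)
  let ?f = "\<lambda>x. if \<forall>v\<in>V. deg v x = c v then f x else 0"
  have "finite {x. ?f x \<noteq> 0}" by (rule finite_subset[OF _ f(2)]) auto
  then have "(\<lambda>x. if deg v x = c v then ?f x else 0) \<in> W"
    using insert by (intro graded_component[of W "deg v" ?f]) (auto intro: add scl)
  also have "(\<lambda>x. if deg v x = c v then ?f x else 0) = (\<lambda>x. if \<forall>v\<in>insert v V. deg v x = c v then f x else 0)"
    by auto
  finally show ?case .
qed

text \<open>The polynomials that vanish at every point form a space stable under rescaling each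
  variable by 2. It therefore contains every single term of its members, and the value of a term at
  the point with all coordinates 1 is its coefficient.\<close>

lemma eval_eq_0_imp_0:
  fixes P :: "'k::field_char_0 mpoly"
  assumes "\<And>x. eval x P = 0"
  shows "P = 0"
proof (rule poly_mapping_eqI)
  fix m0
  define W where "W = lookup ` {P :: 'k mpoly. \<forall>x. eval x P = 0}"
  \<comment> \<open>The variables of \<open>m0\<close> are included because \<open>m0\<close> need
    not occur in \<open>P\<close>: agreement with \<open>m0\<close> on this set then forces a
    monomial of \<open>P\<close> to be \<open>m0\<close>.\<close>
  let ?V = "\<Union>(keys ` insert m0 (keys P))"
  have "(\<lambda>m. if \<forall>v\<in>?V. int (lookup m v) = int (lookup m0 v) then lookup P m else 0) \<in> W"
  proof (rule multigraded_component)
    fix f g assume "f \<in> W" "g \<in> W"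
    then obtain P Q where "f = lookup P" "g = lookup Q" "\<forall>x. eval x P = 0" "\<forall>x. eval x Q = 0"
      by (auto simp: W_def)
    then show "(\<lambda>x. f x + g x) \<in> W"
      unfolding W_def by (intro image_eqI[of _ _ "P + Q"]) (auto simp: lookup_add)
  next
    fix a f assume "f \<in> W"
    then obtain P where "f = lookup P" "\<forall>x. eval x P = 0" by (auto simp: W_def)
    then show "(\<lambda>x. a * f x) \<in> W"
      unfolding W_def by (intro image_eqI[of _ _ "Const a * P"]) auto
  next
    fix v f assume "f \<in> W"
    then obtain P where P: "f = lookup P" "\<forall>x. eval x P = 0" by (auto simp: W_def)
    let ?c = "\<lambda>u::nat. if u = v then 2 else 1 :: 'k"
    have "mono_val ?c m = 2 ^ lookup m v" for m
      by (subst mono_val_superset[of "insert v (keys m)"])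
         (auto simp: if_distrib[of "\<lambda>a. a ^ _"] prod.If_cases)
    then show "(\<lambda>m. 2 powi int (lookup m v) * f m) \<in> W"
      unfolding W_def using P
      by (intro image_eqI[of _ _ "poly_subst (\<lambda>v. Const (?c v) * Var v) P"])
         (auto simp: lookup_diag_subst eval_subst)
  qed (use assms in \<open>auto simp: W_def\<close>)
  then obtain Q where Q: "\<forall>x. eval x Q = 0"
    "lookup Q = (\<lambda>m. if \<forall>v\<in>?V. int (lookup m v) = int (lookup m0 v) then lookup P m else 0)"
    by (auto simp: W_def)
  have "lookup Q m = lookup (single m0 (lookup P m0)) m" for m
  proof (cases "m = m0")
    case False
    then obtain v where v: "lookup m v \<noteq> lookup m0 v" using poly_mapping_eqI by metis
    show ?thesis
    proof (cases "m \<in> keys P")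
      case True
      have "v \<in> keys m \<or> v \<in> keys m0" using v by (auto simp: in_keys_iff)
      then have "v \<in> ?V" using True by auto
      then have "\<not> (\<forall>v\<in>?V. int (lookup m v) = int (lookup m0 v))" using v by auto
      then show ?thesis using False unfolding Q(2) by (simp only: if_False) (simp add: lookup_single)
    next
      case False
      then show ?thesis using \<open>m \<noteq> m0\<close> by (simp add: Q(2) lookup_single in_keys_iff)
    qed
  qed (simp add: Q(2))
  then have "Q = single m0 (lookup P m0)" by (intro poly_mapping_eqI)
  then show "lookup P m0 = lookup 0 m0"
    using Q(1)[rule_format, of "\<lambda>_. 1"] by (simp add: eval_single mono_val_def)
qed

section \<open>The contravariant form on polynomials\<close>

definition monomial_fact :: "(nat \<Rightarrow>\<^sub>0 nat) \<Rightarrow> nat" where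
  "monomial_fact m = (\<Prod>v\<in>keys m. fact (lookup m v))"

text \<open>The apolar or Fischer pairing, taken bilinearly.\<close>

definition poly_pair :: "'k::field mpoly \<Rightarrow> 'k mpoly \<Rightarrow> 'k" where
  "poly_pair P Q = (\<Sum>m\<in>keys P. of_nat (monomial_fact m) * lookup P m * lookup Q m)"

definition poly_deriv :: "nat \<Rightarrow> 'k::field mpoly \<Rightarrow> 'k mpoly" where
  "poly_deriv v Q = Abs_poly_mapping (\<lambda>m. of_nat (Suc (lookup m v)) * lookup Q (m + single v 1))"

lemma lookup_poly_deriv: "lookup (poly_deriv v Q) m = of_nat (Suc (lookup m v)) * lookup Q (m + single v 1)"
proof -
  have "finite ((\<lambda>m. m + single v 1) -` keys Q)"
    by (rule finite_vimageI) (auto intro: injI)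
  then have "finite {m. of_nat (Suc (lookup m v)) * lookup Q (m + single v 1) \<noteq> 0}"
    by (rule rev_finite_subset) (auto simp: in_keys_iff)
  then show ?thesis unfolding poly_deriv_def by simp
qed

lemma poly_pair_superset:
  "finite S \<Longrightarrow> keys P \<subseteq> S \<Longrightarrow> poly_pair P Q = (\<Sum>m\<in>S. of_nat (monomial_fact m) * lookup P m * lookup Q m)"
  unfolding poly_pair_def by (rule sum.mono_neutral_left) (auto simp: in_keys_iff)

lemma poly_pair_commute: "poly_pair P Q = poly_pair Q P"
proof -
  have "finite (keys P \<union> keys Q)" by simp
  note * = poly_pair_superset[OF this]
  show ?thesis by (subst (1 2) *) (auto intro!: sum.cong)
qed

lemma poly_pair_add_right: "poly_pair P (Q + R) = poly_pair P Q + poly_pair P R"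
  by (simp add: poly_pair_def lookup_add algebra_simps sum.distrib)

lemma poly_pair_add_left: "poly_pair (P + R) Q = poly_pair P Q + poly_pair R Q"
  using poly_pair_add_right poly_pair_commute by metis

lemma poly_pair_0 [simp]: "poly_pair P 0 = 0" "poly_pair 0 P = 0"
  by (simp_all add: poly_pair_def)

lemma poly_pair_Const_right: "poly_pair P (Const c * Q) = c * poly_pair P Q"
  by (simp add: poly_pair_def mult.left_commute sum_distrib_left)

lemma poly_pair_Const_left: "poly_pair (Const c * P) Q = c * poly_pair P Q"
  using poly_pair_Const_right poly_pair_commute by metis

lemma poly_pair_sum_right: "poly_pair P (\<Sum>i\<in>A. f i) = (\<Sum>i\<in>A. poly_pair P (f i))"
  by (induction A rule: infinite_finite_induct) (auto simp: poly_pair_add_right)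

lemma poly_pair_sum_left: "poly_pair (\<Sum>i\<in>A. f i) P = (\<Sum>i\<in>A. poly_pair (f i) P)"
  by (induction A rule: infinite_finite_induct) (auto simp: poly_pair_add_left)

lemma poly_pair_single: "poly_pair (single m c) Q = of_nat (monomial_fact m) * c * lookup Q m"
  by (cases "c = 0") (simp_all add: poly_pair_def)

lemma monomial_fact_add: "monomial_fact (m + single v 1) = monomial_fact m * Suc (lookup m v)"
proof -
  let ?S = "insert v (keys m)"
  have *: "monomial_fact m' = (\<Prod>u\<in>?S. fact (lookup m' u))" if "keys m' \<subseteq> ?S" for m'
    unfolding monomial_fact_def by (rule prod.mono_neutral_left) (use that in \<open>auto simp: in_keys_iff\<close>)
  have "monomial_fact (m + single v 1) = (\<Prod>u\<in>?S. fact (lookup (m + single v 1) u))"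
    by (rule *) (auto simp: keys_add_nat)
  also have "\<dots> = (\<Prod>u\<in>?S. fact (lookup m u) * (if u = v then Suc (lookup m v) else 1))"
    by (intro prod.cong refl) (auto simp: lookup_add lookup_single when_def)
  also have "\<dots> = monomial_fact m * Suc (lookup m v)"
    by (simp add: prod.distrib *[symmetric] subset_insertI prod.delta del: prod.insert)
  finally show ?thesis .
qed

text \<open>Multiplication by a variable is adjoint to differentiation; on monomials this is
  \<open>monomial_fact_add\<close>, and it is the reason for the factorial weights.\<close>

lemma poly_pair_Var_mult: "poly_pair (Var v * P) Q = poly_pair P (poly_deriv v Q)"
proof (induction P rule: mpoly_add_induct)
  case (single m c)
  show ?case
    unfolding single_add_Var[symmetric] poly_pair_single
    by (simp only: monomial_fact_add lookup_poly_deriv of_nat_mult mult_ac)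
qed (simp_all add: poly_pair_add_left ring_distribs)

lemma poly_deriv_add [simp]: "poly_deriv v (P + Q) = poly_deriv v P + poly_deriv v Q"
  by (rule poly_mapping_eqI) (simp add: lookup_poly_deriv lookup_add algebra_simps)

lemma poly_deriv_0 [simp]: "poly_deriv v 0 = 0"
  by (rule poly_mapping_eqI) (simp add: lookup_poly_deriv)

lemma poly_deriv_Const_mult [simp]: "poly_deriv v (Const c * P) = Const c * poly_deriv v P"
  by (rule poly_mapping_eqI) (simp add: lookup_poly_deriv mult.left_commute del: of_nat_Suc)

lemma poly_deriv_sum [simp]: "poly_deriv v (\<Sum>i\<in>A. f i) = (\<Sum>i\<in>A. poly_deriv v (f i))"
  by (induction A rule: infinite_finite_induct) auto

lemma poly_deriv_Const [simp]: "poly_deriv v (Const c) = 0"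
proof (rule poly_mapping_eqI)
  fix m :: "nat \<Rightarrow>\<^sub>0 nat"
  have "lookup (m + single v 1) v \<noteq> lookup 0 v" by (simp add: lookup_add)
  then have "0 \<noteq> m + single v 1" by metis
  then have "lookup (Const c) (m + single v 1) = 0"
    unfolding Const_def by (rule lookup_single_not_eq)
  then show "lookup (poly_deriv v (Const c)) m = lookup 0 m"
    by (simp only: lookup_poly_deriv mult_zero_right lookup_zero)
qed

lemma lookup_Var_mult: "lookup (Var v * P) m = (if lookup m v = 0 then 0 else lookup P (m - single v 1))"
proof (induction P rule: mpoly_add_induct)
  case (single m' c)
  have *: "m' + single v 1 = m \<longleftrightarrow> lookup m v \<noteq> 0 \<and> m' = m - single v 1"
  proof
    assume "lookup m v \<noteq> 0 \<and> m' = m - single v 1"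
    then show "m' + single v 1 = m"
      by (auto simp: poly_mapping_eq_iff fun_eq_iff lookup_add lookup_minus lookup_single when_def)
  qed (auto simp: lookup_add)
  show ?case unfolding single_add_Var[symmetric] using * by (simp add: lookup_single when_def)
qed (simp_all add: ring_distribs lookup_add)

lemma poly_deriv_Var_mult:
  "poly_deriv v (Var u * P) = (if u = v then P else 0) + Var u * poly_deriv v P"
proof (rule poly_mapping_eqI)
  fix m :: "nat \<Rightarrow>\<^sub>0 nat"
  have shift: "m - single u 1 + single v 1 = m + single v 1 - single u 1" if "lookup m u \<noteq> 0"
    by (rule poly_mapping_eqI) (use that in \<open>auto simp: lookup_add lookup_minus lookup_single when_def\<close>)
  show "lookup (poly_deriv v (Var u * P)) m = lookup ((if u = v then P else 0) + Var u * poly_deriv v P) m"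
  proof (cases "u = v")
    case True
    then show ?thesis using shift
      by (cases "lookup m u = 0")
         (simp_all add: lookup_poly_deriv lookup_add lookup_Var_mult lookup_minus lookup_single ring_distribs add.commute[of _ "single v (Suc 0)"])
  next
    case False
    then show ?thesis using shift
      by (simp add: lookup_poly_deriv lookup_add lookup_Var_mult lookup_minus lookup_single)
  qed
qed

section \<open>Linear substitutions and their adjoints\<close>

definition linear_subst :: "nat \<Rightarrow> (nat \<Rightarrow> nat \<Rightarrow> 'k::field) \<Rightarrow> nat \<Rightarrow> 'k mpoly" where
  "linear_subst N G v = (if v < N then \<Sum>w<N. Const (G w v) * Var w else Var v)"

text \<open>The chain rule for a linear substitution, by induction with the Leibniz rule for one
  leading variable.\<close>

lemma poly_deriv_linear_subst:
  assumes Q: "Q \<in> poly_over {..<N}" and v: "v < N"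
  shows "poly_deriv v (poly_subst (linear_subst N G) Q) =
    (\<Sum>w<N. Const (G v w) * poly_subst (linear_subst N G) (poly_deriv w Q))"
  using Q
proof (induction Q rule: mpoly_Var_induct)
  case (Const c)
  then show ?case by simp
next
  case (add A B)
  then show ?case by (simp add: ring_distribs sum.distrib)
next
  case (Var u A)
  let ?s = "poly_subst (linear_subst N G)"
  have u: "u < N" using Var by simp
  have l: "poly_deriv v (linear_subst N G u * R) = Const (G v u) * R + linear_subst N G u * poly_deriv v R" for R
  proof -
    have "poly_deriv v (linear_subst N G u * R) = (\<Sum>w<N. poly_deriv v (Const (G w u) * (Var w * R)))"
      using u by (simp add: linear_subst_def sum_distrib_right mult.assoc)
    also have "\<dots> = (\<Sum>w<N. Const (G w u) * (if w = v then R else 0)) +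
        (\<Sum>w<N. Const (G w u) * (Var w * poly_deriv v R))"
      by (simp only: poly_deriv_Const_mult poly_deriv_Var_mult ring_distribs sum.distrib)
    also have "(\<Sum>w<N. Const (G w u) * (if w = v then R else 0)) = Const (G v u) * R"
      using v by (simp add: if_distrib cong: if_cong)
    also have "(\<Sum>w<N. Const (G w u) * (Var w * poly_deriv v R)) = linear_subst N G u * poly_deriv v R"
      using u by (simp add: linear_subst_def sum_distrib_right mult.assoc)
    finally show ?thesis .
  qed
  have "(\<Sum>w<N. Const (G v w) * ?s (poly_deriv w (Var u * A))) =
      (\<Sum>w<N. Const (G v w) * ((if u = w then ?s A else 0) + linear_subst N G u * ?s (poly_deriv w A)))"
    by (intro sum.cong refl) (simp add: poly_deriv_Var_mult)
  also have "\<dots> = (\<Sum>w<N. Const (G v w) * (if u = w then ?s A else 0)) +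
      linear_subst N G u * (\<Sum>w<N. Const (G v w) * ?s (poly_deriv w A))"
    by (simp only: ring_distribs sum.distrib sum_distrib_left mult_ac)
  also have "(\<Sum>w<N. Const (G v w) * (if u = w then ?s A else 0)) = Const (G v u) * ?s A"
    using u by (simp add: if_distrib cong: if_cong)
  finally show ?case using Var.IH by (simp add: l)
qed

text \<open>A variable is split off from \<open>P\<close> and moved across the pairing as a
  derivative, where the chain rule produces the transposed matrix. The induction starts with
  constants: they pair only with the constant term of \<open>Q\<close>, which a homogeneous linear
  substitution does not change.\<close>

lemma poly_pair_linear_subst:
  assumes P: "P \<in> poly_over {..<N}" and Q: "Q \<in> poly_over {..<N}"
  shows "poly_pair (poly_subst (linear_subst N G) P) Q =
    poly_pair P (poly_subst (linear_subst N (\<lambda>v w. G w v)) Q)"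
proof -
  have deriv_over: "poly_deriv w Q \<in> poly_over {..<N}" if "Q \<in> poly_over {..<N}" for w and Q :: "'a mpoly"
  proof -
    have "keys m \<subseteq> {..<N}" if "m \<in> keys (poly_deriv w Q)" for m
    proof -
      have "m + single w 1 \<in> keys Q" using that by (auto simp: in_keys_iff lookup_poly_deriv)
      then show ?thesis using \<open>Q \<in> poly_over {..<N}\<close> 
        unfolding poly_over_def by (fastforce simp: keys_add_nat)
    qed
    then show ?thesis by (simp add: poly_over_def)
  qed
  show ?thesis
    using P Q
  proof (induction P arbitrary: Q rule: mpoly_Var_induct)
    case (Const c)
    have "lookup (poly_subst \<sigma> Q) 0 = lookup Q 0" if Q: "Q \<in> poly_over {..<N}"
      and \<sigma>: "\<And>v. v < N \<Longrightarrow> \<sigma> v = (\<Sum>w<N. Const (H w v) * Var w)" for \<sigma> and H :: "nat \<Rightarrow> nat \<Rightarrow> 'a"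
      using Q
    proof (induction Q rule: mpoly_Var_induct)
      case (Var v A)
      then show ?case
        using \<sigma>[of v] by (simp add: lookup_sum lookup_Var_mult sum_distrib_right mult.assoc)
    qed (simp_all add: lookup_add)
    from this[OF Const, of "linear_subst N (\<lambda>v w. G w v)" "\<lambda>w v. G v w"]
    have "lookup (poly_subst (linear_subst N (\<lambda>v w. G w v)) Q) 0 = lookup Q 0"
      by (simp add: linear_subst_def)
    then show ?case by (simp add: single_0_Const[symmetric] poly_pair_single subst_single)
  next
    case (add A B)
    then show ?case by (simp add: poly_pair_add_left)
  next
    case (Var v A)
    let ?s = "poly_subst (linear_subst N G)" and ?t = "poly_subst (linear_subst N (\<lambda>v w. G w v))"
    have v: "v < N" using Var by simp
    have "poly_pair (?s (Var v * A)) Q = (\<Sum>w<N. G w v * poly_pair (Var w * ?s A) Q)"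
      using v by (simp add: linear_subst_def sum_distrib_right mult.assoc poly_pair_sum_left poly_pair_Const_left)
    also have "\<dots> = (\<Sum>w<N. G w v * poly_pair A (?t (poly_deriv w Q)))"
      using Var.IH[OF deriv_over[OF Var.prems]] by (simp add: poly_pair_Var_mult)
    also have "\<dots> = poly_pair A (\<Sum>w<N. Const (G w v) * ?t (poly_deriv w Q))"
      by (simp add: poly_pair_sum_right poly_pair_Const_right)
    also have "\<dots> = poly_pair A (poly_deriv v (?t Q))"
      using poly_deriv_linear_subst[OF Var.prems v, of "\<lambda>v w. G w v"] by simp
    finally show ?case by (simp add: poly_pair_Var_mult)
  qed
qed

section \<open>The general linear group\<close>

lemma mult_mat_assoc:
  "A \<in> carrier_mat n n \<Longrightarrow> B \<in> carrier_mat n n \<Longrightarrow> C \<in> carrier_mat n n \<Longrightarrow> A * (B * C) = A * B * C"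
  by simp

lemma GL_mat_inv:
  assumes "g \<in> GL n"
  shows "mat_inv g \<in> carrier_mat n n" "g * mat_inv g = 1\<^sub>m n" "mat_inv g * g = 1\<^sub>m n"
proof -
  have g: "g \<in> carrier_mat n n" "invertible_mat g" using assms by (auto simp: GL_def)
  obtain B where B: "inverts_mat g B" "inverts_mat B g" using g(2) by (auto simp: invertible_mat_def)
  then have "g * B = 1\<^sub>m n" "B * g = 1\<^sub>m (dim_row B)" using g(1) by (auto simp: inverts_mat_def)
  moreover from this have "dim_row B = n" "dim_col B = n"
    using g(1) by (metis carrier_matD(2) index_mult_mat(3) index_one_mat(3),
      metis carrier_matD(1) index_mult_mat(3) index_one_mat(3))
  ultimately have "g \<in> Units (ring_mat TYPE('a) n (undefined :: nat))"
    using g(1) by (auto simp: Units_def ring_mat_def intro!: bexI[of _ B])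
  then obtain C where "mat_inverse g = Some C"
    using mat_inverse(1)[OF g(1), of undefined] by (cases "mat_inverse g") (auto simp del: not_None_eq)
  then show "mat_inv g \<in> carrier_mat n n" "g * mat_inv g = 1\<^sub>m n" "mat_inv g * g = 1\<^sub>m n"
    using mat_inverse(2)[OF g(1), of C] by (auto simp: mat_inv_def)
qed

lemma GL_I:
  assumes "g \<in> carrier_mat n n" "h \<in> carrier_mat n n" "g * h = 1\<^sub>m n" "h * g = 1\<^sub>m n"
  shows "g \<in> GL n" "mat_inv g = h"
proof -
  show GL: "g \<in> GL n"
    using assms by (auto simp: GL_def invertible_mat_def inverts_mat_def)
  have "mat_inv g = mat_inv g * (g * h)" using GL_mat_inv[OF GL] assms by simp
  also have "\<dots> = (mat_inv g * g) * h" by (rule mult_mat_assoc) (use GL_mat_inv[OF GL] assms in auto)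
  finally show "mat_inv g = h" unfolding GL_mat_inv(3)[OF GL] using assms by simp
qed

lemma GL_carrier: "g \<in> GL n \<Longrightarrow> g \<in> carrier_mat n n"
  by (simp add: GL_def)

lemma GL_mult:
  assumes "g \<in> GL n" "h \<in> GL n"
  shows "g * h \<in> GL n" "mat_inv (g * h) = mat_inv h * mat_inv g"
proof -
  note c = GL_carrier[OF assms(1)] GL_carrier[OF assms(2)] GL_mat_inv[OF assms(1)] GL_mat_inv[OF assms(2)]
  have "(g * h) * (mat_inv h * mat_inv g) = g * h * mat_inv h * mat_inv g"
    by (rule mult_mat_assoc) (use c in auto)
  also have "g * h * mat_inv h = g * (h * mat_inv h)"
    by (rule mult_mat_assoc[symmetric]) (use c in auto)
  finally have 1: "(g * h) * (mat_inv h * mat_inv g) = 1\<^sub>m n" unfolding c(7) using c by simp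
  have "(mat_inv h * mat_inv g) * (g * h) = mat_inv h * mat_inv g * g * h"
    by (rule mult_mat_assoc) (use c in auto)
  also have "mat_inv h * mat_inv g * g = mat_inv h * (mat_inv g * g)"
    by (rule mult_mat_assoc[symmetric]) (use c in auto)
  finally have 2: "(mat_inv h * mat_inv g) * (g * h) = 1\<^sub>m n" unfolding c(5) using c by simp
  show "g * h \<in> GL n" "mat_inv (g * h) = mat_inv h * mat_inv g"
    using GL_I[OF _ _ 1 2] c by auto
qed

lemma GL_transpose:
  assumes "g \<in> GL n"
  shows "transpose_mat g \<in> GL n" "mat_inv (transpose_mat g) = transpose_mat (mat_inv g)"
proof -
  note c = GL_carrier[OF assms(1)] GL_mat_inv[OF assms(1)]
  have "transpose_mat g * transpose_mat (mat_inv g) = 1\<^sub>m n" "transpose_mat (mat_inv g) * transpose_mat g = 1\<^sub>m n"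
    using transpose_mult[of g n n "mat_inv g" n, symmetric] transpose_mult[of "mat_inv g" n n g n, symmetric] c(1,2)
    by (simp_all add: c(3,4) del: transpose_mult)
  then show "transpose_mat g \<in> GL n" "mat_inv (transpose_mat g) = transpose_mat (mat_inv g)"
    using GL_I[of "transpose_mat g" n "transpose_mat (mat_inv g)"] c by auto
qed

lemma GL_mat_inv_GL: "g \<in> GL n \<Longrightarrow> mat_inv g \<in> GL n" "g \<in> GL n \<Longrightarrow> mat_inv (mat_inv g) = g"
  using GL_I[of "mat_inv g" n g] GL_mat_inv GL_carrier by blast+

lemma GL_one: "1\<^sub>m n \<in> GL n" "mat_inv (1\<^sub>m n) = 1\<^sub>m n"
  using GL_I[of "1\<^sub>m n" n "1\<^sub>m n"] by auto

lemma mult_mat_index: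
  assumes "A \<in> carrier_mat n n" "B \<in> carrier_mat n n" "i < n" "j < n"
  shows "(A * B) $$ (i, j) = (\<Sum>k<n. A $$ (i, k) * B $$ (k, j))"
  using assms by (simp add: scalar_prod_def atLeast0LessThan)

lemma gl_var_simps:
  "v < n \<Longrightarrow> gl_var n g v = (\<Sum>i<n. Const (g $$ (i, v)) * Var i)"
  "v < n \<Longrightarrow> gl_var n g (n + v) = (\<Sum>i<n. Const (mat_inv g $$ (v, i)) * Var (n + i))"
  "\<not> v < 2 * n \<Longrightarrow> gl_var n g v = Var v"
  by (auto simp: gl_var_def)

section \<open>The action on polynomials in the coordinates and the dual coordinates\<close>

definition subst_gl :: "nat \<Rightarrow> 'k::field mat \<Rightarrow> 'k mpoly \<Rightarrow> 'k mpoly" where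
  "subst_gl n g = poly_subst (gl_var n g)"

lemma subst_gl_simps [simp]:
  "subst_gl n g 0 = 0" "subst_gl n g 1 = 1" "subst_gl n g (P + Q) = subst_gl n g P + subst_gl n g Q"
  "subst_gl n g (P * Q) = subst_gl n g P * subst_gl n g Q" "subst_gl n g (- P) = - subst_gl n g P"
  "subst_gl n g (P - Q) = subst_gl n g P - subst_gl n g Q"
  "subst_gl n g (Const c) = Const c" "subst_gl n g (Var v) = gl_var n g v"
  "subst_gl n g (sum f A) = (\<Sum>i\<in>A. subst_gl n g (f i))" "subst_gl n g (P ^ k) = subst_gl n g P ^ k"
  by (simp_all add: subst_gl_def)

lemma var_cases:
  obtains "v < (n :: nat)" | u where "u < n" "v = n + u" | "\<not> v < 2 * n"
proof -
  consider "v < n" | "v - n < n" "v = n + (v - n)" | "\<not> v < 2 * n" by linarith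
  then show ?thesis using that by metis
qed

lemma sum_mat_mult_Var:
  assumes "A \<in> carrier_mat n n" "B \<in> carrier_mat n n" "i < n"
  shows "(\<Sum>k<n. Const (A $$ (i, k)) * (\<Sum>l<n. Const (B $$ (k, l)) * X l)) =
    (\<Sum>l<n. Const ((A * B) $$ (i, l)) * X l)"
proof -
  have "(\<Sum>k<n. Const (A $$ (i, k)) * (\<Sum>l<n. Const (B $$ (k, l)) * X l)) =
      (\<Sum>l<n. \<Sum>k<n. Const (A $$ (i, k)) * (Const (B $$ (k, l)) * X l))"
    unfolding sum_distrib_left by (rule sum.swap)
  also have "\<dots> = (\<Sum>l<n. Const ((A * B) $$ (i, l)) * X l)"
    using assms by (intro sum.cong refl) (simp add: mult_mat_index Const_sum sum_distrib_right mult.assoc del: index_mult_mat)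
  finally show ?thesis .
qed

lemma subst_gl_gl_var:
  assumes g: "g \<in> GL n" and h: "h \<in> GL n"
  shows "subst_gl n g (gl_var n h v) = gl_var n (g * h) v"
proof (cases rule: var_cases[of v n])
  case 1
  note c = GL_carrier[OF g] GL_carrier[OF h]
  have "subst_gl n g (gl_var n h v) = (\<Sum>k<n. Const (h $$ (k, v)) * (\<Sum>l<n. Const (g $$ (l, k)) * Var l))"
    using 1 by (simp add: gl_var_simps)
  also have "\<dots> = (\<Sum>k<n. Const (transpose_mat h $$ (v, k)) * (\<Sum>l<n. Const (transpose_mat g $$ (k, l)) * Var l))"
    using 1 c by (intro sum.cong refl arg_cong2[of _ _ _ _ "(*)"]) auto
  also have "\<dots> = (\<Sum>l<n. Const ((transpose_mat h * transpose_mat g) $$ (v, l)) * Var l)"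
    using 1 c by (intro sum_mat_mult_Var) auto
  also have "transpose_mat h * transpose_mat g = transpose_mat (g * h)"
    using transpose_mult[OF c] by simp
  also have "(\<Sum>l<n. Const (transpose_mat (g * h) $$ (v, l)) * Var l) = (\<Sum>l<n. Const ((g * h) $$ (l, v)) * Var l)"
    using 1 c by (intro sum.cong refl) auto
  finally show ?thesis using 1 by (simp add: gl_var_simps)
next
  case (2 u)
  then show ?thesis using sum_mat_mult_Var[OF GL_mat_inv(1)[OF h] GL_mat_inv(1)[OF g] 2(1), of "\<lambda>l. Var (n + l)"]
    by (simp add: gl_var_simps GL_mult[OF g h])
next
  case 3
  then show ?thesis by (simp add: gl_var_simps)
qed

lemma subst_gl_mult:
  assumes "g \<in> GL n" "h \<in> GL n"
  shows "subst_gl n g (subst_gl n h P) = subst_gl n (g * h) P"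
  using subst_gl_gl_var[OF assms] by (simp add: subst_gl_def subst_subst)

lemma subst_gl_one: "subst_gl n (1\<^sub>m n) P = P"
proof -
  have "gl_var n (1\<^sub>m n) v = (Var v :: 'a mpoly)" for v :: nat
  proof (cases rule: var_cases[of v n])
    case 1
    then show ?thesis
      by (simp add: gl_var_simps if_distrib[of Const] if_distrib[of "\<lambda>c. c * _"] cong: if_cong)
  next
    case (2 u)
    then show ?thesis
      by (simp add: gl_var_simps GL_one if_distrib[of Const] if_distrib[of "\<lambda>c. c * _"] cong: if_cong)
  qed (simp add: gl_var_simps)
  then have "gl_var n (1\<^sub>m n) = (Var :: nat \<Rightarrow> 'a mpoly)" by blast
  then show ?thesis by (simp add: subst_gl_def subst_Var)
qed

lemma inj_subst_gl:
  assumes "g \<in> GL n"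
  shows "inj (subst_gl n g)"
proof (rule inj_on_inverseI)
  show "subst_gl n (mat_inv g) (subst_gl n g P) = P" for P
    using assms by (simp add: subst_gl_mult GL_mat_inv_GL GL_mat_inv subst_gl_one)
qed

lemma subst_gl_zz_dual:
  assumes g: "g \<in> GL n"
  shows "subst_gl n g (zz_dual n) = zz_dual n"
proof -
  note c = GL_carrier[OF g] GL_mat_inv[OF g]
  have "subst_gl n g (zz_dual n) =
      (\<Sum>i<n. \<Sum>a<n. Const (g $$ (a, i)) * Var a * (\<Sum>b<n. Const (mat_inv g $$ (i, b)) * Var (n + b)))"
    by (simp add: zz_dual_def gl_var_simps sum_distrib_right)
  also have "\<dots> = (\<Sum>a<n. Var a * (\<Sum>i<n. Const (g $$ (a, i)) * (\<Sum>b<n. Const (mat_inv g $$ (i, b)) * Var (n + b))))"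
    by (subst sum.swap) (simp add: sum_distrib_left mult_ac)
  also have "\<dots> = (\<Sum>a<n. Var a * (\<Sum>b<n. Const ((g * mat_inv g) $$ (a, b)) * Var (n + b)))"
    using c by (intro sum.cong refl arg_cong2[of _ _ _ _ "(*)"] sum_mat_mult_Var) auto
  also have "\<dots> = zz_dual n"
    unfolding c(3) zz_dual_def
    by (intro sum.cong refl) (simp add: if_distrib[of Const] if_distrib[of "\<lambda>c. c * _"] cong: if_cong)
  finally show ?thesis .
qed

text \<open>The action on all \<open>2 * n\<close> variables is one linear substitution, and
  transposing its matrix corresponds to transposing \<open>g\<close>, since transposition commutes
  with inversion.\<close>

lemma poly_pair_subst_gl:
  assumes g: "g \<in> GL n" and P: "P \<in> poly_zzd n" and Q: "Q \<in> poly_zzd n"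
  shows "poly_pair (subst_gl n g P) Q = poly_pair P (subst_gl n (transpose_mat g) Q)"
proof -
  \<comment> \<open>\<open>G h w v\<close> is the coefficient of \<open>Var w\<close> in the image
    of \<open>Var v\<close>; the matrix is block diagonal, with one block for \<open>z\<close> and
    one for the dual variables.\<close>
  define G where "G h w v = (if v < n then if w < n then h $$ (w, v) else 0
      else if w < n then 0 else mat_inv h $$ (v - n, w - n))" for h :: "'a mat" and w v
  have split: "(\<Sum>w<2*n. f w) = (\<Sum>w<n. f w) + (\<Sum>w<n. f (n + w))" for f :: "nat \<Rightarrow> 'a mpoly"
  proof -
    have "(\<Sum>w<n + k. f w) = (\<Sum>w<n. f w) + (\<Sum>w<k. f (n + w))" for k
      by (induction k) (auto simp: add.assoc)
    then show ?thesis by (simp add: mult_2)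
  qed
  have lin: "gl_var n h = linear_subst (2 * n) (G h)" for h
  proof
    fix v show "gl_var n h v = linear_subst (2 * n) (G h) v"
      by (cases rule: var_cases[of v n]) (auto simp: gl_var_simps linear_subst_def split G_def)
  qed
  have "linear_subst (2 * n) (G (transpose_mat g)) = linear_subst (2 * n) (\<lambda>v w. G g w v)"
    using GL_carrier[OF g] GL_mat_inv[OF g] GL_transpose[OF g]
    by (auto simp: linear_subst_def G_def fun_eq_iff intro!: sum.cong)
  then show ?thesis
    using poly_pair_linear_subst[of P "2 * n" Q "G g"] P Q
    by (simp add: subst_gl_def lin poly_zzd_poly_over)
qed

section \<open>Numerators of forms\<close>

definition idx :: "nat \<Rightarrow> nat \<Rightarrow> nat list set" where
  "idx n p = {J. set J \<subseteq> {..<n} \<and> length J = p}"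

lemma finite_idx [simp]: "finite (idx n p)"
  unfolding idx_def by (rule finite_lists_length_eq) simp

lemma idx_0: "idx n 0 = {[]}"
  by (auto simp: idx_def)

lemma sum_idx_Suc: "(\<Sum>J\<in>idx n (Suc p). f J) = (\<Sum>x<n. \<Sum>J\<in>idx n p. f (x # J))"
proof -
  have "(\<Sum>J\<in>idx n (Suc p). f J) = (\<Sum>(x, J)\<in>{..<n} \<times> idx n p. f (x # J))"
    by (rule sum.reindex_bij_witness[where i = "\<lambda>(x, J). x # J" and j = "\<lambda>J. (hd J, tl J)"])
       (auto simp: idx_def length_Suc_conv)
  then show ?thesis by (simp add: sum.cartesian_product)
qed

lemma idx_Cons: "x # J \<in> idx n (Suc p) \<longleftrightarrow> x < n \<and> J \<in> idx n p"
  by (auto simp: idx_def)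

text \<open>The entry in row \<open>J\<close> and column \<open>I\<close> of a tensor power of
  \<open>A\<close>; thus \<open>tens_mult\<close> is functoriality of the tensor power.\<close>

definition tens :: "'k::comm_ring_1 mat \<Rightarrow> nat list \<Rightarrow> nat list \<Rightarrow> 'k" where
  "tens A J I = (\<Prod>t<length I. A $$ (J ! t, I ! t))"

lemma tens_Nil [simp]: "tens A J [] = 1"
  by (simp add: tens_def)

lemma tens_Cons [simp]: "tens A (j # J) (i # I) = A $$ (j, i) * tens A J I"
  by (simp add: tens_def prod.lessThan_Suc_shift del: prod.lessThan_Suc)

lemma idx_induct2 [consumes 2, case_names Nil Cons]:
  assumes "J \<in> idx n p" "I \<in> idx n p" "P 0 [] []"
    and "\<And>p j J i I. j < n \<Longrightarrow> i < n \<Longrightarrow> J \<in> idx n p \<Longrightarrow> I \<in> idx n p \<Longrightarrow> P p J I \<Longrightarrow> P (Suc p) (j # J) (i # I)"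
  shows "P p J I"
  using assms(1,2)
proof (induction p arbitrary: J I)
  case 0
  then show ?case using assms(3) by (simp add: idx_0)
next
  case (Suc p)
  then obtain j J' i I' where "J = j # J'" "I = i # I'" by (auto simp: idx_def length_Suc_conv)
  then show ?case using Suc assms(4) by (simp add: idx_Cons)
qed

lemma tens_mult:
  assumes A: "A \<in> carrier_mat n n" and B: "B \<in> carrier_mat n n" and "J \<in> idx n p" "I \<in> idx n p"
  shows "(\<Sum>L\<in>idx n p. tens A J L * tens B L I) = tens (A * B) J I"
  using assms(3,4)
proof (induction rule: idx_induct2)
  case Nil
  then show ?case by (simp add: idx_0)
next
  case (Cons p j J i I)
  have "(\<Sum>L\<in>idx n (Suc p). tens A (j # J) L * tens B L (i # I)) =
      (\<Sum>x<n. \<Sum>L\<in>idx n p. (A $$ (j, x) * B $$ (x, i)) * (tens A J L * tens B L I))"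
    unfolding sum_idx_Suc by (intro sum.cong refl) (simp add: mult_ac)
  also have "\<dots> = (A * B) $$ (j, i) * tens (A * B) J I"
    unfolding Cons.IH[symmetric] mult_mat_index[OF A B Cons.hyps(1,2)]
    by (simp add: sum_distrib_left sum_distrib_right) (rule sum.swap)
  finally show ?case by simp
qed

lemma tens_one: "J \<in> idx n p \<Longrightarrow> I \<in> idx n p \<Longrightarrow> tens (1\<^sub>m n) J I = (if J = I then 1 else 0)"
  by (induction rule: idx_induct2) auto

lemma tens_transpose:
  "A \<in> carrier_mat n n \<Longrightarrow> J \<in> idx n p \<Longrightarrow> I \<in> idx n p \<Longrightarrow> tens (transpose_mat A) J I = tens A I J"
  by (rotate_tac 1, induction rule: idx_induct2) auto

definition swap_nth :: "nat \<Rightarrow> nat \<Rightarrow> 'a list \<Rightarrow> 'a list" where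
  "swap_nth i j I = I[i := I ! j, j := I ! i]"

lemma length_swap_nth [simp]: "length (swap_nth i j I) = length I"
  by (simp add: swap_nth_def)

lemma nth_swap_nth:
  "i < length I \<Longrightarrow> j < length I \<Longrightarrow> t < length I \<Longrightarrow> swap_nth i j I ! t = I ! Transposition.transpose i j t"
  by (auto simp: swap_nth_def nth_list_update Transposition.transpose_def)

lemma set_swap_nth: "i < length I \<Longrightarrow> j < length I \<Longrightarrow> set (swap_nth i j I) = set I"
  unfolding swap_nth_def by (rule set_swap)

lemma swap_nth_idx: "i < p \<Longrightarrow> j < p \<Longrightarrow> I \<in> idx n p \<Longrightarrow> swap_nth i j I \<in> idx n p"
  by (auto simp: idx_def set_swap_nth)

lemma swap_nth_swap_nth: "i < length I \<Longrightarrow> j < length I \<Longrightarrow> swap_nth i j (swap_nth i j I) = I"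
  by (rule nth_equalityI) (auto simp: nth_swap_nth Transposition.transpose_def)

lemma tens_swap_nth:
  assumes "i < p" "j < p" "J \<in> idx n p" "I \<in> idx n p"
  shows "tens A (swap_nth i j J) (swap_nth i j I) = tens A J I"
proof -
  let ?\<pi> = "Transposition.transpose i j"
  have \<pi>: "?\<pi> permutes {..<p}" using assms by (intro permutes_swap_id) auto
  have len: "length I = p" "length J = p" using assms by (auto simp: idx_def)
  have "tens A (swap_nth i j J) (swap_nth i j I) = (\<Prod>t<p. A $$ (J ! ?\<pi> t, I ! ?\<pi> t))"
    unfolding tens_def by (rule prod.cong) (use assms len in \<open>auto simp: nth_swap_nth\<close>)
  also have "\<dots> = tens A J I"
    unfolding tens_def len using prod.permute[OF \<pi>, of "\<lambda>t. A $$ (J ! t, I ! t)"] by (simp add: comp_def)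
  finally show ?thesis .
qed

lemma Const_eq_0_iff: "Const c = 0 \<longleftrightarrow> c = 0"
  unfolding Const_def by (metis lookup_single_eq lookup_zero single_zero)

text \<open>\<open>antisymmetric_form\<close> with general coefficients: it is applied to fractions,
  to their numerators, and to the values of numerators at a point.\<close>

definition alternating :: "nat \<Rightarrow> nat \<Rightarrow> (nat list \<Rightarrow> 'b::ab_group_add) \<Rightarrow> bool" where
  "alternating n p \<omega> \<longleftrightarrow>
     (\<forall>I. \<not> (I \<in> idx n p \<and> distinct I) \<longrightarrow> \<omega> I = 0) \<and>
     (\<forall>I i j. i < j \<and> j < length I \<longrightarrow> \<omega> (swap_nth i j I) = - \<omega> I)"

lemma antisymmetric_form_iff: "antisymmetric_form n p \<omega> \<longleftrightarrow> alternating n p \<omega>"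
  unfolding antisymmetric_form_def alternating_def idx_def swap_nth_def by auto

text \<open>With a repeated index the swap fixes the list, so twice the component is 0, and 2 is
  invertible.\<close>

lemma alternatingI:
  fixes \<omega> :: "nat list \<Rightarrow> 'k::field_char_0 mpoly"
  assumes "\<And>I. I \<notin> idx n p \<Longrightarrow> \<omega> I = 0"
    and "\<And>I i j. i < j \<Longrightarrow> j < p \<Longrightarrow> I \<in> idx n p \<Longrightarrow> \<omega> (swap_nth i j I) = - \<omega> I"
  shows "alternating n p \<omega>"
proof -
  have swap: "\<omega> (swap_nth i j I) = - \<omega> I" if ij: "i < j" "j < length I" for I i j
  proof (cases "I \<in> idx n p")
    case True
    then show ?thesis using assms(2) ij by (simp add: idx_def)
  next
    case False
    then have "swap_nth i j I \<notin> idx n p"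
      using ij set_swap_nth[of i I j] by (auto simp: idx_def)
    then show ?thesis using False assms(1) by simp
  qed
  have "\<omega> I = 0" if I: "I \<in> idx n p" "\<not> distinct I" for I
  proof -
    obtain i j where ij: "i < j" "j < length I" "I ! i = I ! j"
      using I(2) by (metis distinct_conv_nth linorder_neq_iff)
    then have "swap_nth i j I = I" by (simp add: swap_nth_def list_update_id) (metis list_update_id)
    then have "\<omega> I + \<omega> I = 0" using swap[OF ij(1,2)] by simp
    then have "Const 2 * \<omega> I = 0" unfolding numeral_2_eq_2 using Const_simps(3)[of 1 1] by (simp add: ring_distribs numeral_2_eq_2)
    moreover have "Const (2 :: 'k) \<noteq> 0" by (simp only: Const_eq_0_iff) simp
    ultimately show ?thesis by simp
  qed
  then show ?thesis using assms(1) swap unfolding alternating_def by blast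
qed

text \<open>As \<open>zz_dual\<close> is invariant, the action on forms with denominator
  \<open>zz_dual n ^ r\<close> is, for every \<open>r\<close>, this action on the
  numerators.\<close>

definition gl_num :: "nat \<Rightarrow> 'k::field mat \<Rightarrow> (nat list \<Rightarrow> 'k mpoly) \<Rightarrow> nat list \<Rightarrow> 'k mpoly" where
  "gl_num n g \<Phi> I = (if set I \<subseteq> {..<n} then
     \<Sum>J\<in>idx n (length I). Const (tens (mat_inv g) J I) * subst_gl n g (\<Phi> J) else 0)"

lemma gl_num_idx:
  "I \<in> idx n p \<Longrightarrow> gl_num n g \<Phi> I = (\<Sum>J\<in>idx n p. Const (tens (mat_inv g) J I) * subst_gl n g (\<Phi> J))"
  by (auto simp: gl_num_def idx_def)

lemma gl_num_not_idx: "I \<notin> idx n p \<Longrightarrow> (\<And>J. J \<notin> idx n p \<Longrightarrow> \<Phi> J = 0) \<Longrightarrow> gl_num n g \<Phi> I = 0"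
  by (cases "length I = p") (auto simp: gl_num_def idx_def intro!: sum.neutral)

lemma gl_num_mult:
  assumes g: "g \<in> GL n" and h: "h \<in> GL n"
  shows "gl_num n g (gl_num n h \<Phi>) = gl_num n (g * h) \<Phi>"
proof
  fix I
  show "gl_num n g (gl_num n h \<Phi>) I = gl_num n (g * h) \<Phi> I"
  proof (cases "set I \<subseteq> {..<n}")
    case False
    then show ?thesis by (simp add: gl_num_def)
  next
    case True
    define p where "p = length I"
    have I: "I \<in> idx n p" using True by (simp add: idx_def p_def)
    have "gl_num n g (gl_num n h \<Phi>) I = (\<Sum>J\<in>idx n p. \<Sum>L\<in>idx n p.
        Const (tens (mat_inv h) L J * tens (mat_inv g) J I) * subst_gl n (g * h) (\<Phi> L))"
      using g h by (simp add: gl_num_idx[OF I] gl_num_idx[of _ n p h] subst_gl_mult sum_distrib_left mult_ac)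
    also have "\<dots> = (\<Sum>L\<in>idx n p. Const (\<Sum>J\<in>idx n p. tens (mat_inv h) L J * tens (mat_inv g) J I) *
        subst_gl n (g * h) (\<Phi> L))"
      unfolding Const_sum sum_distrib_right by (rule sum.swap)
    also have "\<dots> = gl_num n (g * h) \<Phi> I"
      unfolding gl_num_idx[OF I] using GL_mat_inv[OF g] GL_mat_inv[OF h] I
      by (intro sum.cong refl) (simp add: tens_mult GL_mult[OF g h])
    finally show ?thesis .
  qed
qed

lemma gl_num_add: "gl_num n g (\<lambda>I. \<Phi> I + \<Psi> I) = (\<lambda>I. gl_num n g \<Phi> I + gl_num n g \<Psi> I)"
  by (auto simp: gl_num_def fun_eq_iff ring_distribs sum.distrib)

lemma gl_num_Const_mult: "gl_num n g (\<lambda>I. Const c * \<Phi> I) = (\<lambda>I. Const c * gl_num n g \<Phi> I)"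
  by (auto simp: gl_num_def fun_eq_iff sum_distrib_left mult_ac)

definition contraction :: "nat \<Rightarrow> (nat list \<Rightarrow> 'k::field mpoly) \<Rightarrow> nat list \<Rightarrow> 'k mpoly" where
  "contraction n \<Phi> I = (\<Sum>\<nu><n. Var (n + \<nu>) * \<Phi> (\<nu> # I))"

text \<open>The numerators of \<open>p\<close>-forms over \<open>zz_dual n ^ r\<close>: coefficients
  have degree \<open>- p\<close> in the dual variables, and the denominator contributes
  \<open>r\<close>. The exponent may be smaller than \<open>p\<close>, in which case only 0
  remains.\<close>

definition numerators :: "nat \<Rightarrow> nat \<Rightarrow> nat \<Rightarrow> (nat list \<Rightarrow> 'k::field mpoly) set" where
  "numerators n p r = {\<Phi>. alternating n p \<Phi> \<and> (\<forall>I. contraction n \<Phi> I = 0) \<and>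
     (\<forall>I. \<Phi> I \<in> poly_zzd n \<and> dual_homogeneous n (int r - int p) (\<Phi> I))}"

lemma numeratorsD:
  assumes "\<Phi> \<in> numerators n p r"
  shows "alternating n p \<Phi>" "contraction n \<Phi> I = 0" "\<Phi> I \<in> poly_zzd n"
    "dual_homogeneous n (int r - int p) (\<Phi> I)"
    "I \<notin> idx n p \<Longrightarrow> \<Phi> I = 0" "i < j \<Longrightarrow> j < length I \<Longrightarrow> \<Phi> (swap_nth i j I) = - \<Phi> I"
    "\<not> distinct I \<Longrightarrow> \<Phi> I = 0"
  using assms by (auto simp: numerators_def alternating_def)

section \<open>Degrees and their preservation by the group\<close>

definition dual_degree :: "nat \<Rightarrow> (nat \<Rightarrow>\<^sub>0 nat) \<Rightarrow> int" where
  "dual_degree n m = int (\<Sum>i<n. lookup m (n + i))"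

definition total_degree :: "nat \<Rightarrow> (nat \<Rightarrow>\<^sub>0 nat) \<Rightarrow> nat" where
  "total_degree n m = (\<Sum>i<2 * n. lookup m i)"

text \<open>Records the exponents of the variables outside \<open>z\<close> and its dual, so that
  membership in \<open>poly_zzd\<close> becomes homogeneity of degree 0 and needs no separate
  treatment.\<close>

definition other_degree :: "nat \<Rightarrow> (nat \<Rightarrow>\<^sub>0 nat) \<Rightarrow> nat \<Rightarrow> nat" where
  "other_degree n m = (\<lambda>v. if v < 2 * n then 0 else lookup m v)"

interpretation dual: grading "dual_degree n" for n
  by unfold_locales (auto simp: dual_degree_def lookup_add sum.distrib)

interpretation total: grading "total_degree n" for n
  by unfold_locales (auto simp: total_degree_def lookup_add sum.distrib)

interpretation other: grading "other_degree n" for n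
  by unfold_locales (auto simp: other_degree_def lookup_add fun_eq_iff)

lemma dual_homogeneous_hom: "dual_homogeneous n d P \<longleftrightarrow> dual.hom n d P"
  by (simp add: dual_homogeneous_def dual.hom_def dual_degree_def)

lemma poly_zzd_hom: "P \<in> poly_zzd n \<longleftrightarrow> other.hom n 0 P"
proof -
  have "keys m \<subseteq> {..<2 * n} \<longleftrightarrow> other_degree n m = 0" for m :: "nat \<Rightarrow>\<^sub>0 nat"
    by (auto simp: other_degree_def fun_eq_iff in_keys_iff subset_iff)
  then show ?thesis by (simp add: poly_zzd_def other.hom_def)
qed

lemma (in grading) hom_gl_var:
  assumes "\<And>a b. a < n \<Longrightarrow> b < n \<Longrightarrow> deg (single a 1) = deg (single b 1)"
    and "\<And>a b. a < n \<Longrightarrow> b < n \<Longrightarrow> deg (single (n + a) 1) = deg (single (n + b) 1)"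
  shows "hom (deg (single v 1)) (gl_var n g v)"
proof (cases rule: var_cases[of v n])
  case 1
  then show ?thesis unfolding gl_var_simps(1)[OF 1]
  proof (intro hom_sum hom_Const_mult)
    fix i assume "i \<in> {..<n}"
    then have eq: "deg (single v 1) = deg (single i 1)" using assms(1)[OF 1] by blast
    show "hom (deg (single v 1)) (Var i)" unfolding eq by (rule hom_Var)
  qed
next
  case (2 u)
  then show ?thesis unfolding 2(2) gl_var_simps(2)[OF 2(1)]
  proof (intro hom_sum hom_Const_mult)
    fix i assume "i \<in> {..<n}"
    then have eq: "deg (single (n + u) 1) = deg (single (n + i) 1)" using assms(2)[OF 2(1)] by blast
    show "hom (deg (single (n + u) 1)) (Var (n + i))" unfolding eq by (rule hom_Var)
  qed
next
  case 3
  then show ?thesis using hom_Var by (simp add: gl_var_simps)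
qed

lemma dual_degree_single: "dual_degree n (single a 1) = (if n \<le> a \<and> a < 2 * n then 1 else 0)"
proof (cases "n \<le> a \<and> a < 2 * n")
  case True
  define u where "u = a - n"
  have "u < n" "a = n + u" using True by (auto simp: u_def)
  then show ?thesis by (simp add: dual_degree_def lookup_single when_def)
next
  case False
  then have "lookup (single a (1 :: nat)) (n + i) = 0" if "i < n" for i
    using that by (intro lookup_single_not_eq) auto
  then show ?thesis using False by (auto simp: dual_degree_def)
qed

lemma hom_gl_var:
  "dual.hom n (dual_degree n (single v 1)) (gl_var n g v)"
  "total.hom n (total_degree n (single v 1)) (gl_var n g v)"
  "other.hom n (other_degree n (single v 1)) (gl_var n g v)"
proof -
  note 1 = dual_degree_single
  have 2: "total_degree n (single a 1) = (if a < 2 * n then 1 else 0)" for a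
    by (simp add: total_degree_def lookup_single when_def)
  have 3: "other_degree n (single a 1) = (\<lambda>v. if v < 2 * n then 0 else if a = v then 1 else 0)" for a
    by (auto simp: other_degree_def fun_eq_iff lookup_single)
  show "dual.hom n (dual_degree n (single v 1)) (gl_var n g v)"
    by (rule dual.hom_gl_var) (simp_all only: 1, auto)
  show "total.hom n (total_degree n (single v 1)) (gl_var n g v)"
    by (rule total.hom_gl_var) (simp_all only: 2, auto)
  show "other.hom n (other_degree n (single v 1)) (gl_var n g v)"
    by (rule other.hom_gl_var) (simp_all only: 3, auto)
qed

text \<open>A set \<open>D\<close> of degrees covers both homogeneity, where \<open>D\<close> is a
  singleton, and bounds on the total degree.\<close>

lemma gl_num_preserves:
  assumes deg: "grading deg" and var: "\<And>v. grading.hom deg (deg (single v 1)) (gl_var n g v)"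
    and \<Phi>: "\<And>J m. m \<in> keys (\<Phi> J) \<Longrightarrow> deg m \<in> D" and m: "m \<in> keys (gl_num n g \<Phi> I)"
  shows "deg m \<in> D"
proof -
  interpret grading deg by (rule deg)
  have "set I \<subseteq> {..<n}" using m by (auto simp: gl_num_def split: if_splits)
  then have "m \<in> keys (\<Sum>J\<in>idx n (length I). Const (tens (mat_inv g) J I) * subst_gl n g (\<Phi> J))"
    using m by (simp add: gl_num_def)
  then obtain J where J: "m \<in> keys (Const (tens (mat_inv g) J I) * subst_gl n g (\<Phi> J))"
    using keys_sum by fast
  then have "m \<in> keys (subst_gl n g (\<Phi> J))" by (auto simp: in_keys_iff)
  then obtain m' where m': "m' \<in> keys (\<Phi> J)" "deg m = deg m'"
    using keys_subst[OF var, of m "\<Phi> J"] unfolding subst_gl_def by blast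
  then show ?thesis using \<Phi>[OF m'(1)] by simp
qed

lemma alternating_gl_num:
  fixes \<Phi> :: "nat list \<Rightarrow> 'k::field_char_0 mpoly"
  assumes \<Phi>: "alternating n p \<Phi>"
  shows "alternating n p (gl_num n g \<Phi>)"
proof (rule alternatingI)
  fix I assume "I \<notin> idx n p"
  then show "gl_num n g \<Phi> I = 0"
    using \<Phi> by (intro gl_num_not_idx) (auto simp: alternating_def)
next
  fix I i j assume ij: "i < j" "j < p" and I: "I \<in> idx n p"
  have "gl_num n g \<Phi> (swap_nth i j I) =
      (\<Sum>J\<in>idx n p. Const (tens (mat_inv g) J (swap_nth i j I)) * subst_gl n g (\<Phi> J))"
    using ij I by (intro gl_num_idx swap_nth_idx) auto
  also have "\<dots> = (\<Sum>J\<in>idx n p. Const (tens (mat_inv g) (swap_nth i j J) (swap_nth i j I)) *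
      subst_gl n g (\<Phi> (swap_nth i j J)))"
    by (rule sum.reindex_bij_witness[where i = "swap_nth i j" and j = "swap_nth i j"])
       (use ij in \<open>auto simp: swap_nth_idx swap_nth_swap_nth idx_def set_swap_nth\<close>)
  also have "\<dots> = (\<Sum>J\<in>idx n p. - (Const (tens (mat_inv g) J I) * subst_gl n g (\<Phi> J)))"
  proof (intro sum.cong refl)
    fix J assume J: "J \<in> idx n p"
    then have "\<Phi> (swap_nth i j J) = - \<Phi> J" using \<Phi> ij by (auto simp: alternating_def idx_def)
    then show "Const (tens (mat_inv g) (swap_nth i j J) (swap_nth i j I)) * subst_gl n g (\<Phi> (swap_nth i j J)) =
        - (Const (tens (mat_inv g) J I) * subst_gl n g (\<Phi> J))"
      using tens_swap_nth[of i p j J n I "mat_inv g"] ij I J by simp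
  qed
  also have "\<dots> = - gl_num n g \<Phi> I" by (simp add: gl_num_idx[OF I] sum_negf)
  finally show "gl_num n g \<Phi> (swap_nth i j I) = - gl_num n g \<Phi> I" .
qed

text \<open>Contraction is equivariant: in the sum over the first index the entries of
  \<open>mat_inv g\<close> combine with the dual variables to their images under
  \<open>g\<close>.\<close>

lemma contraction_gl_num:
  assumes \<Phi>: "\<And>I. contraction n \<Phi> I = 0"
  shows "contraction n (gl_num n g \<Phi>) I = 0"
proof (cases "set I \<subseteq> {..<n}")
  case False
  then show ?thesis by (simp add: contraction_def gl_num_def)
next
  case True
  define p where "p = length I"
  have I: "I \<in> idx n p" using True by (simp add: idx_def p_def)
  have "contraction n (gl_num n g \<Phi>) I = (\<Sum>\<nu><n. Var (n + \<nu>) * (\<Sum>\<mu><n. \<Sum>J\<in>idx n p.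
      Const (mat_inv g $$ (\<mu>, \<nu>) * tens (mat_inv g) J I) * subst_gl n g (\<Phi> (\<mu> # J))))"
    unfolding contraction_def using I
    by (intro sum.cong refl) (simp add: gl_num_idx[of _ n "Suc p"] idx_Cons sum_idx_Suc)
  also have "\<dots> = (\<Sum>\<nu><n. \<Sum>\<mu><n. Const (mat_inv g $$ (\<mu>, \<nu>)) * Var (n + \<nu>) *
      (\<Sum>J\<in>idx n p. Const (tens (mat_inv g) J I) * subst_gl n g (\<Phi> (\<mu> # J))))"
    by (simp add: sum_distrib_left mult_ac)
  also have "\<dots> = (\<Sum>\<mu><n. \<Sum>\<nu><n. Const (mat_inv g $$ (\<mu>, \<nu>)) * Var (n + \<nu>) *
      (\<Sum>J\<in>idx n p. Const (tens (mat_inv g) J I) * subst_gl n g (\<Phi> (\<mu> # J))))"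
    by (rule sum.swap)
  also have "\<dots> = (\<Sum>\<mu><n. subst_gl n g (Var (n + \<mu>)) *
      (\<Sum>J\<in>idx n p. Const (tens (mat_inv g) J I) * subst_gl n g (\<Phi> (\<mu> # J))))"
    by (simp add: gl_var_simps sum_distrib_right)
  also have "\<dots> = (\<Sum>\<mu><n. \<Sum>J\<in>idx n p. Const (tens (mat_inv g) J I) *
      subst_gl n g (Var (n + \<mu>) * \<Phi> (\<mu> # J)))"
    by (simp add: sum_distrib_left mult_ac)
  also have "\<dots> = (\<Sum>J\<in>idx n p. Const (tens (mat_inv g) J I) * subst_gl n g (contraction n \<Phi> J))"
    by (subst sum.swap) (simp add: contraction_def sum_distrib_left)
  also have "\<dots> = 0" by (simp add: \<Phi>)
  finally show ?thesis .
qed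

lemma gl_num_numerators:
  fixes \<Phi> :: "nat list \<Rightarrow> 'k::field_char_0 mpoly"
  assumes "\<Phi> \<in> numerators n p r"
  shows "gl_num n g \<Phi> \<in> numerators n p r"
proof -
  have "dual.hom n (int r - int p) (gl_num n g \<Phi> I)" for I
    using gl_num_preserves[of "dual_degree n" n g \<Phi> "{int r - int p}" _ I] dual.grading_axioms hom_gl_var(1)
      numeratorsD(4)[OF assms] unfolding dual_homogeneous_hom dual.hom_def by blast
  moreover have "other.hom n 0 (gl_num n g \<Phi> I)" for I
    using gl_num_preserves[of "other_degree n" n g \<Phi> "{0}" _ I] other.grading_axioms hom_gl_var(3)
      numeratorsD(3)[OF assms] unfolding poly_zzd_hom other.hom_def by blast
  ultimately show ?thesis
    using assms by (simp add: numerators_def alternating_gl_num contraction_gl_num dual_homogeneous_hom poly_zzd_hom)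
qed

lemma numerators_zero: "(\<lambda>I. 0) \<in> numerators n p r"
  by (auto simp: numerators_def alternating_def contraction_def dual_homogeneous_hom poly_zzd_hom dual.hom_0 other.hom_0)

lemma numerators_add:
  "\<Phi> \<in> numerators n p r \<Longrightarrow> \<Psi> \<in> numerators n p r \<Longrightarrow> (\<lambda>I. \<Phi> I + \<Psi> I) \<in> numerators n p r"
  by (auto simp: numerators_def alternating_def contraction_def dual_homogeneous_hom poly_zzd_hom
      dual.hom_add other.hom_add ring_distribs sum.distrib)

lemma numerators_hom_mult:
  assumes "\<Phi> \<in> numerators n p r" "Q \<in> poly_zzd n" "dual_homogeneous n (int k) Q"
  shows "(\<lambda>I. Q * \<Phi> I) \<in> numerators n p (k + r)"
proof -
  have "dual.hom n (int (k + r) - int p) (Q * \<Phi> I)" for I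
    using dual.hom_mult[of n "int k" Q "int r - int p" "\<Phi> I"] assms(3) numeratorsD(4)[OF assms(1), of I]
    by (simp add: dual_homogeneous_hom algebra_simps)
  moreover have "other.hom n 0 (Q * \<Phi> I)" for I
    using other.hom_mult[of n 0 Q 0 "\<Phi> I"] assms(2) numeratorsD(3)[OF assms(1), of I]
    by (simp add: poly_zzd_hom)
  moreover have "contraction n (\<lambda>I. Q * \<Phi> I) I = 0" for I
  proof -
    have "contraction n (\<lambda>I. Q * \<Phi> I) I = Q * contraction n \<Phi> I"
      by (simp add: contraction_def sum_distrib_left mult_ac)
    then show ?thesis using numeratorsD(2)[OF assms(1)] by simp
  qed
  ultimately show ?thesis
    using assms(1) by (auto simp: numerators_def alternating_def dual_homogeneous_hom poly_zzd_hom)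
qed

lemma numerators_Const_mult: "\<Phi> \<in> numerators n p r \<Longrightarrow> (\<lambda>I. Const c * \<Phi> I) \<in> numerators n p r"
  using numerators_hom_mult[of \<Phi> n p r "Const c" 0]
  by (simp add: dual_homogeneous_hom poly_zzd_hom dual.hom_Const other.hom_Const)

lemma zz_dual_hom:
  "(zz_dual n ^ k :: 'a::field mpoly) \<in> poly_zzd n" "dual_homogeneous n (int k) (zz_dual n ^ k :: 'a mpoly)"
proof -
  have other: "other_degree n (single v 1) = 0" if "v < 2 * n" for v
    using that by (auto simp: other_degree_def fun_eq_iff lookup_single when_def)
  have "dual.hom n 1 (zz_dual n :: 'a mpoly)"
    unfolding zz_dual_def
  proof (intro dual.hom_sum)
    fix i assume "i \<in> {..<n}"
    then have "dual_degree n (single i 1) + dual_degree n (single (n + i) 1) = 1"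
      by (simp only: dual_degree_single) simp
    then show "dual.hom n 1 (Var i * Var (n + i) :: 'a mpoly)"
      using dual.hom_mult[OF dual.hom_Var dual.hom_Var, of n i "n + i"] by metis
  qed
  then have "dual.hom n (int k) (zz_dual n ^ k :: 'a mpoly)"
  proof (induction k)
    case 0
    then show ?case using dual.hom_Const[of n 1] by simp
  next
    case (Suc k)
    then show ?case using dual.hom_mult[of n 1 "zz_dual n" "int k" "zz_dual n ^ k"] by simp
  qed
  then show "dual_homogeneous n (int k) (zz_dual n ^ k :: 'a mpoly)" by (simp add: dual_homogeneous_hom)
  have oz: "other.hom n 0 (zz_dual n :: 'a mpoly)"
    unfolding zz_dual_def
  proof (intro other.hom_sum)
    fix i assume "i \<in> {..<n}"
    then have "other_degree n (single i 1) + other_degree n (single (n + i) 1) = 0"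
      using other[of i] other[of "n + i"] by simp
    then show "other.hom n 0 (Var i * Var (n + i) :: 'a mpoly)"
      using other.hom_mult[OF other.hom_Var other.hom_Var, of n i "n + i"] by metis
  qed
  have "other.hom n 0 (zz_dual n ^ k :: 'a mpoly)"
  proof (induction k)
    case 0
    then show ?case using other.hom_Const[of n 1] by (simp only: power_0 Const_simps)
  next
    case (Suc k)
    then have "other.hom n (0 + 0) (zz_dual n * zz_dual n ^ k :: 'a mpoly)" by (rule other.hom_mult[OF oz])
    then show ?case by (simp only: power_Suc add_0_left)
  qed
  then show "zz_dual n ^ k \<in> (poly_zzd n :: 'a mpoly set)" by (simp add: poly_zzd_hom)
qed

section \<open>Forms and their numerators\<close>

definition frac_form :: "nat \<Rightarrow> nat \<Rightarrow> (nat list \<Rightarrow> 'k::field mpoly) \<Rightarrow> 'k form" where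
  "frac_form n r \<Phi> = (\<lambda>I. Fract (\<Phi> I) (zz_dual n ^ r))"

lemma zz_dual_neq_0: "n \<ge> 1 \<Longrightarrow> (zz_dual n :: 'k::field_char_0 mpoly) \<noteq> 0"
proof
  assume "n \<ge> 1" "(zz_dual n :: 'k mpoly) = 0"
  then have "eval (\<lambda>_. 1) (zz_dual n :: 'k mpoly) = 0" by simp
  then show False using \<open>n \<ge> 1\<close> by (simp add: zz_dual_def)
qed

lemma zz_dual_nonzero: "n \<ge> 1 \<Longrightarrow> (zz_dual n :: 'k::field_char_0 mpoly) ^ r \<noteq> 0"
  by (simp add: zz_dual_neq_0)

lemma Fract_sum: "d \<noteq> 0 \<Longrightarrow> (\<Sum>i\<in>A. Fract (f i) d) = Fract (\<Sum>i\<in>A. f i) d"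
proof (induction A rule: infinite_finite_induct)
  case (insert x A)
  then show ?case by (simp add: eq_fract algebra_simps)
qed (simp_all add: Zero_fract_def eq_fract)

lemma Fract_add_same: "d \<noteq> 0 \<Longrightarrow> Fract a d + Fract b d = Fract (a + b) d"
  by (simp add: eq_fract algebra_simps)

lemma Fract_eq_same: "d \<noteq> 0 \<Longrightarrow> Fract a d = Fract b d \<longleftrightarrow> a = b"
  by (simp add: eq_fract)

definition integral_poly :: "'k::field mpoly \<Rightarrow> bool" where
  "integral_poly P \<longleftrightarrow> (\<forall>m. lookup P m \<in> \<int>)"

definition num_pair :: "nat \<Rightarrow> nat \<Rightarrow> (nat list \<Rightarrow> 'k::field mpoly) \<Rightarrow> (nat list \<Rightarrow> 'k mpoly) \<Rightarrow> 'k" where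
  "num_pair n p \<Phi> \<Psi> = (\<Sum>I\<in>idx n p. poly_pair (\<Phi> I) (\<Psi> I))"

definition numer :: "nat \<Rightarrow> nat \<Rightarrow> 'k::field_char_0 form \<Rightarrow> nat list \<Rightarrow> 'k mpoly" where
  "numer n r = inv_into UNIV (frac_form n r)"

context
  fixes n :: nat
  assumes n: "n \<ge> 1"
begin

lemma inj_frac_form: "inj (frac_form n r :: (nat list \<Rightarrow> 'k::field_char_0 mpoly) \<Rightarrow> _)"
proof (rule injI, rule ext)
  fix \<Phi> \<Psi> :: "nat list \<Rightarrow> 'k mpoly" and I
  assume "frac_form n r \<Phi> = frac_form n r \<Psi>"
  then have "Fract (\<Phi> I) (zz_dual n ^ r) = Fract (\<Psi> I) (zz_dual n ^ r)"
    by (simp add: frac_form_def fun_eq_iff)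
  then show "\<Phi> I = \<Psi> I" using Fract_eq_same[OF zz_dual_nonzero[OF n]] by blast
qed

lemma frac_form_add:
  "frac_form n r (\<lambda>I. \<Phi> I + \<Psi> I) = frac_form n r \<Phi> + (frac_form n r \<Psi> :: 'k::field_char_0 form)"
  by (simp add: frac_form_def fun_eq_iff Fract_add_same[OF zz_dual_nonzero[OF n]] del: add_fract)

lemma frac_form_scale: "frac_form n r (\<lambda>I. Const c * \<Phi> I) = form_scale c (frac_form n r \<Phi>)"
  by (simp add: frac_form_def form_scale_def fun_eq_iff)

lemma frac_form_shift:
  "frac_form n (k + r) (\<lambda>I. zz_dual n ^ k * \<Phi> I) = (frac_form n r \<Phi> :: 'k::field_char_0 form)"
  using zz_dual_neq_0[OF n, where 'k = 'k] by (simp add: frac_form_def fun_eq_iff eq_fract power_add mult_ac)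

lemma gl_fun_Fract:
  assumes g: "(g :: 'k::field_char_0 mat) \<in> GL n"
  shows "gl_fun n g (Fract P (zz_dual n ^ r)) = Fract (subst_gl n g P) (zz_dual n ^ r)"
proof -
  have "gl_fun n g (Fract P (zz_dual n ^ r)) = Fract (subst_gl n g P) (subst_gl n g (zz_dual n ^ r))"
    unfolding gl_fun_def subst_gl_def[symmetric]
    by (rule fract_map_Fract[OF inj_subst_gl[OF g]]) (simp_all add: zz_dual_neq_0[OF n])
  then show ?thesis using subst_gl_zz_dual[OF g] by simp
qed

lemma gl_form_frac_form:
  assumes g: "(g :: 'k::field_char_0 mat) \<in> GL n"
  shows "gl_form n g (frac_form n r \<Phi>) = frac_form n r (gl_num n g \<Phi>)"
proof
  fix I
  show "gl_form n g (frac_form n r \<Phi>) I = frac_form n r (gl_num n g \<Phi>) I"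
  proof (cases "set I \<subseteq> {..<n}")
    case False
    then show ?thesis by (simp add: gl_form_def frac_form_def gl_num_def Zero_fract_def eq_fract zz_dual_neq_0[OF n])
  next
    case True
    then have "gl_form n g (frac_form n r \<Phi>) I = (\<Sum>J\<in>idx n (length I).
        Fract (Const (tens (mat_inv g) J I) * subst_gl n g (\<Phi> J)) (zz_dual n ^ r))"
      by (simp add: gl_form_def frac_form_def gl_fun_Fract[OF g] idx_def tens_def)
    then show ?thesis
      using True by (simp add: Fract_sum[OF zz_dual_nonzero[OF n]] frac_form_def gl_num_def)
  qed
qed

lemma frac_form_alternating:
  "alternating n p (frac_form n r \<Phi>) \<longleftrightarrow> alternating n p (\<Phi> :: nat list \<Rightarrow> 'k::field_char_0 mpoly)"
proof -
  note nz = zz_dual_nonzero[OF n, of r, where 'k = 'k]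
  have "Fract P (zz_dual n ^ r) = 0 \<longleftrightarrow> P = 0" for P :: "'k mpoly"
    using Fract_eq_same[OF nz, of P 0] nz by (simp add: Zero_fract_def eq_fract)
  moreover have "Fract P (zz_dual n ^ r) = - Fract Q (zz_dual n ^ r) \<longleftrightarrow> P = - Q" for P Q :: "'k mpoly"
    using Fract_eq_same[OF nz, of P "- Q"] by simp
  ultimately show ?thesis by (simp add: alternating_def frac_form_def)
qed

lemma frac_form_contraction:
  "euler_contraction n (frac_form n r \<Phi>) = 0 \<longleftrightarrow> (\<forall>I. contraction n (\<Phi> :: nat list \<Rightarrow> 'k::field_char_0 mpoly) I = 0)"
proof -
  note nz = zz_dual_nonzero[OF n, of r, where 'k = 'k]
  have "euler_contraction n (frac_form n r \<Phi>) = (\<lambda>I. Fract (contraction n \<Phi> I) (zz_dual n ^ r))"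
    by (simp add: euler_contraction_def frac_form_def fun_eq_iff contraction_def Fract_sum[OF nz])
  moreover have "Fract P (zz_dual n ^ r) = 0 \<longleftrightarrow> P = 0" for P :: "'k mpoly"
    using nz by (simp add: Zero_fract_def eq_fract)
  ultimately show ?thesis by (simp add: fun_eq_iff zero_fun_def)
qed

lemma frac_form_mem:
  assumes \<Phi>: "\<Phi> \<in> numerators n p r"
  shows "(frac_form n r \<Phi> :: 'k::field_char_0 form) \<in> jouanolou_forms n p"
proof -
  have "int r - int p = - int p + int r" by simp
  then have "frac_form n r \<Phi> I \<in> jouanolou_ring_deg n (- int p)" for I
    unfolding jouanolou_ring_deg_def frac_form_def using numeratorsD(3,4)[OF \<Phi>, of I] by (metis (mono_tags, lifting) mem_Collect_eq)
  then show ?thesis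
    using numeratorsD(1,2)[OF \<Phi>]
    by (simp add: jouanolou_forms_def antisymmetric_form_iff frac_form_alternating frac_form_contraction)
qed

text \<open>A common denominator exists because a form vanishes off the finite set
  \<open>idx n p\<close>. Multiplying a numerator by powers of \<open>zz_dual\<close> raises its
  dual degree by as much as the exponent of the denominator.\<close>

lemma jouanolou_forms_frac_form:
  assumes \<omega>: "(\<omega> :: 'k::field_char_0 form) \<in> jouanolou_forms n p"
  obtains r \<Phi> where "\<Phi> \<in> numerators n p r" "\<omega> = frac_form n r \<Phi>"
proof -
  have "\<exists>P r. \<omega> I = Fract P (zz_dual n ^ r) \<and> P \<in> poly_zzd n \<and> dual_homogeneous n (- int p + int r) P" for I
    using \<omega> unfolding jouanolou_forms_def jouanolou_ring_deg_def by blast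
  then obtain P e where P: "\<And>I. \<omega> I = Fract (P I) (zz_dual n ^ e I)" "\<And>I. P I \<in> poly_zzd n"
    "\<And>I. dual_homogeneous n (- int p + int (e I)) (P I)"
    by metis
  define r where "r = Max (insert 0 (e ` idx n p))"
  have e: "e I \<le> r" if "I \<in> idx n p" for I
    unfolding r_def using that by (intro Max_ge) auto
  define \<Phi> where "\<Phi> I = (if I \<in> idx n p then zz_dual n ^ (r - e I) * P I else 0)" for I
  have \<omega>\<Phi>: "\<omega> = frac_form n r \<Phi>"
  proof
    fix I
    show "\<omega> I = frac_form n r \<Phi> I"
    proof (cases "I \<in> idx n p")
      case True
      have "(zz_dual n :: 'k mpoly) ^ r = zz_dual n ^ (r - e I) * zz_dual n ^ e I"
        using e[OF True] by (simp add: power_add[symmetric])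
      then show ?thesis
        using True zz_dual_neq_0[OF n, where 'k = 'k] by (simp add: \<Phi>_def frac_form_def P(1)[of I] eq_fract mult_ac)
    next
      case False
      then have "\<omega> I = 0"
        using \<omega> by (auto simp: jouanolou_forms_def antisymmetric_form_def idx_def)
      then show ?thesis using False zz_dual_neq_0[OF n, where 'k = 'k]
        by (simp add: \<Phi>_def frac_form_def Zero_fract_def eq_fract)
    qed
  qed
  have "\<Phi> I \<in> poly_zzd n \<and> dual_homogeneous n (int r - int p) (\<Phi> I)" for I
  proof (cases "I \<in> idx n p")
    case True
    have "dual.hom n (int (r - e I) + (- int p + int (e I))) (zz_dual n ^ (r - e I) * P I)"
      using zz_dual_hom(2)[of n "r - e I"] P(3)[of I] unfolding dual_homogeneous_hom by (rule dual.hom_mult)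
    moreover have "int (r - e I) + (- int p + int (e I)) = int r - int p" using e[OF True] by simp
    moreover have "other.hom n (0 + 0) (zz_dual n ^ (r - e I) * P I)"
      using zz_dual_hom(1)[of n "r - e I"] P(2)[of I] unfolding poly_zzd_hom by (rule other.hom_mult)
    ultimately show ?thesis using True by (simp add: \<Phi>_def dual_homogeneous_hom poly_zzd_hom)
  qed (simp add: \<Phi>_def dual_homogeneous_hom poly_zzd_hom dual.hom_0 other.hom_0)
  then have "\<Phi> \<in> numerators n p r"
    using \<omega> unfolding \<omega>\<Phi> numerators_def
    by (simp add: jouanolou_forms_def antisymmetric_form_iff frac_form_alternating frac_form_contraction)
  then show ?thesis using that \<omega>\<Phi> by blast
qed

lemma numer_frac_form [simp]: "numer n r (frac_form n r \<Phi>) = (\<Phi> :: nat list \<Rightarrow> 'k::field_char_0 mpoly)"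
  by (simp add: numer_def inv_f_f[OF inj_frac_form])

text \<open>The two ingredients of the action are transposed separately: the tensor entries by
  \<open>tens_transpose\<close>, the coefficients by \<open>poly_pair_subst_gl\<close>.\<close>

lemma num_pair_contravariant:
  assumes g: "(g :: 'k::field_char_0 mat) \<in> GL n" and \<Phi>: "\<Phi> \<in> numerators n p r" and \<Psi>: "\<Psi> \<in> numerators n p r"
  shows "num_pair n p (gl_num n g \<Phi>) \<Psi> = num_pair n p \<Phi> (gl_num n (transpose_mat g) \<Psi>)"
proof -
  have "num_pair n p (gl_num n g \<Phi>) \<Psi> = (\<Sum>I\<in>idx n p. \<Sum>J\<in>idx n p.
      tens (mat_inv g) J I * poly_pair (subst_gl n g (\<Phi> J)) (\<Psi> I))"
    by (simp add: num_pair_def gl_num_idx poly_pair_sum_left poly_pair_Const_left)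
  also have "\<dots> = (\<Sum>J\<in>idx n p. \<Sum>I\<in>idx n p.
      tens (mat_inv g) J I * poly_pair (subst_gl n g (\<Phi> J)) (\<Psi> I))"
    by (rule sum.swap)
  also have "\<dots> = (\<Sum>J\<in>idx n p. \<Sum>I\<in>idx n p.
      tens (mat_inv (transpose_mat g)) I J * poly_pair (\<Phi> J) (subst_gl n (transpose_mat g) (\<Psi> I)))"
    using GL_mat_inv(1)[OF g] numeratorsD(3)[OF \<Phi>] numeratorsD(3)[OF \<Psi>]
    by (intro sum.cong refl) (simp add: GL_transpose[OF g] tens_transpose[of _ n _ p] poly_pair_subst_gl[OF g])
  also have "\<dots> = num_pair n p \<Phi> (gl_num n (transpose_mat g) \<Psi>)"
    by (simp add: num_pair_def gl_num_idx poly_pair_sum_right poly_pair_Const_right)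
  finally show ?thesis .
qed

text \<open>The pairing is computed as an integer, where positivity makes sense, and the integers
  embed into a field of characteristic 0.\<close>

lemma num_pair_self:
  fixes \<Phi> :: "nat list \<Rightarrow> 'k::field_char_0 mpoly"
  assumes int: "\<And>I. integral_poly (\<Phi> I)" and nz: "I0 \<in> idx n p" "\<Phi> I0 \<noteq> 0"
  shows "num_pair n p \<Phi> \<Phi> \<noteq> 0"
proof -
  have "\<exists>c. lookup (\<Phi> I) m = of_int c" for I m
    using int[of I] by (auto simp: integral_poly_def elim: Ints_cases)
  then obtain c where c: "\<And>I m. lookup (\<Phi> I) m = of_int (c I m)" by metis
  let ?s = "\<Sum>I\<in>idx n p. \<Sum>m\<in>keys (\<Phi> I). int (monomial_fact m) * (c I m * c I m)"
  have mf: "monomial_fact m > 0" for m by (simp add: monomial_fact_def prod_pos)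
  have eq: "num_pair n p \<Phi> \<Phi> = of_int ?s"
    by (simp add: num_pair_def poly_pair_def c mult.assoc)
  have "?s > 0"
  proof -
    obtain m where m: "m \<in> keys (\<Phi> I0)" using nz(2) by (metis all_not_in_conv keys_eq_empty)
    then have cm: "c I0 m \<noteq> 0" using c[of I0 m] by (auto simp: in_keys_iff)
    have nn: "int (monomial_fact m) * (c I m * c I m) \<ge> 0" for I m by simp
    have "(\<Sum>m\<in>keys (\<Phi> I0). int (monomial_fact m) * (c I0 m * c I0 m)) > 0"
      by (rule sum_pos2[OF _ m]) (use cm mf[of m] nn in \<open>auto simp: zero_less_mult_iff linorder_neq_iff\<close>)
    then show ?thesis
      by (rule sum_pos2[OF finite_idx nz(1)]) (use nn in \<open>auto intro: sum_nonneg\<close>)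
  qed
  then have "?s \<noteq> 0" by linarith
  then show ?thesis unfolding eq of_int_eq_0_iff .
qed

end

section \<open>Polynomials with integral coefficients\<close>

lemma integral_poly_add: "integral_poly P \<Longrightarrow> integral_poly Q \<Longrightarrow> integral_poly (P + Q)"
  by (auto simp: integral_poly_def lookup_add)

lemma integral_poly_sum: "(\<And>i. i \<in> A \<Longrightarrow> integral_poly (f i)) \<Longrightarrow> integral_poly (\<Sum>i\<in>A. f i)"
  by (induction A rule: infinite_finite_induct) (auto simp: integral_poly_add, auto simp: integral_poly_def)

lemma integral_poly_mult:
  assumes "integral_poly P" "integral_poly Q"
  shows "integral_poly (P * Q)"
proof -
  have "integral_poly (single m c * single m' c')" if "c \<in> \<int>" "c' \<in> \<int>" for m m' and c c' :: 'a
    using that by (auto simp: integral_poly_def mult_single lookup_single when_def)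
  moreover have "P * Q = (\<Sum>m\<in>keys P. \<Sum>m'\<in>keys Q. single m (lookup P m) * single m' (lookup Q m'))"
    by (subst (1 2) poly_mapping_sum_single[symmetric]) (simp add: sum_product)
  ultimately show ?thesis
    using assms by (auto simp: integral_poly_def[of P] integral_poly_def[of Q] intro!: integral_poly_sum)
qed

lemma integral_poly_Var: "integral_poly (Var v)"
  by (auto simp: integral_poly_def Var_def lookup_single when_def)

lemma integral_poly_0_1: "integral_poly 0" "integral_poly 1"
  by (auto simp: integral_poly_def lookup_one when_def)

lemma integral_poly_prod: "(\<And>i. i \<in> A \<Longrightarrow> integral_poly (f i)) \<Longrightarrow> integral_poly (\<Prod>i\<in>A. f i)"
  by (induction A rule: infinite_finite_induct) (auto simp: integral_poly_mult integral_poly_0_1)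

lemma integral_poly_power: "integral_poly P \<Longrightarrow> integral_poly (P ^ k)"
  by (induction k) (auto simp: integral_poly_mult integral_poly_0_1)

lemma integral_poly_uminus: "integral_poly P \<Longrightarrow> integral_poly (- P)"
  by (auto simp: integral_poly_def)

lemma integral_zz_dual: "integral_poly (zz_dual n)"
  unfolding zz_dual_def by (intro integral_poly_sum integral_poly_mult integral_poly_Var)

text \<open>
  Gauss' lemma for the primitive polynomial \<open>zz\<^sup>*\<close>: among the monomials of \<open>P\<close> with non-integral
  coefficient take one of maximal degree in \<open>z\<^sub>0\<close> and multiply it by \<open>z\<^sub>0 z\<^sub>0\<^sup>*\<close>.
\<close>
lemma integral_poly_zz_dual_cancel:
  fixes P :: "'k::field mpoly"
  assumes n: "n \<ge> 1" and int: "integral_poly (zz_dual n * P)"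
  shows "integral_poly P"
proof (rule ccontr)
  assume "\<not> integral_poly P"
  define B where "B = {m. lookup P m \<notin> \<int>}"
  have "B \<noteq> {}" using \<open>\<not> integral_poly P\<close> by (auto simp: B_def integral_poly_def)
  have "finite B" unfolding B_def by (rule finite_subset[OF _ finite_keys[of P]]) (auto simp: in_keys_iff)
  let ?f = "\<lambda>m. lookup m 0"
  have "Max (?f ` B) \<in> ?f ` B" using \<open>finite B\<close> \<open>B \<noteq> {}\<close> by (intro Max_in) auto
  then obtain m where m: "m \<in> B" "lookup m 0 = Max (?f ` B)" by auto
  have max: "lookup m' 0 \<le> lookup m 0" if "m' \<in> B" for m'
    unfolding m(2) using \<open>finite B\<close> that by (intro Max_ge) auto
  let ?M = "m + single n 1 + single 0 1"
  \<comment> \<open>For \<open>i \<noteq> 0\<close> the monomial of \<open>P\<close> that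
    contributes has degree in \<open>z_0\<close> one higher than \<open>m\<close>, so its
    coefficient is integral by maximality.\<close>
  have coeff: "lookup (Var i * Var (n + i) * P) ?M \<in> \<int>" if "i \<noteq> 0" "i < n" for i
  proof -
    have "lookup P (?M - single i 1 - single (n + i) 1) \<in> \<int>"
    proof (rule ccontr)
      assume "\<not> ?thesis"
      then have "lookup (?M - single i 1 - single (n + i) 1) 0 \<le> lookup m 0" using max by (auto simp: B_def)
      then show False using that n by (simp add: lookup_add lookup_minus lookup_single when_def)
    qed
    then show ?thesis by (simp add: mult.assoc lookup_Var_mult)
  qed
  have "lookup (zz_dual n * P) ?M = (\<Sum>i<n. lookup (Var i * Var (n + i) * P) ?M)"
    by (simp add: zz_dual_def sum_distrib_right lookup_sum)
  also have "\<dots> = lookup (Var 0 * Var n * P) ?M + (\<Sum>i\<in>{..<n} - {0}. lookup (Var i * Var (n + i) * P) ?M)"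
    using n by (subst sum.remove[of _ 0]) auto
  also have "lookup (Var 0 * Var n * P) ?M = lookup P m"
    using n by (simp add: mult.assoc lookup_Var_mult lookup_add lookup_minus lookup_single)
  finally have "lookup P m = lookup (zz_dual n * P) ?M - (\<Sum>i\<in>{..<n} - {0}. lookup (Var i * Var (n + i) * P) ?M)"
    by simp
  moreover have "\<dots> \<in> \<int>"
    using int coeff by (intro Ints_diff Ints_sum) (auto simp: integral_poly_def)
  ultimately show False using m(1) by (simp add: B_def)
qed

section \<open>Weights\<close>

definition character :: "nat \<Rightarrow> int list \<Rightarrow> 'k::field mat \<Rightarrow> 'k" where
  "character n \<alpha> g = (\<Prod>i<n. (g $$ (i, i)) powi (\<alpha> ! i))"

definition num_hw :: "nat \<Rightarrow> int list \<Rightarrow> (nat list \<Rightarrow> 'k::field mpoly) \<Rightarrow> bool" where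
  "num_hw n \<alpha> \<Phi> \<longleftrightarrow> (\<forall>g\<in>GL n. upper_triangular g \<longrightarrow> gl_num n g \<Phi> = (\<lambda>I. Const (character n \<alpha> g) * \<Phi> I))"

lemma upper_triangular_GL:
  assumes g: "g \<in> GL n" and ut: "upper_triangular (g :: 'k::field mat)"
  shows "i < n \<Longrightarrow> g $$ (i, i) \<noteq> 0" "upper_triangular (mat_inv g)"
    "i < n \<Longrightarrow> mat_inv g $$ (i, i) = inverse (g $$ (i, i))"
proof -
  note c = GL_carrier[OF g] GL_mat_inv[OF g]
  have "det g * det (mat_inv g) = 1" using det_mult[OF c(1,2)] c(3) by simp
  then have "det g \<noteq> 0" by auto
  then show diag: "g $$ (i, i) \<noteq> 0" if "i < n" for i
    using upper_triangular_imp_det_eq_0_iff[OF c(1) ut] that c(1) by (auto simp: diag_mat_def)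
  have g0: "g $$ (k, j) = 0" if "j < k" "k < n" for k j
    using upper_triangularD[OF ut that(1)] that(2) c(1) by simp
  have eq: "(\<Sum>k<n. mat_inv g $$ (i, k) * g $$ (k, j)) = (if i = j then 1 else 0)" if "i < n" "j < n" for i j
    using mult_mat_index[OF c(2) c(1) that] that unfolding c(4) by simp
  have inv0: "mat_inv g $$ (i, j) = 0" if "j < i" "i < n" for i j
    using that
  proof (induction j rule: less_induct)
    case (less j)
    have "(\<Sum>k<n. mat_inv g $$ (i, k) * g $$ (k, j)) = (\<Sum>k\<in>{j}. mat_inv g $$ (i, k) * g $$ (k, j))"
      by (rule sum.mono_neutral_right) (use less g0 in \<open>auto simp: not_less_iff_gr_or_eq\<close>, metis less.IH less.prems less_trans linorder_neqE_nat)
    then show ?case using eq[of i j] less.prems diag[of j] by simp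
  qed
  then show "upper_triangular (mat_inv g)" using c(2) by (auto simp: upper_triangular_def)
  show "mat_inv g $$ (i, i) = inverse (g $$ (i, i))" if "i < n"
  proof -
    have "(\<Sum>k<n. mat_inv g $$ (i, k) * g $$ (k, i)) = (\<Sum>k\<in>{i}. mat_inv g $$ (i, k) * g $$ (k, i))"
      by (rule sum.mono_neutral_right) (use that g0 inv0 in \<open>auto, metis linorder_neqE_nat\<close>)
    then show ?thesis using eq[of i i] that diag[of i] by (simp add: field_simps)
  qed
qed

definition diagonal :: "nat \<Rightarrow> (nat \<Rightarrow> 'k::field) \<Rightarrow> 'k mat" where
  "diagonal n c = mat n n (\<lambda>(i, j). if i = j then c i else 0)"

lemma diagonal_simps [simp]:
  "diagonal n c \<in> carrier_mat n n" "i < n \<Longrightarrow> j < n \<Longrightarrow> diagonal n c $$ (i, j) = (if i = j then c i else 0)"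
  "dim_row (diagonal n c) = n" "dim_col (diagonal n c) = n"
  by (auto simp: diagonal_def)

lemma diagonal_mult_index:
  assumes "A \<in> carrier_mat n n" "i < n" "j < n"
  shows "(diagonal n c * A) $$ (i, j) = c i * A $$ (i, j)" "(A * diagonal n c) $$ (i, j) = A $$ (i, j) * c j"
proof -
  have "(diagonal n c * A) $$ (i, j) = (\<Sum>k<n. diagonal n c $$ (i, k) * A $$ (k, j))"
    by (rule mult_mat_index) (use assms in auto)
  also have "\<dots> = (\<Sum>k\<in>{i}. diagonal n c $$ (i, k) * A $$ (k, j))"
    by (rule sum.mono_neutral_right) (use assms in auto)
  finally show "(diagonal n c * A) $$ (i, j) = c i * A $$ (i, j)" using assms by simp
  have "(A * diagonal n c) $$ (i, j) = (\<Sum>k<n. A $$ (i, k) * diagonal n c $$ (k, j))"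
    by (rule mult_mat_index) (use assms in auto)
  also have "\<dots> = (\<Sum>k\<in>{j}. A $$ (i, k) * diagonal n c $$ (k, j))"
    by (rule sum.mono_neutral_right) (use assms in auto)
  finally show "(A * diagonal n c) $$ (i, j) = A $$ (i, j) * c j" using assms by simp
qed

lemma diagonal_GL:
  assumes "\<And>i. i < n \<Longrightarrow> c i \<noteq> 0"
  shows "diagonal n c \<in> GL n" "mat_inv (diagonal n c) = diagonal n (\<lambda>i. inverse (c i))"
    "upper_triangular (diagonal n c)"
proof -
  have "diagonal n c * diagonal n (\<lambda>i. inverse (c i)) = 1\<^sub>m n"
    "diagonal n (\<lambda>i. inverse (c i)) * diagonal n c = 1\<^sub>m n"
    by (rule eq_matI; use assms in \<open>simp add: diagonal_mult_index del: index_mult_mat(1)\<close>)+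
  then show "diagonal n c \<in> GL n" "mat_inv (diagonal n c) = diagonal n (\<lambda>i. inverse (c i))"
    using GL_I[of "diagonal n c" n "diagonal n (\<lambda>i. inverse (c i))"] by simp_all
  show "upper_triangular (diagonal n c)" by (auto simp: upper_triangular_def)
qed

text \<open>The torus weight of the term \<open>m dz\<^sup>*_I\<close>: the dual variable and its
  differential both contribute -1 in their place.\<close>

definition wt :: "nat \<Rightarrow> nat list \<Rightarrow> (nat \<Rightarrow>\<^sub>0 nat) \<Rightarrow> nat \<Rightarrow> int" where
  "wt n I m i = int (lookup m i) - int (lookup m (n + i)) - int (count_list I i)"

lemma tens_diagonal_diff: "J \<in> idx n p \<Longrightarrow> I \<in> idx n p \<Longrightarrow> J \<noteq> I \<Longrightarrow> tens (diagonal n c) J I = 0"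
  by (induction rule: idx_induct2) auto

lemma tens_diagonal_same: "set I \<subseteq> {..<n} \<Longrightarrow> tens (diagonal n c) I I = (\<Prod>i<n. c i ^ count_list I i)"
proof (induction I)
  case (Cons x I)
  have "(\<Prod>i<n. c i ^ count_list (x # I) i) = (\<Prod>i<n. (if i = x then c i else 1) * c i ^ count_list I i)"
    by (intro prod.cong refl) auto
  then show ?case using Cons by (simp add: prod.distrib)
qed simp

lemma lookup_gl_num_diagonal:
  assumes c: "\<And>i. i < n \<Longrightarrow> c i \<noteq> (0 :: 'k::field_char_0)" and \<Phi>: "\<Phi> \<in> numerators n p r"
  shows "lookup (gl_num n (diagonal n c) \<Phi> I) m = (\<Prod>i<n. c i powi wt n I m i) * lookup (\<Phi> I) m"
proof (cases "I \<in> idx n p")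
  case False
  then show ?thesis using gl_num_not_idx[OF False, of \<Phi>] numeratorsD(5)[OF \<Phi>] by simp
next
  case True
  let ?g = "diagonal n c"
  have inv: "mat_inv ?g = diagonal n (\<lambda>i. inverse (c i))" using c by (rule diagonal_GL(2))
  define d where "d v = (if v < n then c v else if v < 2 * n then inverse (c (v - n)) else 1)" for v
  have var: "gl_var n ?g = (\<lambda>v. Const (d v) * Var v)"
  proof
    show "gl_var n ?g v = Const (d v) * Var v" for v
    proof (cases rule: var_cases[of v n])
      case 1
      then show ?thesis
        by (simp add: gl_var_simps d_def if_distrib[of Const] if_distrib[of "\<lambda>c. c * _"] cong: if_cong)
    next
      case (2 u)
      then show ?thesis
        by (simp add: gl_var_simps inv d_def if_distrib[of Const] if_distrib[of "\<lambda>c. c * _"] cong: if_cong)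
    qed (simp add: gl_var_simps d_def)
  qed
  have "gl_num n ?g \<Phi> I = (\<Sum>J\<in>{I}. Const (tens (mat_inv ?g) J I) * subst_gl n ?g (\<Phi> J))"
    unfolding gl_num_idx[OF True] inv
    by (rule sum.mono_neutral_right) (use True in \<open>auto simp: tens_diagonal_diff\<close>)
  then have eq: "lookup (gl_num n ?g \<Phi> I) m =
      (\<Prod>i<n. inverse (c i) ^ count_list I i) * (mono_val d m * lookup (\<Phi> I) m)"
    using True tens_diagonal_same[of I n "\<lambda>i. inverse (c i)"]
    by (simp add: inv subst_gl_def var lookup_diag_subst idx_def)
  show ?thesis
  proof (cases "m \<in> keys (\<Phi> I)")
    case True
    then have "keys m \<subseteq> {..<2 * n}" using numeratorsD(3)[OF \<Phi>, of I] by (auto simp: poly_zzd_def)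
    then have "mono_val d m = (\<Prod>v<2*n. d v ^ lookup m v)" by (intro mono_val_superset) auto
    also have "\<dots> = (\<Prod>v<n. d v ^ lookup m v) * (\<Prod>v<n. d (n + v) ^ lookup m (n + v))"
    proof -
      have "(\<Prod>w<n + k. f w) = (\<Prod>w<n. f w) * (\<Prod>w<k. f (n + w))" for k and f :: "nat \<Rightarrow> 'k"
        by (induction k) (auto simp: mult.assoc)
      then show ?thesis by (simp add: mult_2)
    qed
    also have "\<dots> = (\<Prod>i<n. c i ^ lookup m i * inverse (c i) ^ lookup m (n + i))"
      by (simp add: d_def prod.distrib)
    finally have "(\<Prod>i<n. inverse (c i) ^ count_list I i) * mono_val d m =
        (\<Prod>i<n. inverse (c i) ^ count_list I i * (c i ^ lookup m i * inverse (c i) ^ lookup m (n + i)))"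
      by (simp add: prod.distrib)
    also have "\<dots> = (\<Prod>i<n. c i powi wt n I m i)"
    proof (intro prod.cong refl)
      fix i assume "i \<in> {..<n}"
      then have "c i \<noteq> 0" using c by simp
      then show "inverse (c i) ^ count_list I i * (c i ^ lookup m i * inverse (c i) ^ lookup m (n + i)) =
          c i powi wt n I m i"
        by (simp add: wt_def power_int_diff power_int_add field_simps)
    qed
    finally show ?thesis using eq by simp
  next
    case False
    then show ?thesis using eq by (simp add: in_keys_iff)
  qed
qed

definition num_weight :: "nat \<Rightarrow> (nat \<Rightarrow> int) \<Rightarrow> (nat list \<Rightarrow> 'k::field mpoly) \<Rightarrow> bool" where
  "num_weight n \<kappa> \<Phi> \<longleftrightarrow> (\<forall>I. \<forall>m\<in>keys (\<Phi> I). \<forall>i<n. wt n I m i = \<kappa> i)"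

lemma num_weight_diagonal:
  assumes c: "\<And>i. i < n \<Longrightarrow> c i \<noteq> (0 :: 'k::field_char_0)" and \<Phi>: "\<Phi> \<in> numerators n p r" "num_weight n \<kappa> \<Phi>"
  shows "gl_num n (diagonal n c) \<Phi> = (\<lambda>I. Const (\<Prod>i<n. c i powi \<kappa> i) * \<Phi> I)"
proof (rule ext, rule poly_mapping_eqI)
  fix I m
  show "lookup (gl_num n (diagonal n c) \<Phi> I) m = lookup (Const (\<Prod>i<n. c i powi \<kappa> i) * \<Phi> I) m"
  proof (cases "m \<in> keys (\<Phi> I)")
    case True
    then have "(\<Prod>i<n. c i powi wt n I m i) = (\<Prod>i<n. c i powi \<kappa> i)"
      using \<Phi>(2) by (intro prod.cong refl) (auto simp: num_weight_def)
    then show ?thesis by (simp add: lookup_gl_num_diagonal[OF c \<Phi>(1)])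
  next
    case False
    then show ?thesis by (simp add: lookup_gl_num_diagonal[OF c \<Phi>(1)] in_keys_iff)
  qed
qed

text \<open>The \<open>n\<close> diagonal matrices obtained from these entries already separate all
  weights, by \<open>two_powi_inj\<close>.\<close>

definition two_at :: "nat \<Rightarrow> nat \<Rightarrow> 'k::field_char_0" where
  "two_at k i = (if i = k then 2 else 1)"

lemma prod_two_at: "k < n \<Longrightarrow> (\<Prod>i<n. two_at k i powi f i) = (2 :: 'k::field_char_0) powi f k"
  by (simp add: two_at_def if_distrib[of "\<lambda>a. a powi _"] prod.If_cases cong: if_cong)

lemma two_at_nonzero: "two_at k i \<noteq> 0"
  by (simp add: two_at_def)

lemma lookup_gl_num_two_at:
  "k < n \<Longrightarrow> \<Phi> \<in> numerators n p r \<Longrightarrow>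
    lookup (gl_num n (diagonal n (two_at k)) \<Phi> I) m = (2 :: 'k::field_char_0) powi wt n I m k * lookup (\<Phi> I) m"
  using lookup_gl_num_diagonal[of n "two_at k" \<Phi> p r I m] by (simp add: two_at_nonzero prod_two_at)

lemma num_weight_two_at:
  "k < n \<Longrightarrow> \<Phi> \<in> numerators n p r \<Longrightarrow> num_weight n \<kappa> \<Phi> \<Longrightarrow>
    gl_num n (diagonal n (two_at k)) \<Phi> = (\<lambda>I. Const ((2 :: 'k::field_char_0) powi \<kappa> k) * \<Phi> I)"
  using num_weight_diagonal[of n "two_at k" \<Phi> p r \<kappa>] by (simp add: two_at_nonzero prod_two_at)

lemma num_weightI:
  fixes \<Phi> :: "nat list \<Rightarrow> 'k::field_char_0 mpoly"
  assumes \<Phi>: "\<Phi> \<in> numerators n p r"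
    and eq: "\<And>k. k < n \<Longrightarrow> gl_num n (diagonal n (two_at k)) \<Phi> = (\<lambda>I. Const (2 powi \<kappa> k) * \<Phi> I)"
  shows "num_weight n \<kappa> \<Phi>"
  unfolding num_weight_def
proof (intro allI ballI impI)
  fix I m i assume m: "m \<in> keys (\<Phi> I)" and i: "i < n"
  have "lookup (gl_num n (diagonal n (two_at i)) \<Phi> I) m = lookup (Const (2 powi \<kappa> i) * \<Phi> I) m"
    using eq[OF i] by simp
  then have "2 powi wt n I m i * lookup (\<Phi> I) m = 2 powi \<kappa> i * lookup (\<Phi> I) m"
    by (simp add: lookup_gl_num_two_at[OF i \<Phi>])
  then show "wt n I m i = \<kappa> i" using m two_powi_inj[where 'k = 'k] by (simp add: in_keys_iff)
qed

section \<open>Existence of highest weight vectors\<close>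

text \<open>Weights are compared by pairing with the strictly decreasing vector
  \<open>(n, n - 1, ..., 1)\<close>. Every positive root \<open>e_i - e_j\<close>,
  \<open>i < j\<close>, then has positive height, and adding positive roots is what upper triangular
  matrices do to weights.\<close>

definition height_poly :: "nat \<Rightarrow> (nat \<Rightarrow>\<^sub>0 nat) \<Rightarrow> int" where
  "height_poly n m = (\<Sum>i<n. (int n - int i) * (int (lookup m i) - int (lookup m (n + i))))"

definition height_list :: "nat \<Rightarrow> nat list \<Rightarrow> int" where
  "height_list n I = (\<Sum>i\<leftarrow>I. int n - int i)"

definition height :: "nat \<Rightarrow> (nat \<Rightarrow> int) \<Rightarrow> int" where
  "height n \<kappa> = (\<Sum>i<n. (int n - int i) * \<kappa> i)"

lemma sum_count_list: "set I \<subseteq> {..<n} \<Longrightarrow> (\<Sum>i<n. f i * int (count_list I i)) = (\<Sum>i\<leftarrow>I. f i)" for f :: "nat \<Rightarrow> int"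
proof (induction I)
  case (Cons x I)
  have "(\<Sum>i<n. f i * int (count_list (x # I) i)) = (\<Sum>i<n. (if i = x then f i else 0) + f i * int (count_list I i))"
    by (intro sum.cong refl) (auto simp: algebra_simps)
  then show ?case using Cons by (simp add: sum.distrib)
qed simp

lemma height_wt: "set I \<subseteq> {..<n} \<Longrightarrow> height n (wt n I m) = height_poly n m - height_list n I"
proof -
  assume I: "set I \<subseteq> {..<n}"
  have "height n (wt n I m) = height_poly n m - (\<Sum>i<n. (int n - int i) * int (count_list I i))"
    by (simp add: height_def wt_def height_poly_def right_diff_distrib sum_subtractf)
  then show ?thesis using sum_count_list[OF I] by (simp add: height_list_def)
qed

lemma height_poly_add: "height_poly n (a + b) = height_poly n a + height_poly n b"
  by (simp add: height_poly_def lookup_add algebra_simps sum.distrib sum_subtractf)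

lemma height_poly_single:
  "v < n \<Longrightarrow> height_poly n (single v 1) = int n - int v"
  "v < n \<Longrightarrow> height_poly n (single (n + v) 1) = - (int n - int v)"
proof -
  assume v: "v < n"
  have "height_poly n (single v 1) = (\<Sum>i<n. if i = v then int n - int v else 0)"
    unfolding height_poly_def by (intro sum.cong refl) (use v in \<open>auto simp: lookup_single when_def\<close>)
  then show "height_poly n (single v 1) = int n - int v" using v by simp
  have "height_poly n (single (n + v) 1) = (\<Sum>i<n. if i = v then - (int n - int v) else 0)"
    unfolding height_poly_def by (intro sum.cong refl) (auto simp: lookup_single when_def)
  then show "height_poly n (single (n + v) 1) = - (int n - int v)" using v by simp
qed

definition above :: "nat \<Rightarrow> int \<Rightarrow> 'k::field mpoly \<Rightarrow> bool" where
  "above n h P \<longleftrightarrow> (\<forall>m\<in>keys P. h \<le> height_poly n m)"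

lemma above_add: "above n h P \<Longrightarrow> above n h Q \<Longrightarrow> above n h (P + Q)"
  unfolding above_def using keys_add[of P Q] by blast

lemma above_sum: "(\<And>i. i \<in> A \<Longrightarrow> above n h (f i)) \<Longrightarrow> above n h (\<Sum>i\<in>A. f i)"
  by (induction A rule: infinite_finite_induct) (auto simp: above_add, auto simp: above_def)

lemma above_mult: "above n h P \<Longrightarrow> above n h' Q \<Longrightarrow> above n (h + h') (P * Q)"
  unfolding above_def using keys_mult[of P Q] by (fastforce simp: height_poly_add)

lemma above_Const_mult: "above n h P \<Longrightarrow> above n h (Const c * P)"
  by (auto simp: above_def in_keys_iff)

lemma above_mono: "above n h P \<Longrightarrow> h' \<le> h \<Longrightarrow> above n h' P"
  by (auto simp: above_def)

lemma above_Suc: "above n (h + 1) P \<Longrightarrow> above n h P"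
  by (auto simp: above_def)

lemma above_Var: "above n (height_poly n (single v 1)) (Var v)"
  by (simp add: above_def Var_def)

text \<open>Equality in the associated graded ring of the filtration by height: both polynomials
  have no terms below \<open>h\<close> and the same terms of height \<open>h\<close>.\<close>

definition lead_eq :: "nat \<Rightarrow> int \<Rightarrow> 'k::field mpoly \<Rightarrow> 'k mpoly \<Rightarrow> bool" where
  "lead_eq n h P Q \<longleftrightarrow> above n h P \<and> above n h Q \<and> above n (h + 1) (P - Q)"

lemma lead_eq_mult:
  assumes "lead_eq n h P Q" "lead_eq n h' P' Q'"
  shows "lead_eq n (h + h') (P * P') (Q * Q')"
proof -
  have "above n ((h + 1) + h') ((P - Q) * P')" "above n (h + (h' + 1)) (Q * (P' - Q'))"
    using assms by (auto simp: lead_eq_def intro!: above_mult)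
  then have "above n (h + h' + 1) ((P - Q) * P' + Q * (P' - Q'))"
    by (intro above_add) (auto simp: algebra_simps)
  moreover have "(P - Q) * P' + Q * (P' - Q') = P * P' - Q * Q'" by (simp add: algebra_simps)
  ultimately show ?thesis using assms by (auto simp: lead_eq_def intro!: above_mult)
qed

lemma lead_eq_mono_val:
  assumes "\<And>v. lead_eq n (height_poly n (single v 1)) (\<sigma> v) (\<tau> v)"
  shows "lead_eq n (height_poly n m) (mono_val \<sigma> m) (mono_val \<tau> m)"
proof (induction m rule: monomial_induct)
  case zero
  then show ?case by (simp add: lead_eq_def above_def height_poly_def)
next
  case (add m v)
  then show ?case using lead_eq_mult[OF add assms[of v]] by (simp add: mono_val_add height_poly_add)
qed

lemma lead_eq_subst:
  assumes "\<And>v. lead_eq n (height_poly n (single v 1)) (\<sigma> v) (\<tau> v)" and P: "\<And>m. m \<in> keys P \<Longrightarrow> height_poly n m = h"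
  shows "lead_eq n h (poly_subst \<sigma> P) (poly_subst \<tau> P)"
proof -
  have *: "lead_eq n h (mono_val \<sigma> m) (mono_val \<tau> m)" if "m \<in> keys P" for m
    using lead_eq_mono_val[OF assms(1), of m] P[OF that] by simp
  show ?thesis
    unfolding lead_eq_def poly_subst_coeff_eval coeff_eval_def sum_subtractf[symmetric] right_diff_distrib[symmetric]
    using * by (auto simp: lead_eq_def intro!: above_sum above_Const_mult)
qed

text \<open>An upper triangular matrix sends \<open>z_v\<close> to a combination of the
  \<open>z_i\<close> with \<open>i \<le> v\<close>, and its inverse sends the dual variable of index
  \<open>u\<close> to a combination of those with \<open>i \<ge> u\<close>. In both cases the
  remaining variables have greater height.\<close>

lemma lead_eq_gl_var:
  assumes g: "g \<in> GL n" and ut: "upper_triangular (g :: 'k::field_char_0 mat)"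
  shows "lead_eq n (height_poly n (single v 1)) (gl_var n g v) (gl_var n (diagonal n (\<lambda>i. g $$ (i, i))) v)"
proof (cases rule: var_cases[of v n])
  case 1
  have t: "above n (height_poly n (single v 1) + (if i = v then 0 else 1)) (Const (g $$ (i, v)) * Var i)" if "i < n" for i
  proof (cases "v < i")
    case True
    then have "g $$ (i, v) = 0" using upper_triangularD[OF ut True] that GL_carrier[OF g] by simp
    then show ?thesis by (simp add: above_def)
  next
    case False
    then show ?thesis using that 1
      by (intro above_Const_mult above_mono[OF above_Var]) (simp only: height_poly_single, auto)
  qed
  have d: "gl_var n (diagonal n (\<lambda>i. g $$ (i, i))) v = Const (g $$ (v, v)) * Var v"
    using 1 by (simp add: gl_var_simps if_distrib[of Const] if_distrib[of "\<lambda>c. c * _"] cong: if_cong)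
  have "gl_var n g v = Const (g $$ (v, v)) * Var v + (\<Sum>i\<in>{..<n} - {v}. Const (g $$ (i, v)) * Var i)"
    unfolding gl_var_simps(1)[OF 1] using 1 by (intro sum.remove) auto
  moreover have "above n (height_poly n (single v 1) + 1) (\<Sum>i\<in>{..<n} - {v}. Const (g $$ (i, v)) * Var i)"
    using t by (intro above_sum) (force split: if_splits)
  moreover have "above n (height_poly n (single v 1)) (Const (g $$ (v, v)) * Var v)" by (rule above_Const_mult[OF above_Var])
  ultimately show ?thesis unfolding lead_eq_def d by (auto intro!: above_add intro: above_Suc)
next
  case (2 u)
  note h = upper_triangular_GL[OF g ut]
  let ?h = "mat_inv g"
  have t: "above n (height_poly n (single v 1) + (if i = u then 0 else 1)) (Const (?h $$ (u, i)) * Var (n + i))" if "i < n" for i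
  proof (cases "i < u")
    case True
    then have "?h $$ (u, i) = 0" using upper_triangularD[OF h(2) True] 2 GL_mat_inv(1)[OF g] by simp
    then show ?thesis by (simp add: above_def)
  next
    case False
    then show ?thesis using that 2(1) unfolding 2(2)
      by (intro above_Const_mult above_mono[OF above_Var]) (simp only: height_poly_single, auto)
  qed
  have d: "gl_var n (diagonal n (\<lambda>i. g $$ (i, i))) v = Const (?h $$ (u, u)) * Var (n + u)"
    using 2 h(3)[of u] diagonal_GL(2)[of n "\<lambda>i. g $$ (i, i)"] h(1)
    by (simp add: gl_var_simps if_distrib[of Const] if_distrib[of "\<lambda>c. c * _"] cong: if_cong)
  have "gl_var n g v = Const (?h $$ (u, u)) * Var (n + u) + (\<Sum>i\<in>{..<n} - {u}. Const (?h $$ (u, i)) * Var (n + i))"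
    unfolding 2(2) gl_var_simps(2)[OF 2(1)] using 2 by (intro sum.remove) auto
  moreover have "above n (height_poly n (single v 1) + 1) (\<Sum>i\<in>{..<n} - {u}. Const (?h $$ (u, i)) * Var (n + i))"
    using t by (intro above_sum) (force split: if_splits)
  moreover have "above n (height_poly n (single v 1)) (Const (?h $$ (u, u)) * Var (n + u))"
    unfolding 2(2) by (rule above_Const_mult[OF above_Var])
  ultimately show ?thesis unfolding lead_eq_def d by (auto intro!: above_add intro: above_Suc)
next
  case 3
  then show ?thesis using above_Var[of n v] by (simp add: gl_var_simps lead_eq_def) (simp add: above_def)
qed

text \<open>A nonzero entry requires \<open>J ! t \<le> I ! t\<close> in every place, and smaller
  indices have greater height.\<close>

lemma tens_upper_triangular:
  assumes ut: "upper_triangular A" "A \<in> carrier_mat n n" and "J \<in> idx n p" "I \<in> idx n p"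
  shows "tens A J I \<noteq> 0 \<Longrightarrow> J = I \<or> height_list n I < height_list n J"
  using assms(3,4)
proof (induction rule: idx_induct2)
  case (Cons p j J i I)
  then have "A $$ (j, i) \<noteq> 0" by auto
  then have "j \<le> i" using upper_triangularD[OF ut(1), of i j] ut(2) Cons.hyps by force
  moreover have "J = I \<or> height_list n I < height_list n J" using Cons.IH Cons.prems by (metis mult_zero_right tens_Cons)
  ultimately show ?case by (cases "j = i") (auto simp: height_list_def)
qed simp

text \<open>An upper triangular matrix differs from its diagonal part by terms of greater weight
  only. For \<open>J = I\<close> the surplus comes from the coefficients by \<open>lead_eq\<close>.
  For \<open>J \<noteq> I\<close> it comes from the differentials: coefficients of a weight vector
  at \<open>J\<close> have height \<open>height n \<kappa> + height_list n J\<close>, which exceeds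
  the value at \<open>I\<close>.\<close>

lemma num_weight_upper_triangular:
  fixes \<Phi> :: "nat list \<Rightarrow> 'k::field_char_0 mpoly"
  assumes g: "g \<in> GL n" "upper_triangular g" and \<Phi>: "\<Phi> \<in> numerators n p r" "num_weight n \<kappa> \<Phi>"
    and I: "I \<in> idx n p" and m: "m \<in> keys (gl_num n g \<Phi> I - Const (\<Prod>i<n. (g $$ (i, i)) powi \<kappa> i) * \<Phi> I)"
  shows "height n \<kappa> < height n (wt n I m)"
proof -
  note inv = upper_triangular_GL[OF g]
  let ?d = "diagonal n (\<lambda>i. g $$ (i, i))"
  have ht: "height_poly n m = height n \<kappa> + height_list n J" if "m \<in> keys (\<Phi> J)" "J \<in> idx n p" for J m
  proof -
    have "height n (wt n J m) = height n \<kappa>"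
      unfolding height_def using \<Phi>(2) that(1) by (intro sum.cong refl) (auto simp: num_weight_def)
    then show ?thesis using height_wt[of J n m] that(2) by (simp add: idx_def)
  qed
  have lead: "lead_eq n (height n \<kappa> + height_list n J) (subst_gl n g (\<Phi> J)) (subst_gl n ?d (\<Phi> J))" if "J \<in> idx n p" for J
    unfolding subst_gl_def by (rule lead_eq_subst[OF lead_eq_gl_var[OF g]]) (rule ht[OF _ that])
  have d_same: "tens (mat_inv ?d) I I = tens (mat_inv g) I I"
    using inv(3) diagonal_GL(2)[of n "\<lambda>i. g $$ (i, i)"] inv(1) I
    unfolding tens_def by (intro prod.cong refl) (auto simp: idx_def subset_iff)
  have "gl_num n g \<Phi> I - gl_num n ?d \<Phi> I =
      (\<Sum>J\<in>idx n p. Const (tens (mat_inv g) J I) * subst_gl n g (\<Phi> J) - Const (tens (mat_inv ?d) J I) * subst_gl n ?d (\<Phi> J))"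
    by (simp add: gl_num_idx[OF I] sum_subtractf)
  moreover have "above n (height n \<kappa> + height_list n I + 1)
      (\<Sum>J\<in>idx n p. Const (tens (mat_inv g) J I) * subst_gl n g (\<Phi> J) - Const (tens (mat_inv ?d) J I) * subst_gl n ?d (\<Phi> J))"
  proof (intro above_sum)
    fix J assume J: "J \<in> idx n p"
    show "above n (height n \<kappa> + height_list n I + 1)
      (Const (tens (mat_inv g) J I) * subst_gl n g (\<Phi> J) - Const (tens (mat_inv ?d) J I) * subst_gl n ?d (\<Phi> J))"
    proof (cases "J = I")
      case True
      have "above n (height n \<kappa> + height_list n I + 1) (Const (tens (mat_inv g) I I) * (subst_gl n g (\<Phi> I) - subst_gl n ?d (\<Phi> I)))"
        using lead[OF I] by (intro above_Const_mult) (simp add: lead_eq_def)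
      then show ?thesis unfolding True d_same by (simp only: right_diff_distrib)
    next
      case False
      have d0: "tens (mat_inv ?d) J I = 0"
        using False tens_diagonal_diff[OF J I] diagonal_GL(2)[of n "\<lambda>i. g $$ (i, i)"] inv(1) by auto
      show ?thesis
      proof (cases "tens (mat_inv g) J I = 0")
        case True
        then show ?thesis using d0 by (simp add: above_def)
      next
        case nz: False
        then have "height_list n I < height_list n J"
          using tens_upper_triangular[OF inv(2) GL_mat_inv(1)[OF g(1)] J I nz] False by simp
        moreover have "above n (height n \<kappa> + height_list n J) (subst_gl n g (\<Phi> J))"
          using lead[OF J] by (simp add: lead_eq_def)
        ultimately have "above n (height n \<kappa> + height_list n I + 1) (subst_gl n g (\<Phi> J))"
          by (auto elim: above_mono)
        then show ?thesis unfolding d0 by (simp add: above_Const_mult)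
      qed
    qed
  qed
  ultimately have "above n (height n \<kappa> + height_list n I + 1) (gl_num n g \<Phi> I - gl_num n ?d \<Phi> I)" by simp
  moreover have "gl_num n ?d \<Phi> = (\<lambda>I. Const (\<Prod>i<n. (g $$ (i, i)) powi \<kappa> i) * \<Phi> I)"
    by (rule num_weight_diagonal[OF inv(1) \<Phi>])
  ultimately have "height n \<kappa> + height_list n I + 1 \<le> height_poly n m"
    using m by (simp add: above_def)
  then show ?thesis using height_wt[of I n m] I by (simp add: idx_def)
qed

section \<open>Stable spaces of numerators and their weight components\<close>

definition num_stable :: "nat \<Rightarrow> (nat list \<Rightarrow> 'k::field mpoly) set \<Rightarrow> bool" where
  "num_stable n W \<longleftrightarrow> (\<forall>\<Phi>\<in>W. \<forall>\<Psi>\<in>W. (\<lambda>I. \<Phi> I + \<Psi> I) \<in> W) \<and>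
     (\<forall>c. \<forall>\<Phi>\<in>W. (\<lambda>I. Const c * \<Phi> I) \<in> W) \<and> (\<forall>g\<in>GL n. \<forall>\<Phi>\<in>W. gl_num n g \<Phi> \<in> W)"

lemma num_stableD:
  assumes "num_stable n W"
  shows "\<Phi> \<in> W \<Longrightarrow> \<Psi> \<in> W \<Longrightarrow> (\<lambda>I. \<Phi> I + \<Psi> I) \<in> W" "\<Phi> \<in> W \<Longrightarrow> (\<lambda>I. Const c * \<Phi> I) \<in> W"
    "g \<in> GL n \<Longrightarrow> \<Phi> \<in> W \<Longrightarrow> gl_num n g \<Phi> \<in> W"
  using assms by (auto simp: num_stable_def)

text \<open>A family is read as one function on the pairs \<open>(I, m)\<close>, on which the torus
  acts diagonally; it has finite support there, as \<open>multigraded_component\<close>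
  requires.\<close>

lemma num_component:
  fixes W :: "(nat list \<Rightarrow> 'k::field_char_0 mpoly) set"
  assumes W: "W \<subseteq> numerators n p r"
    and stable: "num_stable n W"
    and \<Phi>: "\<Phi> \<in> W"
  obtains \<Psi> where "\<Psi> \<in> W"
    "\<And>I m. lookup (\<Psi> I) m = (if \<forall>i<n. wt n I m i = \<kappa> i then lookup (\<Phi> I) m else 0)"
proof -
  note add = num_stableD(1)[OF stable] and scl = num_stableD(2)[OF stable] and gl = num_stableD(3)[OF stable]
  define coef where "coef \<Phi> = (\<lambda>(I, m). lookup (\<Phi> I) m)" for \<Phi> :: "nat list \<Rightarrow> 'k mpoly"
  have "(\<lambda>x. if \<forall>i\<in>{..<n}. (case x of (I, m) \<Rightarrow> wt n I m i) = \<kappa> i then coef \<Phi> x else 0) \<in> coef ` W"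
  proof (rule multigraded_component)
    fix f h assume "f \<in> coef ` W" "h \<in> coef ` W"
    then obtain \<Phi> \<Psi> where *: "\<Phi> \<in> W" "\<Psi> \<in> W" "f = coef \<Phi>" "h = coef \<Psi>" by blast
    then show "(\<lambda>x. f x + h x) \<in> coef ` W"
      by (intro image_eqI[OF _ add[OF *(1,2)]]) (auto simp: coef_def lookup_add)
  next
    fix a f assume "f \<in> coef ` W"
    then obtain \<Phi> where *: "\<Phi> \<in> W" "f = coef \<Phi>" by blast
    then show "(\<lambda>x. a * f x) \<in> coef ` W"
      by (intro image_eqI[OF _ scl[OF *(1)]]) (auto simp: coef_def)
  next
    fix i f assume i: "i \<in> {..<n}" and "f \<in> coef ` W"
    then obtain \<Phi> where \<Phi>: "\<Phi> \<in> W" "f = coef \<Phi>" by blast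
    have "gl_num n (diagonal n (two_at i)) \<Phi> \<in> W"
      using gl[OF diagonal_GL(1) \<Phi>(1)] two_at_nonzero by blast
    moreover have "(\<lambda>x. 2 powi (case x of (I, m) \<Rightarrow> wt n I m i) * f x) = coef (gl_num n (diagonal n (two_at i)) \<Phi>)"
      using \<Phi> W i by (auto simp: coef_def fun_eq_iff lookup_gl_num_two_at[of i n \<Phi> p r])
    ultimately show "(\<lambda>x. 2 powi (case x of (I, m) \<Rightarrow> wt n I m i) * f x) \<in> coef ` W" by blast
  next
    have "coef \<Phi> x = 0" if "x \<notin> Sigma (idx n p) (\<lambda>I. keys (\<Phi> I))" for x
    proof (cases x)
      case (Pair I m)
      then show ?thesis using that numeratorsD(5)[of \<Phi> n p r I] \<Phi> W by (auto simp: coef_def in_keys_iff)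
    qed
    then have "{x. coef \<Phi> x \<noteq> 0} \<subseteq> Sigma (idx n p) (\<lambda>I. keys (\<Phi> I))" by blast
    then show "finite {x. coef \<Phi> x \<noteq> 0}"
      by (rule finite_subset) (intro finite_SigmaI finite_idx finite_keys)
  qed (use \<Phi> in auto)
  then obtain \<Psi> where \<Psi>: "\<Psi> \<in> W"
    "coef \<Psi> = (\<lambda>x. if \<forall>i\<in>{..<n}. (case x of (I, m) \<Rightarrow> wt n I m i) = \<kappa> i then coef \<Phi> x else 0)" by auto
  have "lookup (\<Psi> I) m = (if \<forall>i<n. wt n I m i = \<kappa> i then lookup (\<Phi> I) m else 0)" for I m
    using fun_cong[OF \<Psi>(2), of "(I, m)"] by (auto simp: coef_def)
  then show ?thesis using that \<Psi>(1) by blast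
qed

text \<open>For fixed \<open>r\<close> and \<open>p\<close> the sum of the weight and the total
  degree determine each other. Since the group preserves the total degree, the sum of the weight is
  constant along its action.\<close>

lemma sum_wt:
  assumes \<Phi>: "\<Phi> \<in> numerators n p r" and m: "m \<in> keys (\<Phi> I)"
  shows "(\<Sum>i<n. wt n I m i) = (\<Sum>i<n. int (lookup m i)) - int r" "I \<in> idx n p"
    "int (total_degree n m) = (\<Sum>i<n. int (lookup m i)) + (int r - int p)"
proof -
  show I: "I \<in> idx n p" using numeratorsD(5)[OF \<Phi>, of I] m by (metis empty_iff keys_zero)
  have d: "dual_degree n m = int r - int p"
    using numeratorsD(4)[OF \<Phi>, of I] m by (simp add: dual_homogeneous_hom dual.hom_def)
  have "(\<Sum>i<n. int (count_list I i)) = int p"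
    using sum_count_list[of I n "\<lambda>_. 1"] I by (simp add: idx_def sum_list_triv)
  then show "(\<Sum>i<n. wt n I m i) = (\<Sum>i<n. int (lookup m i)) - int r"
    using d by (simp add: wt_def sum_subtractf dual_degree_def)
  have "(\<Sum>i<n + k. f i) = (\<Sum>i<n. f i) + (\<Sum>i<k. f (n + i))" for k and f :: "nat \<Rightarrow> nat"
    by (induction k) auto
  then show "int (total_degree n m) = (\<Sum>i<n. int (lookup m i)) + (int r - int p)"
    using d by (simp add: total_degree_def dual_degree_def mult_2)
qed

text \<open>Only the variables \<open>z_i\<close> contribute positively to the height, and their
  total degree is the sum of the weight plus \<open>r\<close>. Among weights with a given sum there
  is thus one of greatest height.\<close>

lemma height_bound:
  assumes \<Phi>: "\<Phi> \<in> numerators n p r" "num_weight n \<kappa> \<Phi>" "\<Phi> I \<noteq> 0"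
  shows "height n \<kappa> \<le> int n * ((\<Sum>i<n. \<kappa> i) + int r)"
proof -
  obtain m where m: "m \<in> keys (\<Phi> I)" using \<Phi>(3) by (metis all_not_in_conv keys_eq_empty)
  have \<kappa>: "\<kappa> i = wt n I m i" if "i < n" for i using \<Phi>(2) m that by (simp add: num_weight_def)
  have "height n \<kappa> \<le> (\<Sum>i<n. int n * int (lookup m i))"
    unfolding height_def
  proof (rule sum_mono)
    fix i assume "i \<in> {..<n}"
    then have i: "i < n" by simp
    have "(int n - int i) * \<kappa> i \<le> (int n - int i) * int (lookup m i)"
      unfolding \<kappa>[OF i] using i by (intro mult_left_mono) (auto simp: wt_def)
    also have "\<dots> \<le> int n * int (lookup m i)" by (intro mult_right_mono) auto
    finally show "(int n - int i) * \<kappa> i \<le> int n * int (lookup m i)" .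
  qed
  also have "\<dots> = int n * ((\<Sum>i<n. \<kappa> i) + int r)"
    using sum_wt(1)[OF \<Phi>(1) m] \<kappa> by (simp add: sum_distrib_left[symmetric])
  finally show ?thesis .
qed

text \<open>The permutation matrix of a simple reflection; it is used to prove dominance.\<close>

definition adj_swap :: "nat \<Rightarrow> nat \<Rightarrow> 'k::field mat" where
  "adj_swap n k = mat n n (\<lambda>(a, b). if a = Transposition.transpose k (Suc k) b then 1 else 0)"

lemma adj_swap_mult:
  assumes "Suc k < n"
  shows "adj_swap n k * adj_swap n k = 1\<^sub>m n" "adj_swap n k \<in> carrier_mat n n"
    "diagonal n c * adj_swap n k = adj_swap n k * diagonal n (\<lambda>i. c (Transposition.transpose k (Suc k) i))"
proof -
  let ?\<sigma> = "Transposition.transpose k (Suc k)"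
  have \<sigma>: "?\<sigma> b < n" if "b < n" for b using that assms by (auto simp: Transposition.transpose_def)
  show c: "adj_swap n k \<in> carrier_mat n n" by (simp add: adj_swap_def)
  show "adj_swap n k * adj_swap n k = (1\<^sub>m n :: 'a mat)"
  proof (rule eq_matI)
    fix i j assume ij: "i < dim_row (1\<^sub>m n :: 'a mat)" "j < dim_col (1\<^sub>m n :: 'a mat)"
    have "(adj_swap n k * adj_swap n k) $$ (i, j) = (\<Sum>l<n. adj_swap n k $$ (i, l) * (adj_swap n k $$ (l, j) :: 'a))"
      by (rule mult_mat_index) (use ij c in \<open>auto simp: adj_swap_def\<close>)
    also have "\<dots> = (\<Sum>l\<in>{?\<sigma> j}. adj_swap n k $$ (i, l) * adj_swap n k $$ (l, j))"
      by (rule sum.mono_neutral_right) (use ij \<sigma> in \<open>auto simp: adj_swap_def\<close>)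
    finally show "(adj_swap n k * adj_swap n k) $$ (i, j) = (1\<^sub>m n :: 'a mat) $$ (i, j)"
      using ij \<sigma> by (simp add: adj_swap_def)
  qed (simp_all add: adj_swap_def)
  show "diagonal n c * adj_swap n k = adj_swap n k * diagonal n (\<lambda>i. c (?\<sigma> i))"
  proof (rule eq_matI)
    fix i j assume "i < dim_row (adj_swap n k * diagonal n (\<lambda>i. c (?\<sigma> i)))" "j < dim_col (adj_swap n k * diagonal n (\<lambda>i. c (?\<sigma> i)))"
    then have ij: "i < n" "j < n" by (auto simp: adj_swap_def)
    show "(diagonal n c * adj_swap n k) $$ (i, j) = (adj_swap n k * diagonal n (\<lambda>i. c (?\<sigma> i))) $$ (i, j)"
      unfolding diagonal_mult_index[OF c ij] using ij by (simp add: adj_swap_def)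
  qed (simp_all add: adj_swap_def)
qed

lemma gl_num_one: "\<Phi> \<in> numerators n p r \<Longrightarrow> gl_num n (1\<^sub>m n) \<Phi> = \<Phi>"
proof
  fix I assume \<Phi>: "\<Phi> \<in> numerators n p r"
  show "gl_num n (1\<^sub>m n) \<Phi> I = \<Phi> I"
  proof (cases "I \<in> idx n p")
    case True
    have "gl_num n (1\<^sub>m n) \<Phi> I = (\<Sum>J\<in>idx n p. if J = I then \<Phi> J else 0)"
      unfolding gl_num_idx[OF True] by (intro sum.cong refl) (simp add: GL_one tens_one[OF _ True] subst_gl_one)
    then show ?thesis using True by simp
  next
    case False
    then show ?thesis using gl_num_not_idx[OF False, of \<Phi>] numeratorsD(5)[OF \<Phi>] by simp
  qed
qed

lemma num_weight_adj_swap: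
  fixes \<Phi> :: "nat list \<Rightarrow> 'k::field_char_0 mpoly"
  assumes k: "Suc k < n" and \<Phi>: "\<Phi> \<in> numerators n p r" "num_weight n \<kappa> \<Phi>"
  shows "num_weight n (\<lambda>i. \<kappa> (Transposition.transpose k (Suc k) i)) (gl_num n (adj_swap n k) \<Phi>)"
proof (rule num_weightI[OF gl_num_numerators[OF \<Phi>(1)]])
  let ?\<sigma> = "Transposition.transpose k (Suc k)"
  fix l assume l: "l < n"
  note s = adj_swap_mult[OF k]
  have S: "adj_swap n k \<in> GL n" by (rule GL_I(1)[OF s(2) s(2) s(1) s(1)])
  have D: "diagonal n (two_at l) \<in> GL n" "diagonal n (\<lambda>i. two_at l (?\<sigma> i)) \<in> GL n"
    by (rule diagonal_GL; simp add: two_at_nonzero)+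
  have "(\<lambda>i. two_at l (?\<sigma> i) :: 'k) = two_at (?\<sigma> l)"
    by (auto simp: two_at_def fun_eq_iff Transposition.transpose_def)
  moreover have "?\<sigma> l < n" using l k by (auto simp: Transposition.transpose_def)
  ultimately have "gl_num n (diagonal n (\<lambda>i. two_at l (?\<sigma> i))) \<Phi> = (\<lambda>I. Const (2 powi \<kappa> (?\<sigma> l)) * \<Phi> I)"
    using num_weight_two_at[OF _ \<Phi>, of "?\<sigma> l"] by simp
  then show "gl_num n (diagonal n (two_at l)) (gl_num n (adj_swap n k) \<Phi>) =
      (\<lambda>I. Const (2 powi \<kappa> (?\<sigma> l)) * gl_num n (adj_swap n k) \<Phi> I)"
    unfolding gl_num_mult[OF D(1) S] s(3) gl_num_mult[OF S D(2), symmetric] by (simp add: gl_num_Const_mult)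
qed

text \<open>A weight vector of greatest height among those with a given sum is fixed by upper
  triangular matrices up to the character, since any other term would have greater height. The bound
  on the height makes the maximum exist although \<open>W\<close> may have infinite
  dimension.\<close>

lemma num_hw_exists:
  fixes W :: "(nat list \<Rightarrow> 'k::field_char_0 mpoly) set"
  assumes W: "W \<subseteq> numerators n p r"
    and stable: "num_stable n W"
    and \<Phi>0: "\<Phi>0 \<in> W" "\<Phi>0 \<noteq> (\<lambda>I. 0)"
  shows "\<exists>\<alpha>. \<exists>\<Psi>\<in>W. \<Psi> \<noteq> (\<lambda>I. 0) \<and> dominant_weight n \<alpha> \<and> num_hw n \<alpha> \<Psi>"
proof -
  note gl = num_stableD(3)[OF stable]
  have comp_nz: "\<exists>\<Psi>\<in>W. \<Psi> \<noteq> (\<lambda>I. 0) \<and> num_weight n (wt n I m) \<Psi>" if \<Phi>: "\<Phi> \<in> W" "m \<in> keys (\<Phi> I)" for \<Phi> I m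
  proof -
    obtain \<Psi> where \<Psi>: "\<Psi> \<in> W"
      "\<And>I' m'. lookup (\<Psi> I') m' = (if \<forall>i<n. wt n I' m' i = wt n I m i then lookup (\<Phi> I') m' else 0)"
      using num_component[OF W stable \<Phi>(1), of "wt n I m"] by metis
    have "lookup (\<Psi> I) m \<noteq> 0" using \<Psi>(2) \<Phi>(2) by (simp add: in_keys_iff)
    then have "\<Psi> \<noteq> (\<lambda>I. 0)" by auto
    moreover have "num_weight n (wt n I m) \<Psi>"
      using \<Psi>(2) by (auto simp: num_weight_def in_keys_iff split: if_splits)
    ultimately show ?thesis using \<Psi>(1) by blast
  qed
  obtain I0 where "\<Phi>0 I0 \<noteq> 0" using \<Phi>0(2) by auto
  then obtain m0 where m0: "m0 \<in> keys (\<Phi>0 I0)" by (metis all_not_in_conv keys_eq_empty)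
  obtain \<Psi>0 where \<Psi>0: "\<Psi>0 \<in> W" "\<Psi>0 \<noteq> (\<lambda>I. 0)" "num_weight n (wt n I0 m0) \<Psi>0"
    using comp_nz[OF \<Phi>0(1) m0] by blast
  define s where "s = (\<Sum>i<n. wt n I0 m0 i)"
  \<comment> \<open>The sum of the weight is fixed because only then is the height bounded.\<close>
  define P where "P = (\<lambda>(\<kappa>, \<Psi>). \<Psi> \<in> W \<and> \<Psi> \<noteq> (\<lambda>I. 0) \<and> num_weight n \<kappa> \<Psi> \<and> (\<Sum>i<n. \<kappa> i) = s)"
  define B where "B = int n * (s + int r)"
  have bound: "height n \<kappa> \<le> B" if P: "P (\<kappa>, \<Psi>)" for \<kappa> \<Psi>
  proof -
    obtain I where "\<Psi> I \<noteq> 0" using P by (auto simp: P_def)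
    then show ?thesis using height_bound[of \<Psi> n p r \<kappa> I] P W by (auto simp: P_def B_def)
  qed
  have "P (wt n I0 m0, \<Psi>0)" using \<Psi>0 by (simp add: P_def s_def)
  then obtain x where x: "P x" "\<forall>y. P y \<longrightarrow> nat (B - height n (fst x)) \<le> nat (B - height n (fst y))"
    using ex_has_least_nat[of P _ "\<lambda>y. nat (B - height n (fst y))"] by blast
  obtain \<kappa> \<Psi> where x_eq: "x = (\<kappa>, \<Psi>)" by (cases x)
  have max: "height n \<mu> \<le> height n \<kappa>" if "P (\<mu>, \<Psi>')" for \<mu> \<Psi>'
    using x(2)[rule_format, OF that] bound[OF that] x(1) bound[of \<kappa> \<Psi>] by (simp add: x_eq)
  have \<Psi>: "\<Psi> \<in> W" "\<Psi> \<noteq> (\<lambda>I. 0)" "num_weight n \<kappa> \<Psi>" "(\<Sum>i<n. \<kappa> i) = s"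
    using x(1) by (auto simp: P_def x_eq)
  have \<Psi>num: "\<Psi> \<in> numerators n p r" using \<Psi>(1) W by blast
  have "\<exists>I m'. m' \<in> keys (\<Psi> I)" using \<Psi>(2) by (metis all_not_in_conv keys_eq_empty)
  have gl_height: "height n (wt n I m) \<le> height n \<kappa>" if g: "g \<in> GL n" and m: "m \<in> keys (gl_num n g \<Psi> I)" for g I m
  proof -
    have num: "gl_num n g \<Psi> \<in> numerators n p r" by (rule gl_num_numerators[OF \<Psi>num])
    obtain \<Psi>' where \<Psi>': "\<Psi>' \<in> W" "\<Psi>' \<noteq> (\<lambda>I. 0)" "num_weight n (wt n I m) \<Psi>'"
      using comp_nz[OF gl[OF g \<Psi>(1)] m] by blast
    have "total_degree n m \<in> {d. int d = s + int r + (int r - int p)}"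
    proof (rule gl_num_preserves[OF total.grading_axioms hom_gl_var(2) _ m])
      fix J m' assume m': "m' \<in> keys (\<Psi> J)"
      have "(\<Sum>i<n. wt n J m' i) = s"
        using \<Psi>(3,4) m' by (simp add: num_weight_def)
      then show "total_degree n m' \<in> {d. int d = s + int r + (int r - int p)}"
        using sum_wt(1,3)[OF \<Psi>num m'] by simp
    qed
    then have "(\<Sum>i<n. wt n I m i) = s" using sum_wt(1,3)[OF num m] by simp
    then show ?thesis using max[of "wt n I m" \<Psi>'] \<Psi>' by (simp add: P_def)
  qed
  define \<alpha> where "\<alpha> = map \<kappa> [0..<n]"
  have char: "character n \<alpha> g = (\<Prod>i<n. (g $$ (i, i)) powi \<kappa> i)" for g :: "'k mat"
    by (simp add: character_def \<alpha>_def)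
  have "gl_num n g \<Psi> = (\<lambda>I. Const (character n \<alpha> g) * \<Psi> I)" if g: "g \<in> GL n" "upper_triangular g" for g
  proof (rule ext, rule ccontr)
    fix I assume ne: "gl_num n g \<Psi> I \<noteq> Const (character n \<alpha> g) * \<Psi> I"
    then have "gl_num n g \<Psi> I - Const (character n \<alpha> g) * \<Psi> I \<noteq> 0" by simp
    then obtain m where m: "m \<in> keys (gl_num n g \<Psi> I - Const (character n \<alpha> g) * \<Psi> I)"
      by (metis all_not_in_conv keys_eq_empty)
    have I: "I \<in> idx n p"
    proof (rule ccontr)
      assume "I \<notin> idx n p"
      then show False using ne numeratorsD(5)[OF \<Psi>num] numeratorsD(5)[OF gl_num_numerators[OF \<Psi>num]] by simp
    qed
    have lt: "height n \<kappa> < height n (wt n I m)"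
      using num_weight_upper_triangular[OF g \<Psi>num \<Psi>(3) I] m unfolding char by blast
    have "m \<in> keys (gl_num n g \<Psi> I) \<or> m \<in> keys (\<Psi> I)"
      using m by (auto simp: in_keys_iff lookup_minus)
    then show False
    proof
      assume "m \<in> keys (gl_num n g \<Psi> I)"
      then show False using gl_height[OF g(1)] lt by fastforce
    next
      assume "m \<in> keys (\<Psi> I)"
      then have "height n (wt n I m) = height n \<kappa>"
        using \<Psi>(3) unfolding height_def by (intro sum.cong) (auto simp: num_weight_def)
      then show False using lt by simp
    qed
  qed
  then have hw: "num_hw n \<alpha> \<Psi>" by (simp add: num_hw_def)
  \<comment> \<open>Exchanging two adjacent entries gives another admissible weight, whose height
    differs by \<open>\<kappa> (Suc k) - \<kappa> k\<close>; maximality makes this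
    nonpositive.\<close>
  have "\<kappa> (Suc k) \<le> \<kappa> k" if k: "Suc k < n" for k
  proof -
    let ?\<sigma> = "Transposition.transpose k (Suc k)"
    note s = adj_swap_mult[OF k]
    have S: "adj_swap n k \<in> GL n" by (rule GL_I(1)[OF s(2) s(2) s(1) s(1)])
    have "gl_num n (adj_swap n k) \<Psi> \<noteq> (\<lambda>I. 0)"
    proof
      assume 0: "gl_num n (adj_swap n k) \<Psi> = (\<lambda>I. 0)"
      have "\<Psi> = gl_num n (adj_swap n k) (gl_num n (adj_swap n k) \<Psi>)"
        unfolding gl_num_mult[OF S S] s(1) gl_num_one[OF \<Psi>num] ..
      also have "\<dots> = (\<lambda>I. 0)" unfolding 0 by (auto simp: gl_num_def)
      finally show False using \<Psi>(2) by simp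
    qed
    moreover have perm: "(\<Sum>i<n. f (?\<sigma> i)) = (\<Sum>i<n. f i)" for f :: "nat \<Rightarrow> int"
    proof -
      have "?\<sigma> permutes {..<n}" using k by (intro permutes_swap_id) auto
      then show ?thesis using sum.permute[of ?\<sigma> "{..<n}" f] by (simp add: comp_def)
    qed
    ultimately have "P (\<lambda>i. \<kappa> (?\<sigma> i), gl_num n (adj_swap n k) \<Psi>)"
      using gl[OF S \<Psi>(1)] num_weight_adj_swap[OF k \<Psi>num \<Psi>(3)] \<Psi>(4) perm[of \<kappa>] by (simp add: P_def)
    then have "height n (\<lambda>i. \<kappa> (?\<sigma> i)) \<le> height n \<kappa>" by (rule max)
    moreover have "height n (\<lambda>i. \<kappa> (?\<sigma> i)) = height n \<kappa> + (\<kappa> (Suc k) - \<kappa> k)"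
    proof -
      have "height n (\<lambda>i. \<kappa> (?\<sigma> i)) = height n \<kappa> + (\<Sum>i<n. (int n - int i) * (\<kappa> (?\<sigma> i) - \<kappa> i))"
        by (simp add: height_def algebra_simps sum.distrib sum_subtractf)
      also have "(\<Sum>i<n. (int n - int i) * (\<kappa> (?\<sigma> i) - \<kappa> i)) = (\<Sum>i\<in>{k, Suc k}. (int n - int i) * (\<kappa> (?\<sigma> i) - \<kappa> i))"
        by (rule sum.mono_neutral_right) (use k in \<open>auto simp: Transposition.transpose_def\<close>)
      also have "\<dots> = \<kappa> (Suc k) - \<kappa> k" by (simp add: algebra_simps)
      finally show ?thesis .
    qed
    ultimately show ?thesis by simp
  qed
  then have "sorted_wrt (\<ge>) \<alpha>"
    by (subst sorted_wrt_iff_nth_Suc_transp) (auto simp: \<alpha>_def transp_def)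
  then have "dominant_weight n \<alpha>" by (simp add: dominant_weight_def \<alpha>_def)
  then show ?thesis using \<Psi> hw by blast
qed

section \<open>Classification of highest weight vectors\<close>

definition pt :: "nat \<Rightarrow> (nat \<Rightarrow> 'k::field) \<Rightarrow> (nat \<Rightarrow> 'k) \<Rightarrow> nat \<Rightarrow> 'k" where
  "pt n z w = (\<lambda>v. if v < n then z v else if v < 2 * n then w (v - n) else 0)"

lemma pt_simps [simp]: "v < n \<Longrightarrow> pt n z w v = z v" "v < n \<Longrightarrow> pt n z w (n + v) = w v"
  by (simp_all add: pt_def)

text \<open>The new dual vector \<open>w'\<close> is specified by \<open>w = g w'\<close>, so that
  callers never have to compute an inverse matrix.\<close>

lemma eval_subst_gl_pt:
  assumes g: "g \<in> GL n" and P: "P \<in> poly_zzd n"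
    and z: "\<And>v. v < n \<Longrightarrow> (\<Sum>i<n. g $$ (i, v) * z i) = z' v"
    and w: "\<And>u. u < n \<Longrightarrow> (\<Sum>i<n. g $$ (u, i) * w' i) = w u"
  shows "eval (pt n z w) (subst_gl n g P) = eval (pt n z' w') P"
  unfolding subst_gl_def eval_subst
proof (rule eval_cong[OF P[unfolded poly_zzd_poly_over]])
  fix v assume "v \<in> {..<2 * n}"
  show "eval (pt n z w) (gl_var n g v) = pt n z' w' v"
  proof (cases rule: var_cases[of v n])
    case 1
    then show ?thesis using z[OF 1] by (simp add: gl_var_simps)
  next
    case (2 u)
    note c = GL_carrier[OF g] GL_mat_inv[OF g]
    have "(\<Sum>i<n. mat_inv g $$ (u, i) * w i) = (\<Sum>i<n. mat_inv g $$ (u, i) * (\<Sum>j<n. g $$ (i, j) * w' j))"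
      by (intro sum.cong refl) (simp add: w)
    also have "\<dots> = (\<Sum>j<n. (\<Sum>i<n. mat_inv g $$ (u, i) * g $$ (i, j)) * w' j)"
      unfolding sum_distrib_left sum_distrib_right by (subst sum.swap) (simp add: mult.assoc)
    also have "\<dots> = (\<Sum>j<n. (if u = j then 1 else 0) * w' j)"
      using mult_mat_index[OF c(2,1) 2(1), symmetric] 2(1) unfolding c(4) by (intro sum.cong refl) simp
    also have "\<dots> = w' u" using 2(1) by (simp add: if_distrib[of "\<lambda>a. a * _"] cong: if_cong)
    finally show ?thesis using 2 by (simp add: gl_var_simps)
  qed (use \<open>v \<in> {..<2 * n}\<close> in simp)
qed

text \<open>The common zeros of the components of an eigenvector of the Borel subgroup are a union
  of its orbits.\<close>

lemma num_hw_eval_vanish: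
  assumes \<Phi>: "\<Phi> \<in> numerators n p r" "num_hw n \<alpha> \<Phi>" and g: "g \<in> GL n" "upper_triangular g"
    and z: "\<And>v. v < n \<Longrightarrow> (\<Sum>i<n. g $$ (i, v) * z i) = z' v"
    and w: "\<And>u. u < n \<Longrightarrow> (\<Sum>i<n. g $$ (u, i) * w' i) = w u"
    and vanish: "\<And>J. eval (pt n z' w') (\<Phi> J) = 0"
  shows "eval (pt n z w) (\<Phi> I) = 0"
proof (cases "I \<in> idx n p")
  case False
  then show ?thesis using numeratorsD(5)[OF \<Phi>(1)] by simp
next
  case True
  have "eval (pt n z w) (Const (character n \<alpha> g) * \<Phi> I) = eval (pt n z w) (gl_num n g \<Phi> I)"
    using \<Phi>(2) g by (simp add: num_hw_def)
  also have "\<dots> = 0"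
    using eval_subst_gl_pt[OF g(1) numeratorsD(3)[OF \<Phi>(1)] z w] vanish by (simp add: gl_num_idx[OF True])
  finally have "character n \<alpha> g * eval (pt n z w) (\<Phi> I) = 0" by simp
  moreover have "character n \<alpha> g \<noteq> 0"
    using upper_triangular_GL(1)[OF g] by (simp add: character_def)
  ultimately show ?thesis by simp
qed

lemma upper_triangular_GL_I:
  assumes "g \<in> carrier_mat n n" "upper_triangular g" "\<And>i. i < n \<Longrightarrow> g $$ (i, i) \<noteq> (0 :: 'k::field)"
  shows "g \<in> GL n"
proof -
  have "det g \<noteq> 0"
    using upper_triangular_imp_det_eq_0_iff[OF assms(1,2)] assms(1,3) by (auto simp: diag_mat_def)
  then have "g \<in> Units (ring_mat TYPE('k) n (undefined :: nat))"
    by (rule det_non_zero_imp_unit[OF assms(1)])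
  then obtain h where "h \<in> carrier_mat n n" "h * g = 1\<^sub>m n" "g * h = 1\<^sub>m n"
    by (auto simp: Units_def ring_mat_def)
  then show ?thesis using GL_I assms(1) by blast
qed

text \<open>The base point \<open>z = e\<^sub>0 + e\<^bsub>n-1\<^esub>\<close>, \<open>z\<^sup>* = e\<^bsub>n-1\<^esub>\<close> lies in the open orbit of the Borel subgroup.\<close>
definition z_base :: "nat \<Rightarrow> nat \<Rightarrow> 'k::field" where
  "z_base n v = (if v = 0 \<or> v = n - 1 then 1 else 0)"

definition w_base :: "nat \<Rightarrow> nat \<Rightarrow> 'k::field" where
  "w_base n v = (if v = n - 1 then 1 else 0)"

text \<open>The orbit of the base point consists of the points of the torsor with
  \<open>z 0 \<noteq> 0\<close> and \<open>w (n - 1) \<noteq> 0\<close>.\<close>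

lemma num_hw_vanish_generic:
  assumes n: "n \<ge> 1" and \<Phi>: "\<Phi> \<in> numerators n p r" "num_hw n \<alpha> \<Phi>"
    and vanish: "\<And>J. eval (pt n (z_base n) (w_base n)) (\<Phi> J) = 0"
    and z: "z 0 \<noteq> 0" and w: "w (n - 1) \<noteq> 0" and zw: "(\<Sum>i<n. z i * w i) = (1 :: 'k::field)"
  shows "eval (pt n z w) (\<Phi> I) = 0"
proof -
  \<comment> \<open>The last column is \<open>w\<close>, so that the last unit vector goes to
    \<open>w\<close>. In the other columns the entries of row 0 are solved from the condition that
    the transpose of \<open>h\<close> takes \<open>z\<close> to the base point; in the last column
    that condition is \<open>zw\<close>.\<close>
  define h where "h = mat n n (\<lambda>(i, j). if j = n - 1 then w i else
    if j = 0 then (if i = 0 then 1 / z 0 else 0) else if i = j then 1 else if i = 0 then - z j / z 0 else 0)"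
  have hc: "h \<in> carrier_mat n n" by (simp add: h_def)
  have hi: "h $$ (i, j) = (if j = n - 1 then w i else
    if j = 0 then (if i = 0 then 1 / z 0 else 0) else if i = j then 1 else if i = 0 then - z j / z 0 else 0)"
    if "i < n" "j < n" for i j using that by (simp add: h_def)
  have ut: "upper_triangular h"
    by (rule upper_triangularI) (use hc hi in auto)
  have GL: "h \<in> GL n"
    by (rule upper_triangular_GL_I[OF hc ut]) (use hi z w in auto)
  show ?thesis
  proof (rule num_hw_eval_vanish[OF \<Phi> GL ut _ _ vanish])
    fix v assume v: "v < n"
    consider "v = n - 1" | "v \<noteq> n - 1" "v = 0" | "v \<noteq> n - 1" "v \<noteq> 0" by blast
    then show "(\<Sum>i<n. h $$ (i, v) * z i) = z_base n v"
    proof cases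
      case 1
      then show ?thesis using v zw by (simp add: hi z_base_def mult.commute)
    next
      case 2
      then have "(\<Sum>i<n. h $$ (i, v) * z i) = (\<Sum>i\<in>{0}. h $$ (i, v) * z i)"
        using v by (intro sum.mono_neutral_right) (auto simp: hi)
      then show ?thesis using 2 v z by (simp add: hi z_base_def)
    next
      case 3
      then have "(\<Sum>i<n. h $$ (i, v) * z i) = (\<Sum>i\<in>{0, v}. h $$ (i, v) * z i)"
        using v by (intro sum.mono_neutral_right) (auto simp: hi)
      then show ?thesis using 3 v z by (simp add: hi z_base_def)
    qed
  next
    fix u assume u: "u < n"
    have "(\<Sum>i<n. h $$ (u, i) * w_base n i) = (\<Sum>i\<in>{n - 1}. h $$ (u, i) * w_base n i)"
      using n by (intro sum.mono_neutral_right) (auto simp: w_base_def)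
    then show "(\<Sum>i<n. h $$ (u, i) * w_base n i) = w u" using u n by (simp add: hi w_base_def)
  qed
qed

text \<open>Used to move a point with nonzero \<open>zz_dual\<close> onto the torsor, where this
  function is 1.\<close>

lemma eval_dual_scale:
  assumes P: "P \<in> poly_zzd n" "dual_homogeneous n d P" and c: "c \<noteq> (0 :: 'k::field)"
  shows "eval (pt n z (\<lambda>i. c * w i)) P = c powi d * eval (pt n z w) P"
proof -
  let ?c = "\<lambda>v. if n \<le> v \<and> v < 2 * n then c else 1"
  have "poly_subst (\<lambda>v. Const (?c v) * Var v) P = Const (c powi d) * P"
  proof (rule poly_mapping_eqI)
    fix m
    show "lookup (poly_subst (\<lambda>v. Const (?c v) * Var v) P) m = lookup (Const (c powi d) * P) m"
    proof (cases "m \<in> keys P")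
      case True
      then have "keys m \<subseteq> {..<2 * n}" using P(1) by (auto simp: poly_zzd_def)
      then have "mono_val ?c m = (\<Prod>v<n + n. ?c v ^ lookup m v)" by (intro mono_val_superset) auto
      also have "\<dots> = (\<Prod>v<n. ?c v ^ lookup m v) * (\<Prod>v<n. ?c (n + v) ^ lookup m (n + v))"
      proof -
        have "(\<Prod>w<n + k. f w) = (\<Prod>w<n. f w) * (\<Prod>w<k. f (n + w))" for k and f :: "nat \<Rightarrow> 'k"
          by (induction k) (auto simp: mult.assoc)
        then show ?thesis .
      qed
      also have "\<dots> = c ^ (\<Sum>v<n. lookup m (n + v))" by (simp add: power_sum)
      also have "\<dots> = c powi d"
      proof -
        have d: "int (\<Sum>v<n. lookup m (n + v)) = d" using P(2) True unfolding dual_homogeneous_def by blast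
        show ?thesis by (simp only: d[symmetric] power_int_of_nat)
      qed
      finally show ?thesis by (simp add: lookup_diag_subst)
    qed (simp add: lookup_diag_subst in_keys_iff)
  qed
  then have "c powi d * eval (pt n z w) P = eval (pt n z w) (poly_subst (\<lambda>v. Const (?c v) * Var v) P)" by simp
  also have "\<dots> = eval (pt n z (\<lambda>i. c * w i)) P"
    unfolding eval_subst
    by (rule eval_cong[OF P(1)[unfolded poly_zzd_poly_over]]) (auto simp: pt_def)
  finally show ?thesis by simp
qed

text \<open>A highest weight numerator vanishing at the base point vanishes on a dense open set,
  hence identically.\<close>

lemma num_hw_base_nonzero:
  fixes \<Phi> :: "nat list \<Rightarrow> 'k::field_char_0 mpoly"
  assumes n: "n \<ge> 1" and \<Phi>: "\<Phi> \<in> numerators n p r" "num_hw n \<alpha> \<Phi>" "\<Phi> \<noteq> (\<lambda>I. 0)"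
  obtains I where "I \<in> idx n p" "eval (pt n (z_base n) (w_base n)) (\<Phi> I) \<noteq> 0"
proof -
  have "\<exists>I. eval (pt n (z_base n) (w_base n)) (\<Phi> I) \<noteq> 0"
  proof (rule ccontr)
    assume "\<not> ?thesis"
    then have vanish: "\<And>J. eval (pt n (z_base n) (w_base n)) (\<Phi> J) = 0" by blast
    have "\<Phi> I = 0" for I
    proof -
      \<comment> \<open>The product of the functions that must not vanish in order to be in the
        orbit, up to rescaling of the dual vector. Multiplying by it turns vanishing on the open set
        into vanishing everywhere.\<close>
      let ?q = "Var 0 * Var (n + (n - 1)) * zz_dual n :: 'k mpoly"
      have "eval x (\<Phi> I * ?q) = 0" for x
      proof (cases "x 0 = 0 \<or> x (n + (n - 1)) = 0 \<or> eval x (zz_dual n) = 0")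
        case True
        then show ?thesis by auto
      next
        case False
        define c where "c = eval x (zz_dual n)"
        have c: "c \<noteq> 0" "c = (\<Sum>i<n. x i * x (n + i))" using False by (auto simp: c_def zz_dual_def)
        let ?w = "\<lambda>i. inverse c * x (n + i)"
        have "(\<Sum>i<n. x i * ?w i) = inverse c * (\<Sum>i<n. x i * x (n + i))"
          by (simp add: sum_distrib_left mult_ac)
        then have "eval (pt n x ?w) (\<Phi> I) = 0"
          using num_hw_vanish_generic[OF n \<Phi>(1,2) vanish, of x ?w I] False c by simp
        then have "eval (pt n x (\<lambda>i. x (n + i))) (\<Phi> I) = 0"
          using eval_dual_scale[OF numeratorsD(3,4)[OF \<Phi>(1)], of "inverse c" x "\<lambda>i. x (n + i)" I] c by simp
        moreover have "eval x (\<Phi> I) = eval (pt n x (\<lambda>i. x (n + i))) (\<Phi> I)"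
          by (rule eval_cong[OF numeratorsD(3)[OF \<Phi>(1), unfolded poly_zzd_poly_over]]) (auto simp: pt_def)
        ultimately show ?thesis by simp
      qed
      then have "\<Phi> I * ?q = 0" by (rule eval_eq_0_imp_0)
      moreover have "Var v \<noteq> (0 :: 'k mpoly)" for v
      proof
        assume "Var v = (0 :: 'k mpoly)"
        then have "eval (\<lambda>_. 1) (Var v :: 'k mpoly) = 0" by (simp only: eval_simps)
        then show False by simp
      qed
      ultimately show "\<Phi> I = 0" using zz_dual_neq_0[OF n, where 'k = 'k] by simp
    qed
    then show False using \<Phi>(3) by blast
  qed
  then show ?thesis using that numeratorsD(5)[OF \<Phi>(1)] by force
qed

lemma num_hw_num_weight:
  fixes \<Phi> :: "nat list \<Rightarrow> 'k::field_char_0 mpoly"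
  assumes \<Phi>: "\<Phi> \<in> numerators n p r" "num_hw n \<alpha> \<Phi>"
  shows "num_weight n (\<lambda>i. \<alpha> ! i) \<Phi>"
proof (rule num_weightI[OF \<Phi>(1)])
  fix k assume k: "k < n"
  have g: "diagonal n (two_at k :: nat \<Rightarrow> 'k) \<in> GL n" "upper_triangular (diagonal n (two_at k :: nat \<Rightarrow> 'k))"
    by (rule diagonal_GL; simp add: two_at_nonzero)+
  have "character n \<alpha> (diagonal n (two_at k)) = (2 :: 'k) powi (\<alpha> ! k)"
    using prod_two_at[OF k, of "\<lambda>i. \<alpha> ! i", where 'k = 'k] by (simp add: character_def)
  then show "gl_num n (diagonal n (two_at k)) \<Phi> = (\<lambda>I. Const (2 powi \<alpha> ! k) * \<Phi> I)"
    using \<Phi>(2) g by (simp add: num_hw_def)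
qed

lemma eval_nonzero_monomial:
  assumes "eval x P \<noteq> 0"
  obtains m where "m \<in> keys P" "\<And>v. x v = 0 \<Longrightarrow> lookup m v = 0"
proof -
  have "\<exists>m\<in>keys P. lookup P m * mono_val x m \<noteq> 0"
    using assms by (metis (no_types, lifting) coeff_eval_def eval_def id_apply sum.neutral)
  then obtain m where "m \<in> keys P" "mono_val x m \<noteq> 0" by auto
  moreover from this(2) have "lookup m v = 0" if "x v = 0" for v
    using that by (cases "v \<in> keys m") (auto simp: mono_val_def in_keys_iff)
  ultimately show ?thesis using that by blast
qed

text \<open>The effect of the torus stabiliser, read off from monomials: a nonzero value requires a
  monomial free of the coordinates that vanish at the point, and its exponents determine or bound
  the weight entry.\<close>

lemma num_weight_eval:
  assumes \<Phi>: "\<Phi> \<in> numerators n p r" "num_weight n (\<lambda>i. \<alpha> ! i) \<Phi>" and nz: "eval (pt n z w) (\<Phi> I) \<noteq> 0" and i: "i < n"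
  shows "z i = 0 \<Longrightarrow> w i = 0 \<Longrightarrow> \<alpha> ! i = - int (count_list I i)"
    and "w i = 0 \<Longrightarrow> \<alpha> ! i \<ge> - int (count_list I i)"
    and "z i = 0 \<Longrightarrow> \<alpha> ! i \<le> - int (count_list I i)"
proof -
  obtain m where m: "m \<in> keys (\<Phi> I)" "\<And>v. pt n z w v = 0 \<Longrightarrow> lookup m v = 0"
    using eval_nonzero_monomial[OF nz] by blast
  have \<alpha>: "\<alpha> ! i = int (lookup m i) - int (lookup m (n + i)) - int (count_list I i)"
    using \<Phi>(2) m(1) i by (auto simp: num_weight_def wt_def)
  have "z i = 0 \<Longrightarrow> lookup m i = 0" "w i = 0 \<Longrightarrow> lookup m (n + i) = 0"
    using m(2)[of i] m(2)[of "n + i"] i by auto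
  then show "z i = 0 \<Longrightarrow> w i = 0 \<Longrightarrow> \<alpha> ! i = - int (count_list I i)"
    "w i = 0 \<Longrightarrow> \<alpha> ! i \<ge> - int (count_list I i)" "z i = 0 \<Longrightarrow> \<alpha> ! i \<le> - int (count_list I i)"
    using \<alpha> by auto
qed

text \<open>The sign is left open, as only the vanishing of components matters.\<close>

lemma alternating_perm:
  fixes \<psi> :: "nat list \<Rightarrow> 'b::ab_group_add"
  assumes alt: "alternating n p \<psi>" and "mset I = mset I'"
  shows "\<psi> I' = \<psi> I \<or> \<psi> I' = - \<psi> I"
proof -
  have *: "\<forall>xs. length xs = N \<longrightarrow> \<psi> (permute_list \<pi> xs) = \<psi> xs \<or> \<psi> (permute_list \<pi> xs) = - \<psi> xs"
    if "\<pi> permutes {..<N}" for \<pi> N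
    using that finite_lessThan[of N]
  proof (induction rule: permutes_induct)
    case (swap a b q)
    show ?case
    proof (intro allI impI)
      fix xs :: "nat list" assume len: "length xs = N"
      have t: "Transposition.transpose a b permutes {..<length xs}"
        using swap len by (intro permutes_swap_id) auto
      have sw: "permute_list (Transposition.transpose a b) xs = swap_nth a b xs"
        using swap len by (intro nth_equalityI) (auto simp: permute_list_nth[OF t] nth_swap_nth)
      have "permute_list (Transposition.transpose a b \<circ> q) xs = permute_list q (swap_nth a b xs)"
        using swap len sw permute_list_compose[of q xs "Transposition.transpose a b"] by simp
      moreover have "\<psi> (swap_nth a b xs) = - \<psi> xs"
      proof (cases "a < b")
        case True
        then show ?thesis using alt swap len by (auto simp: alternating_def)
      next
        case False
        then have "\<psi> (swap_nth b a xs) = - \<psi> xs" using alt swap len by (auto simp: alternating_def)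
        moreover have "swap_nth b a xs = swap_nth a b xs"
          using swap len by (intro nth_equalityI) (auto simp: nth_swap_nth Transposition.transpose_def)
        ultimately show ?thesis by simp
    qed
      ultimately show "\<psi> (permute_list (Transposition.transpose a b \<circ> q) xs) = \<psi> xs \<or>
          \<psi> (permute_list (Transposition.transpose a b \<circ> q) xs) = - \<psi> xs"
        using swap.IH[rule_format, of "swap_nth a b xs"] len by auto
    qed
  qed simp
  obtain \<pi> where "\<pi> permutes {..<length I}" "permute_list \<pi> I = I'"
    using mset_eq_permutation[OF assms(2)[symmetric]] by blast
  then show ?thesis using * by blast
qed

lemma alternating_eval:
  assumes "\<Phi> \<in> numerators n p r"
  shows "alternating n p (\<lambda>I. eval x (\<Phi> I))"
  using numeratorsD(1)[OF assms] by (auto simp: alternating_def)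

lemma eval_move_to_front:
  assumes \<Phi>: "\<Phi> \<in> numerators n p r" and nz: "eval x (\<Phi> I) \<noteq> 0" and i: "i \<in> set I"
  shows "eval x (\<Phi> (i # remove1 i I)) \<noteq> 0"
  using alternating_perm[OF alternating_eval[OF \<Phi>, of x], of I "i # remove1 i I"] nz i by auto

lemma count_list_numerator:
  assumes \<Phi>: "\<Phi> \<in> numerators n p r" and nz: "eval x (\<Phi> I) \<noteq> 0"
  shows "int (count_list I i) = (if i \<in> set I then 1 else 0)" "I \<in> idx n p" "distinct I"
proof -
  have "\<Phi> I \<noteq> 0" using nz by auto
  then show d: "distinct I" "I \<in> idx n p" using numeratorsD(5,7)[OF \<Phi>] by auto
  have "count_list I i = (if i \<in> set I then 1 else 0)"
    using d(1) by (induction I) auto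
  then show "int (count_list I i) = (if i \<in> set I then 1 else 0)" by simp
qed

lemma eval_contraction:
  assumes \<Phi>: "\<Phi> \<in> numerators n p r"
  shows "(\<Sum>\<nu><n. w \<nu> * eval (pt n z w) (\<Phi> (\<nu> # I))) = 0"
proof -
  have "eval (pt n z w) (contraction n \<Phi> I) = 0" using numeratorsD(2)[OF \<Phi>] by simp
  then show ?thesis by (simp add: contraction_def)
qed

text \<open>At the base point the dual vector is the last unit vector, so the contraction condition
  kills every component with an index \<open>n - 1\<close>. At a middle index both coordinates
  vanish, and the weight entry tells whether the index occurs.\<close>

lemma base_support:
  fixes \<Phi> :: "nat list \<Rightarrow> 'k::field_char_0 mpoly"
  assumes n: "n \<ge> 1" and \<Phi>: "\<Phi> \<in> numerators n p r" "num_hw n \<alpha> \<Phi>"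
    and nz: "eval (pt n (z_base n) (w_base n)) (\<Phi> I) \<noteq> 0"
  shows "n - 1 \<notin> set I" "0 < i \<Longrightarrow> i < n - 1 \<Longrightarrow> \<alpha> ! i = (if i \<in> set I then - 1 else 0)"
    "n \<ge> 2 \<Longrightarrow> \<alpha> ! 0 \<ge> (if 0 \<in> set I then - 1 else 0)"
proof -
  note count = count_list_numerator[OF \<Phi>(1) nz]
  note weight = num_weight_eval[OF \<Phi>(1) num_hw_num_weight[OF \<Phi>] nz]
  show "n - 1 \<notin> set I"
  proof
    assume "n - 1 \<in> set I"
    then have "eval (pt n (z_base n) (w_base n)) (\<Phi> ((n - 1) # remove1 (n - 1) I)) \<noteq> 0"
      by (rule eval_move_to_front[OF \<Phi>(1) nz])
    moreover have "(\<Sum>\<nu><n. w_base n \<nu> * eval (pt n (z_base n) (w_base n)) (\<Phi> (\<nu> # L))) =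
        eval (pt n (z_base n) (w_base n)) (\<Phi> ((n - 1) # L))" for L
      using n by (simp add: w_base_def if_distrib[of "\<lambda>a. a * _"] cong: if_cong)
    ultimately show False using eval_contraction[OF \<Phi>(1)] by metis
  qed
  show "\<alpha> ! i = (if i \<in> set I then - 1 else 0)" if "0 < i" "i < n - 1" for i
    using weight(1)[of i] that count(1)[of i] by (auto simp: z_base_def w_base_def)
  show "\<alpha> ! 0 \<ge> (if 0 \<in> set I then - 1 else 0)" if "n \<ge> 2"
    using weight(2)[of 0] that count(1)[of 0] by (auto simp: w_base_def)
qed

lemma idx_card: "I \<in> idx n p \<Longrightarrow> distinct I \<Longrightarrow> card (set I) = p"
  by (auto simp: idx_def distinct_card)

text \<open>The weight decides every index except 0, and whether 0 occurs then follows from the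
  number \<open>p\<close> of indices.\<close>

lemma base_support_unique:
  fixes \<Phi> \<Psi> :: "nat list \<Rightarrow> 'k::field_char_0 mpoly"
  assumes n: "n \<ge> 1" and \<Phi>: "\<Phi> \<in> numerators n p r" "num_hw n \<alpha> \<Phi>" "eval (pt n (z_base n) (w_base n)) (\<Phi> I) \<noteq> 0"
    and \<Psi>: "\<Psi> \<in> numerators n p r" "num_hw n \<alpha> \<Psi>" "eval (pt n (z_base n) (w_base n)) (\<Psi> J) \<noteq> 0"
  shows "set I = set J"
proof -
  note I = count_list_numerator(2,3)[OF \<Phi>(1,3)] and J = count_list_numerator(2,3)[OF \<Psi>(1,3)]
  note sI = base_support[OF n \<Phi>] and sJ = base_support[OF n \<Psi>]
  have card: "card (set I) = card (set J)" using idx_card I J by metis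
  have mid: "set I - {0} = set J - {0}"
  proof -
    have "i \<in> set I \<longleftrightarrow> i \<in> set J" if "i \<noteq> 0" for i
    proof (cases "i < n - 1")
      case True
      then show ?thesis using sI(2)[of i] sJ(2)[of i] that by (auto split: if_splits)
    next
      case False
      then have "i \<notin> set I" "i \<notin> set J" using sI(1) sJ(1) I(1) J(1) n unfolding idx_def
        by (metis (no_types, lifting) One_nat_def Suc_pred lessThan_iff less_Suc_eq mem_Collect_eq not_gr_zero
            not_one_le_zero subsetD)+
      then show ?thesis by simp
    qed
    then show ?thesis by blast
  qed
  show ?thesis
  proof (cases "0 \<in> set I \<longleftrightarrow> 0 \<in> set J")
    case True
    then show ?thesis using mid by blast
  next
    case False
    have "card A = card (A - {0}) + (if 0 \<in> A then 1 else 0)" if "finite A" for A :: "nat set"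
      using card_Suc_Diff1[OF that, of 0] by auto
    then have "card (set I) = card (set I - {0}) + (if 0 \<in> set I then 1 else 0)"
      "card (set J) = card (set J - {0}) + (if 0 \<in> set J then 1 else 0)" by blast+
    then have "(if 0 \<in> set I then 1 else 0 :: nat) = (if 0 \<in> set J then 1 else 0)"
      using card arg_cong[OF mid, of card] by linarith
    then show ?thesis using False by (simp split: if_splits)
  qed
qed

text \<open>Subtracting a multiple of \<open>\<Phi>\<close> kills the one component, up to order,
  that can be nonzero at the base point; the difference then vanishes there altogether and is
  0.\<close>

lemma num_hw_unique:
  fixes \<Phi> \<Psi> :: "nat list \<Rightarrow> 'k::field_char_0 mpoly"
  assumes n: "n \<ge> 1" and \<Phi>: "\<Phi> \<in> numerators n p r" "num_hw n \<alpha> \<Phi>" "\<Phi> \<noteq> (\<lambda>I. 0)"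
    and \<Psi>: "\<Psi> \<in> numerators n p r" "num_hw n \<alpha> \<Psi>"
  shows "\<exists>c. \<Psi> = (\<lambda>I. Const c * \<Phi> I)"
proof -
  let ?e = "\<lambda>P. eval (pt n (z_base n) (w_base n)) P :: 'k"
  obtain I where I: "I \<in> idx n p" "?e (\<Phi> I) \<noteq> 0" using num_hw_base_nonzero[OF n \<Phi>] by blast
  define c where "c = ?e (\<Psi> I) / ?e (\<Phi> I)"
  define D where "D = (\<lambda>J. \<Psi> J + Const (- c) * \<Phi> J)"
  have D: "D \<in> numerators n p r" unfolding D_def by (intro numerators_add numerators_Const_mult \<Phi> \<Psi>)
  have hwD: "num_hw n \<alpha> D"
    using \<Phi>(2) \<Psi>(2) unfolding num_hw_def D_def gl_num_add gl_num_Const_mult by (auto simp: algebra_simps)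
  have "D = (\<lambda>J. 0)"
  proof (rule ccontr)
    assume "D \<noteq> (\<lambda>J. 0)"
    then obtain J where J: "J \<in> idx n p" "?e (D J) \<noteq> 0" using num_hw_base_nonzero[OF n D hwD] by blast
    have "set I = set J" by (rule base_support_unique[OF n \<Phi>(1,2) I(2) D hwD J(2)])
    moreover have "distinct I" "distinct J"
      using count_list_numerator(3)[OF \<Phi>(1) I(2)] count_list_numerator(3)[OF D J(2)] by auto
    ultimately have "mset J = mset I" by (metis set_eq_iff_mset_eq_distinct)
    then have "?e (D I) \<noteq> 0" using alternating_perm[OF alternating_eval[OF D, of "pt n (z_base n) (w_base n)"], of J I] J(2) by auto
    moreover have "?e (D I) = 0" using I(2) by (simp add: D_def c_def)
    ultimately show False by simp
  qed
  then have "\<Psi> J = Const c * \<Phi> J" for J by (simp add: D_def fun_eq_iff)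
  then show ?thesis by blast
qed

section \<open>A second point of the same orbit\<close>

definition z_other :: "nat \<Rightarrow> 'k::field" where
  "z_other v = (if v = 0 then 1 else 0)"

definition w_other :: "nat \<Rightarrow> nat \<Rightarrow> 'k::field" where
  "w_other n v = (if v = 0 \<or> v = n - 1 then 1 else 0)"

lemma num_hw_other_nonzero:
  fixes \<Phi> :: "nat list \<Rightarrow> 'k::field_char_0 mpoly"
  assumes n: "n \<ge> 2" and \<Phi>: "\<Phi> \<in> numerators n p r" "num_hw n \<alpha> \<Phi>" "\<Phi> \<noteq> (\<lambda>I. 0)"
  obtains I where "eval (pt n z_other (w_other n)) (\<Phi> I) \<noteq> 0"
proof -
  have "\<exists>I. eval (pt n z_other (w_other n)) (\<Phi> I) \<noteq> 0"
  proof (rule ccontr)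
    assume "\<not> ?thesis"
    then have vanish: "\<And>J. eval (pt n z_other (w_other n)) (\<Phi> J) = 0" by blast
    \<comment> \<open>The identity minus the elementary matrix in place \<open>(0, n - 1)\<close>:
      its transpose takes \<open>z_base\<close> to \<open>z_other\<close>, and it takes
      \<open>w_other\<close> to \<open>w_base\<close>. Both rely on
      \<open>0 \<noteq> n - 1\<close>.\<close>
    define g :: "'k mat" where "g = mat n n (\<lambda>(i, j). if i = j then 1 else if i = 0 \<and> j = n - 1 then - 1 else 0)"
    have gc: "g \<in> carrier_mat n n" by (simp add: g_def)
    have gi: "g $$ (i, j) = (if i = j then 1 else if i = 0 \<and> j = n - 1 then - 1 else 0)" if "i < n" "j < n" for i j
      using that by (simp add: g_def)
    have ut: "upper_triangular g" by (rule upper_triangularI) (use gc gi in auto)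
    have GL: "g \<in> GL n" by (rule upper_triangular_GL_I[OF gc ut]) (use gi in auto)
    have "eval (pt n (z_base n) (w_base n)) (\<Phi> I) = 0" for I
    proof (rule num_hw_eval_vanish[OF \<Phi>(1,2) GL ut _ _ vanish])
      fix v assume v: "v < n"
      have "(\<Sum>i<n. g $$ (i, v) * z_base n i) = (\<Sum>i\<in>{0, v}. g $$ (i, v) * z_base n i)"
        using v by (intro sum.mono_neutral_right) (auto simp: gi)
      then show "(\<Sum>i<n. g $$ (i, v) * z_base n i) = z_other v"
        using v n by (cases "v = 0"; cases "v = n - 1") (auto simp: gi z_base_def z_other_def)
    next
      fix u assume u: "u < n"
      have "(\<Sum>i<n. g $$ (u, i) * w_other n i) = (\<Sum>i\<in>{u, n - 1}. g $$ (u, i) * w_other n i)"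
        using u by (intro sum.mono_neutral_right) (auto simp: gi)
      then show "(\<Sum>i<n. g $$ (u, i) * w_other n i) = w_base n u"
        using u n by (cases "u = 0"; cases "u = n - 1") (auto simp: gi w_base_def w_other_def)
    qed
    moreover have "n \<ge> 1" using n by simp
    ultimately show False using num_hw_base_nonzero[OF _ \<Phi>] by metis
  qed
  then show ?thesis using that by blast
qed

lemma upward_closed_interval:
  fixes S :: "nat set"
  assumes "S \<subseteq> {a..<b}" "\<And>i j. i \<in> S \<Longrightarrow> i \<le> j \<Longrightarrow> j < b \<Longrightarrow> j \<in> S"
  shows "S = {b - card S..<b}"
proof (cases "S = {}")
  case False
  have fin: "finite S" using assms(1) finite_subset by blast
  define m where "m = Min S"
  have m: "m \<in> S" "\<And>i. i \<in> S \<Longrightarrow> m \<le> i" using fin False by (auto simp: m_def)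
  have S: "S = {m..<b}"
  proof
    show "S \<subseteq> {m..<b}" using m(2) assms(1) by fastforce
    show "{m..<b} \<subseteq> S"
    proof
      fix j assume "j \<in> {m..<b}"
      then show "j \<in> S" using assms(2)[OF m(1), of j] by simp
    qed
  qed
  have "m \<le> b" using m(1) assms(1) by fastforce
  then show ?thesis using S by simp
qed simp

text \<open>
  Evaluating at \<open>z = e\<^sub>0 + e\<^bsub>n-1\<^esub>, z\<^sup>* = e\<^bsub>n-1\<^esub>\<close> bounds the first entry of the weight from below, evaluating at
  \<open>z = e\<^sub>0, z\<^sup>* = e\<^sub>0 + e\<^bsub>n-1\<^esub>\<close> bounds the last one from above; the indices that survive at either point
  fix the middle ones.
\<close>
lemma num_hw_interlaces:
  fixes \<Phi> :: "nat list \<Rightarrow> 'k::field_char_0 mpoly"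
  assumes n: "n \<ge> 1" and p: "p \<le> n - 1" and dom: "dominant_weight n \<alpha>"
    and \<Phi>: "\<Phi> \<in> numerators n p r" "num_hw n \<alpha> \<Phi>" "\<Phi> \<noteq> (\<lambda>I. 0)"
  shows "interlaces n p \<alpha>"
proof (cases "n \<ge> 2")
  case False
  then show ?thesis by (simp add: interlaces_def)
next
  case n2: True
  have sorted: "\<alpha> ! j \<le> \<alpha> ! i" if "i \<le> j" "j < n" for i j
    using dom that sorted_wrt_nth_less[of "(\<ge>)" \<alpha> i j] by (cases "i = j") (auto simp: dominant_weight_def)
  obtain I where nzI: "eval (pt n (z_base n) (w_base n)) (\<Phi> I) \<noteq> 0" using num_hw_base_nonzero[OF n \<Phi>] by metis
  note I = count_list_numerator[OF \<Phi>(1) nzI] and sI = base_support[OF n \<Phi>(1,2) nzI]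
  obtain J0 where nzJ0: "eval (pt n z_other (w_other n)) (\<Phi> J0) \<noteq> 0" using num_hw_other_nonzero[OF n2 \<Phi>] by metis
  \<comment> \<open>At the second point the contraction condition says that the components at
    \<open>0 # L\<close> and \<open>(n - 1) # L\<close> are opposite, so an index 0 can be traded
    for \<open>n - 1\<close>.\<close>
  obtain J where nzJ: "eval (pt n z_other (w_other n)) (\<Phi> J) \<noteq> 0" and J0: "0 \<notin> set J"
  proof (cases "0 \<in> set J0")
    case True
    define L where "L = remove1 0 J0"
    have nzL: "eval (pt n z_other (w_other n)) (\<Phi> (0 # L)) \<noteq> 0"
      using eval_move_to_front[OF \<Phi>(1) nzJ0 True] by (simp add: L_def)
    have "(\<Sum>\<nu><n. w_other n \<nu> * eval (pt n z_other (w_other n)) (\<Phi> (\<nu> # L))) =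
        (\<Sum>\<nu>\<in>{0, n - 1}. w_other n \<nu> * eval (pt n z_other (w_other n)) (\<Phi> (\<nu> # L)))"
      using n2 by (intro sum.mono_neutral_right) (auto simp: w_other_def)
    also have "\<dots> = eval (pt n z_other (w_other n)) (\<Phi> (0 # L)) + eval (pt n z_other (w_other n)) (\<Phi> ((n - 1) # L))"
      using n2 by (simp add: w_other_def)
    finally have "eval (pt n z_other (w_other n)) (\<Phi> ((n - 1) # L)) \<noteq> 0"
      using nzL eval_contraction[OF \<Phi>(1)] by (metis add.right_neutral)
    moreover have "0 \<notin> set ((n - 1) # L)"
      using count_list_numerator(3)[OF \<Phi>(1) nzL] n2 by auto
    ultimately show ?thesis using that by blast
  qed (use nzJ0 that in blast)
  note J = count_list_numerator[OF \<Phi>(1) nzJ]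
  note wJ = num_weight_eval[OF \<Phi>(1) num_hw_num_weight[OF \<Phi>(1,2)] nzJ]
  have midJ: "\<alpha> ! i = (if i \<in> set J then - 1 else 0)" if "0 < i" "i < n - 1" for i
    using wJ(1)[of i] that J(1)[of i] by (auto simp: z_other_def w_other_def)
  have lastJ: "\<alpha> ! (n - 1) \<le> (if n - 1 \<in> set J then - 1 else 0)"
    using wJ(3)[of "n - 1"] n2 J(1)[of "n - 1"] by (auto simp: z_other_def)
  \<comment> \<open>Both supports consist of \<open>S\<close> and at most one extra index, 0 for
    \<open>I\<close> and \<open>n - 1\<close> for \<open>J\<close>. As both have \<open>p\<close>
    elements, either both extra indices occur or neither does.\<close>
  define S where "S = {i \<in> {1..<n - 1}. \<alpha> ! i = - 1}"
  have S: "S = {n - 1 - card S..<n - 1}"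
  proof (rule upward_closed_interval)
    show "S \<subseteq> {1..<n - 1}" by (auto simp: S_def)
    fix i j assume "i \<in> S" "i \<le> j" "j < n - 1"
    moreover from this have "j < n" by linarith
    ultimately show "j \<in> S" using sorted[of i j] sI(2)[of j] by (auto simp: S_def split: if_splits)
  qed
  have mid: "\<alpha> ! i = (if n - 1 - card S \<le> i then - 1 else 0)" if "0 < i" "i < n - 1" for i
  proof -
    have "i \<in> S \<longleftrightarrow> n - 1 - card S \<le> i" using arg_cong[OF S, of "\<lambda>A. i \<in> A"] that by simp
    moreover have "i \<in> S \<longleftrightarrow> \<alpha> ! i = - 1" using that by (simp add: S_def)
    ultimately show ?thesis using sI(2)[OF that] by (simp split: if_splits)
  qed
  have cardS: "card S \<le> n - 2"
  proof -
    have "S \<subseteq> {1..<n - 1}" by (auto simp: S_def)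
    then have "card S \<le> card {1..<n - 1}" by (intro card_mono) auto
    then show ?thesis by simp
  qed
  have setI: "set I = S \<union> (if 0 \<in> set I then {0} else {})"
  proof -
    have *: "i \<in> set I \<longleftrightarrow> i \<in> S \<or> i = 0 \<and> 0 \<in> set I" for i
    proof (cases "0 < i \<and> i < n - 1")
      case True
      then show ?thesis using sI(2)[of i] by (auto simp: S_def split: if_splits)
    next
      case False
      have "i < n" if "i \<in> set I" using I(2) that by (auto simp: idx_def)
      then have "i = 0" if "i \<in> set I" using False sI(1) that n2 by (cases "i = n - 1") auto
      moreover have "i \<notin> S" using False by (auto simp: S_def)
      ultimately show ?thesis by auto
    qed
    show ?thesis by (rule Set.set_eqI) (subst *, simp)
  qed
  have setJ: "set J = S \<union> (if n - 1 \<in> set J then {n - 1} else {})"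
  proof -
    have *: "i \<in> set J \<longleftrightarrow> i \<in> S \<or> i = n - 1 \<and> n - 1 \<in> set J" for i
    proof (cases "0 < i \<and> i < n - 1")
      case True
      then show ?thesis using midJ[of i] by (auto simp: S_def split: if_splits)
    next
      case False
      have "i < n" if "i \<in> set J" using J(2) that by (auto simp: idx_def)
      then have "i = n - 1" if "i \<in> set J" using False J0 that by (cases "i = 0") auto
      moreover have "i \<notin> S" using False by (auto simp: S_def)
      ultimately show ?thesis by auto
    qed
    show ?thesis by (rule Set.set_eqI) (subst *, simp)
  qed
  have notS: "0 \<notin> S" "n - 1 \<notin> S" "finite S" by (auto simp: S_def)
  have cardI: "p = card S + (if 0 \<in> set I then 1 else 0)"
    using idx_card[OF I(2,3)] setI notS by (auto split: if_splits)
  have cardJ: "p = card S + (if n - 1 \<in> set J then 1 else 0)"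
    using idx_card[OF J(2,3)] setJ notS by (auto split: if_splits)
  have first: "\<alpha> ! 0 \<ge> (if p = card S then 0 else - 1)" using sI(3) n2 cardI by (auto split: if_splits)
  have last: "\<alpha> ! (n - 1) \<le> (if p = card S then 0 else - 1)" using lastJ cardJ by (auto split: if_splits)
  have ps: "p = card S \<or> p = Suc (card S)" using cardI by (auto split: if_splits)
  have sep: "separators n p ! i = (if i < n - 1 - p then 0 else - 1)" if "i < n - 1" for i
    using that p by (auto simp: separators_def nth_append)
  have "\<alpha> ! i \<ge> separators n p ! i \<and> separators n p ! i \<ge> \<alpha> ! Suc i" if i: "i < n - 1" for i
  proof
    show "\<alpha> ! i \<ge> separators n p ! i"
    proof (cases "i = 0")
      case True
      show ?thesis
      proof (cases "p = card S \<or> p = n - 1")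
        case True
        then show ?thesis using first sep[OF i] \<open>i = 0\<close> cardS n2 by (auto split: if_splits)
      next
        \<comment> \<open>The bound at the base point only gives -1, but here
          \<open>\<alpha> ! 1\<close> is a middle entry equal to 0, and dominance improves the bound
          to 0.\<close>
        case False
        then have "p = Suc (card S)" "p < n - 1" using ps p by auto
        then have "\<alpha> ! 1 = 0" using mid[of 1] by auto
        then show ?thesis using sorted[of 0 1] sep[OF i] \<open>i = 0\<close> n2 by auto
      qed
    next
      case False
      then show ?thesis using mid[of i] sep[OF i] i ps by auto
    qed
    show "separators n p ! i \<ge> \<alpha> ! Suc i"
    proof (cases "Suc i < n - 1")
      case True
      then show ?thesis using mid[of "Suc i"] sep[OF i] ps by auto
    next
      case False
      then have Si: "Suc i = n - 1" using i by simp
      show ?thesis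
      proof (cases "p = card S \<and> p > 0")
        \<comment> \<open>The bound at the second point only gives 0, but here the entry before the
          last is a middle entry equal to -1, and dominance improves the bound to -1.\<close>
        case True
        then have "0 < i" using cardS Si by linarith
        then have "\<alpha> ! i = - 1" using mid[of i] i True Si by auto
        moreover have "Suc i < n" using Si n2 by linarith
        ultimately show ?thesis using sorted[of i "Suc i"] sep[OF i] by simp
      next
        case False
        then show ?thesis using last ps sep[OF i] Si by (auto split: if_splits)
      qed
    qed
  qed
  then show ?thesis by (simp add: interlaces_def)
qed

section \<open>Explicit highest weight vectors\<close>

text \<open>A determinant whose columns are functions, so that multilinearity in the columns and
  linear maps applied to them can be used without forming matrices.\<close>

definition column_det :: "nat \<Rightarrow> (nat \<Rightarrow> nat \<Rightarrow> 'a::comm_ring_1) \<Rightarrow> 'a" where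
  "column_det m C = (\<Sum>\<pi> | \<pi> permutes {0..<m}. signof \<pi> * (\<Prod>t<m. C t (\<pi> t)))"

lemma column_det_det: "column_det m C = det (mat m m (\<lambda>(s, t). C t s))"
proof -
  have "(\<Prod>t<m. C t (\<pi> t)) = (\<Prod>t<m. mat m m (\<lambda>(s, t). C t s) $$ (\<pi> t, t))" if "\<pi> permutes {0..<m}" for \<pi>
    using that by (intro prod.cong refl) (auto simp: permutes_in_image[OF that] dest: permutes_in_image)
  then show ?thesis
    unfolding column_det_def by (subst det_col[of _ m]) (auto intro!: sum.cong)
qed

lemma column_det_cong: "(\<And>t s. t < m \<Longrightarrow> s < m \<Longrightarrow> C t s = C' t s) \<Longrightarrow> column_det m C = column_det m C'"
  unfolding column_det_det by (intro arg_cong[of _ _ det] eq_matI) auto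

lemma column_det_identical:
  assumes "i < m" "j < m" "i \<noteq> j" "C i = C j"
  shows "column_det m C = 0"
  unfolding column_det_det
  by (rule det_identical_columns[of _ m i j]) (use assms in \<open>auto intro!: eq_vecI\<close>)

lemma column_det_swap:
  assumes "i < m" "j < m" "i \<noteq> j"
  shows "column_det m (\<lambda>t. C (Transposition.transpose i j t)) = - column_det m C"
proof -
  have "mat m m (\<lambda>(s, t). C (Transposition.transpose i j t) s) = swapcols i j (mat m m (\<lambda>(s, t). C t s))"
    by (rule eq_matI) (use assms in \<open>auto simp: Transposition.transpose_def\<close>)
  then show ?thesis unfolding column_det_det using det_swapcols[OF assms, of "mat m m (\<lambda>(s, t). C t s)"] by simp
qed

lemma column_det_mult:
  assumes T: "T \<in> carrier_mat m m"
  shows "column_det m (\<lambda>t s. \<Sum>k<m. T $$ (s, k) * C t k) = det T * column_det m C"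
proof -
  have "mat m m (\<lambda>(s, t). \<Sum>k<m. T $$ (s, k) * C t k) = T * mat m m (\<lambda>(s, t). C t s)"
    by (rule eq_matI) (use T in \<open>auto simp: mult_mat_index[OF T, of "mat m m (\<lambda>(s, t). C t s)"] simp del: index_mult_mat(1)\<close>)
  then show ?thesis unfolding column_det_det using det_mult[OF T, of "mat m m (\<lambda>(s, t). C t s)"] by simp
qed

lemma sum_idx_prod: "(\<Sum>J\<in>idx n p. \<Prod>t<p. f t (J ! t)) = (\<Prod>t<p. \<Sum>j<n. (f t j :: 'a::comm_ring_1))"
proof (induction p arbitrary: f)
  case 0
  then show ?case by (simp add: idx_0)
next
  case (Suc p)
  have "(\<Sum>J\<in>idx n (Suc p). \<Prod>t<Suc p. f t (J ! t)) = (\<Sum>x<n. \<Sum>J\<in>idx n p. f 0 x * (\<Prod>t<p. f (Suc t) (J ! t)))"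
    unfolding sum_idx_Suc by (simp add: prod.lessThan_Suc_shift del: prod.lessThan_Suc)
  also have "\<dots> = (\<Sum>x<n. f 0 x) * (\<Prod>t<p. \<Sum>j<n. f (Suc t) j)"
    using Suc.IH[of "\<lambda>t. f (Suc t)"] by (simp add: sum_distrib_left[symmetric] sum_distrib_right[symmetric])
  finally show ?case by (simp add: prod.lessThan_Suc_shift del: prod.lessThan_Suc)
qed

definition unit_col :: "nat \<Rightarrow> nat \<Rightarrow> 'a::comm_ring_1" where
  "unit_col i k = (if k = i then 1 else 0)"

text \<open>
  The linear functionals on column vectors \<open>c\<close> whose minors give the forms: the last \<open>p + 1\<close>
  coordinates, or the pairing with \<open>x\<close> (to be \<open>z\<close>) followed by the last \<open>p\<close> coordinates.
\<close>
definition hw_row :: "nat \<Rightarrow> nat \<Rightarrow> bool \<Rightarrow> (nat \<Rightarrow> 'a::comm_ring_1) \<Rightarrow> (nat \<Rightarrow> 'a) \<Rightarrow> nat \<Rightarrow> 'a" where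
  "hw_row n p b x c s = (if b \<and> s = 0 then \<Sum>i<n. x i * c i else c (n - 1 - p + s))"

definition hw_minor :: "nat \<Rightarrow> nat \<Rightarrow> bool \<Rightarrow> (nat \<Rightarrow> 'a::comm_ring_1) \<Rightarrow> (nat \<Rightarrow> 'a) \<Rightarrow> nat list \<Rightarrow> 'a" where
  "hw_minor n p b x y I =
    column_det (Suc p) (\<lambda>t. hw_row n p b x (if t = 0 then y else unit_col (I ! (t - 1))))"

lemma hw_row_sum:
  "finite A \<Longrightarrow> hw_row n p b x (\<lambda>k. \<Sum>j\<in>A. a j * f j k) s = (\<Sum>j\<in>A. a j * hw_row n p b x (f j) s)"
  by (auto simp: hw_row_def sum_distrib_left mult_ac intro: sum.swap)

lemma sum_unit_col: "k < n \<Longrightarrow> (\<Sum>j<n. y j * unit_col j k) = y k"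
  by (simp add: unit_col_def if_distrib[of "\<lambda>a. _ * a"] cong: if_cong)

lemma hw_row_cong: "p < n \<Longrightarrow> s \<le> p \<Longrightarrow> (\<And>k. k < n \<Longrightarrow> c k = c' k) \<Longrightarrow> hw_row n p b x c s = hw_row n p b x c' s"
  by (auto simp: hw_row_def)

text \<open>Multilinearity in the last \<open>p\<close> columns: summing over all index lists
  replaces the unit columns by arbitrary ones.\<close>

lemma hw_minor_sum:
  assumes p: "p < n"
  shows "(\<Sum>J\<in>idx n p. (\<Prod>t<p. a (J ! t) t) * hw_minor n p b x y J) =
    column_det (Suc p) (\<lambda>t. hw_row n p b x (if t = 0 then y else (\<lambda>k. a k (t - 1))))"
proof -
  have "(\<Sum>J\<in>idx n p. (\<Prod>t<p. a (J ! t) t) * hw_minor n p b x y J) =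
    (\<Sum>\<pi> | \<pi> permutes {0..<Suc p}. \<Sum>J\<in>idx n p. signof \<pi> * hw_row n p b x y (\<pi> 0) *
      (\<Prod>t<p. a (J ! t) t * hw_row n p b x (unit_col (J ! t)) (\<pi> (Suc t))))"
    unfolding hw_minor_def column_det_def sum_distrib_left
    by (subst sum.swap) (simp add: prod.lessThan_Suc_shift prod.distrib mult_ac del: prod.lessThan_Suc)
  also have "\<dots> = (\<Sum>\<pi> | \<pi> permutes {0..<Suc p}. signof \<pi> * hw_row n p b x y (\<pi> 0) *
      (\<Prod>t<p. \<Sum>j<n. a j t * hw_row n p b x (unit_col j) (\<pi> (Suc t))))"
    by (simp only: sum_distrib_left[symmetric] sum_idx_prod[where f = "\<lambda>t j. a j t * hw_row n p b x (unit_col j) (_ (Suc t))"])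
  also have "\<dots> = (\<Sum>\<pi> | \<pi> permutes {0..<Suc p}. signof \<pi> * (hw_row n p b x y (\<pi> 0) *
      (\<Prod>t<p. hw_row n p b x (\<lambda>k. a k t) (\<pi> (Suc t)))))"
  proof (intro sum.cong refl, unfold mult.assoc, intro arg_cong2[of _ _ _ _ "(*)"] refl prod.cong)
    fix \<pi> t assume \<pi>: "\<pi> \<in> {\<pi>. \<pi> permutes {0..<Suc p}}" and t: "t \<in> {..<p}"
    then have "Suc t \<in> {0..<Suc p}" by simp
    then have "\<pi> (Suc t) \<in> {0..<Suc p}" using permutes_in_image[of \<pi>] \<pi> by blast
    then have "\<pi> (Suc t) \<le> p" by simp
    then have "hw_row n p b x (\<lambda>k. a k t) (\<pi> (Suc t)) = hw_row n p b x (\<lambda>k. \<Sum>j<n. a j t * unit_col j k) (\<pi> (Suc t))"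
      using p by (intro hw_row_cong) (auto simp: sum_unit_col)
    then show "(\<Sum>j<n. a j t * hw_row n p b x (unit_col j) (\<pi> (Suc t))) = hw_row n p b x (\<lambda>k. a k t) (\<pi> (Suc t))"
      by (simp add: hw_row_sum)
  qed
  finally show ?thesis
    by (simp add: column_det_def prod.lessThan_Suc_shift del: prod.lessThan_Suc)
qed

text \<open>By linearity in the second column, contraction puts \<open>y\<close> there as well, and
  a determinant with two equal columns is 0.\<close>

lemma hw_minor_contraction:
  assumes p: "Suc p < n"
  shows "(\<Sum>\<nu><n. y \<nu> * hw_minor n (Suc p) b x y (\<nu> # I)) = 0"
proof -
  let ?r = "hw_row n (Suc p) b x"
  have "(\<Sum>\<nu><n. y \<nu> * hw_minor n (Suc p) b x y (\<nu> # I)) =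
    (\<Sum>\<pi> | \<pi> permutes {0..<Suc (Suc p)}. \<Sum>\<nu><n. signof \<pi> * (?r y (\<pi> 0) *
      (y \<nu> * ?r (unit_col \<nu>) (\<pi> 1) * (\<Prod>t<p. ?r (unit_col (I ! t)) (\<pi> (Suc (Suc t)))))))"
    unfolding hw_minor_def column_det_def sum_distrib_left
    by (subst sum.swap) (simp add: prod.lessThan_Suc_shift mult_ac del: prod.lessThan_Suc)
  also have "\<dots> = (\<Sum>\<pi> | \<pi> permutes {0..<Suc (Suc p)}. signof \<pi> * (?r y (\<pi> 0) *
      (?r y (\<pi> 1) * (\<Prod>t<p. ?r (unit_col (I ! t)) (\<pi> (Suc (Suc t)))))))"
  proof (intro sum.cong refl)
    fix \<pi> assume \<pi>: "\<pi> \<in> {\<pi>. \<pi> permutes {0..<Suc (Suc p)}}"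
    have "1 \<in> {0..<Suc (Suc p)}" by simp
    then have "\<pi> 1 \<in> {0..<Suc (Suc p)}" using permutes_in_image[of \<pi>] \<pi> by blast
    then have "\<pi> 1 \<le> Suc p" by simp
    then have "?r y (\<pi> 1) = ?r (\<lambda>k. \<Sum>j<n. y j * unit_col j k) (\<pi> 1)"
      using p by (intro hw_row_cong) (auto simp: sum_unit_col)
    then have "(\<Sum>\<nu><n. y \<nu> * ?r (unit_col \<nu>) (\<pi> 1)) = ?r y (\<pi> 1)" by (simp add: hw_row_sum)
    then show "(\<Sum>\<nu><n. signof \<pi> * (?r y (\<pi> 0) *
        (y \<nu> * ?r (unit_col \<nu>) (\<pi> 1) * (\<Prod>t<p. ?r (unit_col (I ! t)) (\<pi> (Suc (Suc t))))))) =
      signof \<pi> * (?r y (\<pi> 0) * (?r y (\<pi> 1) * (\<Prod>t<p. ?r (unit_col (I ! t)) (\<pi> (Suc (Suc t))))))"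
      by (simp add: sum_distrib_left[symmetric] sum_distrib_right[symmetric])
  qed
  also have "\<dots> = column_det (Suc (Suc p)) (\<lambda>t. ?r (if t < 2 then y else unit_col (I ! (t - 2))))"
    unfolding column_det_def
    by (simp add: prod.lessThan_Suc_shift numeral_2_eq_2 del: prod.lessThan_Suc)
  also have "\<dots> = 0" by (rule column_det_identical[of 0 _ 1]) auto
  finally show ?thesis .
qed

lemma hw_minor_swap:
  assumes "i < j" "j < length I" "length I = p"
  shows "hw_minor n p b x y (swap_nth i j I) = - hw_minor n p b x y I"
proof -
  let ?C = "\<lambda>t. hw_row n p b x (if t = 0 then y else unit_col (I ! (t - 1)))"
  have "hw_minor n p b x y (swap_nth i j I) = column_det (Suc p) (\<lambda>t. ?C (Transposition.transpose (Suc i) (Suc j) t))"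
    unfolding hw_minor_def
  proof (rule column_det_cong)
    fix t s assume "t < Suc p" "s < Suc p"
    then show "hw_row n p b x (if t = 0 then y else unit_col (swap_nth i j I ! (t - 1))) s =
        ?C (Transposition.transpose (Suc i) (Suc j) t) s"
      using assms by (cases t) (auto simp: nth_swap_nth Transposition.transpose_def)
  qed
  then show ?thesis using column_det_swap[of "Suc i" "Suc p" "Suc j" ?C] assms by (simp add: hw_minor_def)
qed

lemma (in coeff_hom) eval_hw_minor:
  "coeff_eval \<phi> v (hw_minor n p b x y I) =
    hw_minor n p b (\<lambda>i. coeff_eval \<phi> v (x i)) (\<lambda>i. coeff_eval \<phi> v (y i)) I"
proof -
  have sgn: "coeff_eval \<phi> v (signof \<pi>) = signof \<pi>" for \<pi> :: "nat \<Rightarrow> nat"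
    by (simp add: sign_def eval_1 eval_uminus)
  have row: "coeff_eval \<phi> v (hw_row n p b x c s) =
      hw_row n p b (\<lambda>i. coeff_eval \<phi> v (x i)) (\<lambda>i. coeff_eval \<phi> v (c i)) s" for c s
    by (simp add: hw_row_def eval_sum eval_mult)
  have unit: "(\<lambda>i. coeff_eval \<phi> v (unit_col j i)) = unit_col j" for j
    by (auto simp: unit_col_def eval_0 eval_1)
  show ?thesis
    unfolding hw_minor_def column_det_def
    by (simp add: eval_sum eval_mult eval_prod sgn row unit if_distrib[of "\<lambda>c i. coeff_eval \<phi> v (c i)"] cong: if_cong)
qed

text \<open>The functionals in the rows span a space stable under an upper triangular
  \<open>T\<close>, which acts on it by the matrix \<open>U\<close>. Since \<open>T\<close> is
  applied to all columns at once, the minor is multiplied by \<open>det U\<close>.\<close>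

lemma hw_minor_upper_triangular:
  fixes T :: "'a::comm_ring_1 mat"
  assumes p: "p < n" and T: "T \<in> carrier_mat n n" "upper_triangular T"
    and x: "\<And>j. j < n \<Longrightarrow> (\<Sum>i<n. x' i * T $$ (i, j)) = x j"
    and I: "I \<in> idx n p"
  shows "(\<Sum>J\<in>idx n p. tens T J I * hw_minor n p b x' (\<lambda>k. \<Sum>l<n. T $$ (k, l) * y l) J) =
    (\<Prod>i\<in>{(if b then n - p else n - 1 - p)..<n}. T $$ (i, i)) * hw_minor n p b x y I"
proof -
  \<comment> \<open>For \<open>b\<close> the row of the pairing is invariant by the hypothesis on
    \<open>x'\<close>, which gives a diagonal entry 1; the rest is the lower right corner of
    \<open>T\<close>.\<close>
  define U where "U = mat (Suc p) (Suc p) (\<lambda>(s, k). if b \<and> (s = 0 \<or> k = 0) then (if s = k then 1 else 0)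
    else T $$ (n - 1 - p + s, n - 1 - p + k))"
  have U: "U \<in> carrier_mat (Suc p) (Suc p)" by (simp add: U_def)
  have T0: "T $$ (i, j) = 0" if "j < i" "i < n" for i j using T that by auto
  have row: "hw_row n p b x' (\<lambda>k. \<Sum>l<n. T $$ (k, l) * c l) s = (\<Sum>k<Suc p. U $$ (s, k) * hw_row n p b x c k)"
    if s: "s < Suc p" for c s
  proof (cases "b \<and> s = 0")
    case True
    have "(\<Sum>i<n. x' i * (\<Sum>l<n. T $$ (i, l) * c l)) = (\<Sum>l<n. (\<Sum>i<n. x' i * T $$ (i, l)) * c l)"
      unfolding sum_distrib_left sum_distrib_right by (subst sum.swap) (simp add: mult.assoc)
    also have "\<dots> = (\<Sum>l<n. x l * c l)" by (intro sum.cong refl) (simp add: x)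
    finally have "hw_row n p b x' (\<lambda>k. \<Sum>l<n. T $$ (k, l) * c l) s = hw_row n p b x c 0"
      using True by (simp add: hw_row_def)
    moreover have "(\<Sum>k<Suc p. U $$ (s, k) * hw_row n p b x c k) = (\<Sum>k\<in>{0}. U $$ (s, k) * hw_row n p b x c k)"
      by (rule sum.mono_neutral_right) (use True in \<open>auto simp: U_def\<close>)
    ultimately show ?thesis using True by (simp add: U_def)
  next
    case False
    have inj: "inj_on (\<lambda>k. n - 1 - p + k) {..<Suc p}" by (auto simp: inj_on_def)
    have img: "(\<lambda>k. n - 1 - p + k) ` {..<Suc p} = {n - 1 - p..<n}"
    proof
      show "{n - 1 - p..<n} \<subseteq> (\<lambda>k. n - 1 - p + k) ` {..<Suc p}"
      proof
        fix i assume "i \<in> {n - 1 - p..<n}"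
        then show "i \<in> (\<lambda>k. n - 1 - p + k) ` {..<Suc p}"
          using p by (intro image_eqI[of _ _ "i - (n - 1 - p)"]) auto
      qed
    qed (use p in auto)
    have "hw_row n p b x' (\<lambda>k. \<Sum>l<n. T $$ (k, l) * c l) s = (\<Sum>l<n. T $$ (n - 1 - p + s, l) * c l)"
      using False by (auto simp: hw_row_def)
    also have "\<dots> = (\<Sum>l\<in>{n - 1 - p..<n}. T $$ (n - 1 - p + s, l) * c l)"
      by (rule sum.mono_neutral_right) (use s p T0 in auto)
    also have "\<dots> = (\<Sum>k<Suc p. T $$ (n - 1 - p + s, n - 1 - p + k) * c (n - 1 - p + k))"
      unfolding img[symmetric] by (subst sum.reindex[OF inj]) simp
    also have "\<dots> = (\<Sum>k<Suc p. U $$ (s, k) * hw_row n p b x c k)"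
    proof (intro sum.cong refl)
      fix k assume k: "k \<in> {..<Suc p}"
      \<comment> \<open>For \<open>b\<close> the coordinate \<open>n - 1 - p\<close> is not among
        the functionals; the rows with \<open>s > 0\<close> do not involve it, as this entry lies
        below the diagonal.\<close>
      have "T $$ (n - 1 - p + s, n - 1 - p) = 0" if b
        using False that s p by (intro T0) auto
      then show "T $$ (n - 1 - p + s, n - 1 - p + k) * c (n - 1 - p + k) = U $$ (s, k) * hw_row n p b x c k"
        using False s k by (auto simp: U_def hw_row_def)
    qed
    finally show ?thesis .
  qed
  have detU: "det U = (\<Prod>i\<in>{(if b then n - p else n - 1 - p)..<n}. T $$ (i, i))"
  proof -
    have "upper_triangular U" by (rule upper_triangularI) (use T0 p in \<open>auto simp: U_def\<close>)
    then have "det U = prod_list (diag_mat U)" using det_upper_triangular U by blast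
    also have "\<dots> = (\<Prod>s<Suc p. U $$ (s, s))"
      using U by (simp add: prod_list_diag_prod atLeast0LessThan del: prod.lessThan_Suc)
    also have "\<dots> = (\<Prod>i\<in>{(if b then n - p else n - 1 - p)..<n}. T $$ (i, i))"
    proof (cases b)
      case True
      have shift: "Suc (n - Suc p + s) = n - p + s" for s using p by simp
      have "(\<Prod>s<Suc p. U $$ (s, s)) = U $$ (0, 0) * (\<Prod>s<p. U $$ (Suc s, Suc s))"
        by (rule prod.lessThan_Suc_shift)
      also have "(\<Prod>s<p. U $$ (Suc s, Suc s)) = (\<Prod>s<p. T $$ (n - p + s, n - p + s))"
        by (intro prod.cong refl) (simp add: U_def shift)
      also have "U $$ (0, 0) * \<dots> = (\<Prod>s<p. T $$ (n - p + s, n - p + s))"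
        using True by (simp add: U_def)
      also have "\<dots> = (\<Prod>i\<in>{n - p..<n}. T $$ (i, i))"
        by (rule prod.reindex_bij_witness[where i = "\<lambda>i. i - (n - p)" and j = "\<lambda>s. n - p + s"]) (use p in auto)
      finally show ?thesis using True by simp
    next
      case False
      have "(\<Prod>s<Suc p. U $$ (s, s)) = (\<Prod>s<Suc p. T $$ (n - 1 - p + s, n - 1 - p + s))"
        using False by (intro prod.cong refl) (simp add: U_def)
      also have "\<dots> = (\<Prod>i\<in>{n - 1 - p..<n}. T $$ (i, i))"
        by (rule prod.reindex_bij_witness[where i = "\<lambda>i. i - (n - 1 - p)" and j = "\<lambda>s. n - 1 - p + s"]) (use p in auto)
      finally show ?thesis using False by simp
    qed
    finally show ?thesis .
  qed
  have len: "length I = p" "\<And>t. t < p \<Longrightarrow> I ! t < n" using I by (auto simp: idx_def subset_iff)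
  have "(\<Sum>J\<in>idx n p. tens T J I * hw_minor n p b x' (\<lambda>k. \<Sum>l<n. T $$ (k, l) * y l) J) =
      column_det (Suc p) (\<lambda>t. hw_row n p b x' (if t = 0 then (\<lambda>k. \<Sum>l<n. T $$ (k, l) * y l) else (\<lambda>k. T $$ (k, I ! (t - 1)))))"
    using hw_minor_sum[OF p, of "\<lambda>j t. T $$ (j, I ! t)"] len by (simp add: tens_def)
  also have "\<dots> = column_det (Suc p) (\<lambda>t. hw_row n p b x' (\<lambda>k. \<Sum>l<n. T $$ (k, l) * (if t = 0 then y else unit_col (I ! (t - 1))) l))"
  proof (rule column_det_cong)
    fix t s assume t: "t < Suc p" "s < Suc p"
    have "(\<Sum>l<n. T $$ (k, l) * unit_col (I ! (t - 1)) l) = T $$ (k, I ! (t - 1))" if "t \<noteq> 0" for k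
      using len(2)[of "t - 1"] t that by (simp add: unit_col_def if_distrib[of "\<lambda>a. _ * a"] cong: if_cong)
    then show "hw_row n p b x' (if t = 0 then (\<lambda>k. \<Sum>l<n. T $$ (k, l) * y l) else (\<lambda>k. T $$ (k, I ! (t - 1)))) s =
        hw_row n p b x' (\<lambda>k. \<Sum>l<n. T $$ (k, l) * (if t = 0 then y else unit_col (I ! (t - 1))) l) s"
      by simp
  qed
  also have "\<dots> = column_det (Suc p) (\<lambda>t s. \<Sum>k<Suc p. U $$ (s, k) * hw_row n p b x (if t = 0 then y else unit_col (I ! (t - 1))) k)"
    by (rule column_det_cong) (simp only: row)
  also have "\<dots> = det U * hw_minor n p b x y I"
    unfolding hw_minor_def by (rule column_det_mult[OF U])
  finally show ?thesis unfolding detU .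
qed

lemma hw_minor_cong:
  assumes "p < n" "\<And>k. k < n \<Longrightarrow> y k = y' k"
  shows "hw_minor n p b x y I = hw_minor n p b x y' I"
  unfolding hw_minor_def
proof (rule column_det_cong)
  fix t s assume "t < Suc p" "s < Suc p"
  then show "hw_row n p b x (if t = 0 then y else unit_col (I ! (t - 1))) s =
      hw_row n p b x (if t = 0 then y' else unit_col (I ! (t - 1))) s"
    using assms by (intro hw_row_cong) auto
qed

text \<open>The factors have weights \<open>x\<close> in place 0, \<open>- y\<close> in the last
  place, and -1 in each of the last \<open>p\<close> places if \<open>b\<close>, in the last
  \<open>p + 1\<close> places otherwise. Pairing with \<open>z\<close> in one row removes one of the
  -1's, as that row is invariant.\<close>

definition hw_num :: "nat \<Rightarrow> nat \<Rightarrow> bool \<Rightarrow> nat \<Rightarrow> nat \<Rightarrow> nat list \<Rightarrow> 'k::field mpoly" where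
  "hw_num n p b x y I = (if I \<in> idx n p
     then Var 0 ^ x * Var (n + (n - 1)) ^ y * hw_minor n p b Var (\<lambda>i. Var (n + i)) I else 0)"

context grading
begin

lemma hom_one: "hom 0 (1 :: 'k::field mpoly)"
  using hom_Const[of "1 :: 'k"] by simp

lemma hom_prod: "(\<And>i. i \<in> A \<Longrightarrow> hom (d i) (f i)) \<Longrightarrow> hom (\<Sum>i\<in>A. d i) (\<Prod>i\<in>A. f i)"
proof (induction A rule: infinite_finite_induct)
  case (insert i A)
  then show ?case by (simp add: hom_mult)
qed (simp_all add: hom_one)

lemma hom_signof: "hom 0 (signof \<pi> :: 'k::field mpoly)"
proof -
  have eq: "signof \<pi> = Const (signof \<pi> :: 'k)" by (simp add: sign_def)
  show ?thesis unfolding eq by (rule hom_Const)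
qed

text \<open>Only the first column carries dual variables, so every term of the minor has the degree
  \<open>e\<close> of one of them.\<close>

lemma hom_hw_minor:
  assumes z: "\<And>i. i < n \<Longrightarrow> deg (single i 1) = 0" and w: "\<And>i. i < n \<Longrightarrow> deg (single (n + i) 1) = e" and p: "p < n"
  shows "hom e (hw_minor n p b Var (\<lambda>i. Var (n + i)) I :: 'k::field mpoly)"
proof -
  have row: "hom d (hw_row n p b Var c s :: 'k mpoly)" if c: "\<And>k. k < n \<Longrightarrow> hom d (c k)" and s: "s \<le> p" for c d s
  proof -
    have "hom d (Var k * c k)" if "k < n" for k
      using hom_mult[OF hom_Var c[OF that], of k] z[OF that] by simp
    then show ?thesis using c s p by (auto simp: hw_row_def intro!: hom_sum)
  qed
  have y: "hom e (Var (n + k) :: 'k mpoly)" if "k < n" for k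
    using hom_Var[of "n + k"] w[OF that] by metis
  have u: "hom 0 (unit_col j k :: 'k mpoly)" for j k
    by (simp add: unit_col_def hom_0 hom_one)
  have "hom (0 + e) (signof \<pi> * (\<Prod>t<Suc p. hw_row n p b Var
      (if t = 0 then (\<lambda>i. Var (n + i)) else unit_col (I ! (t - 1))) (\<pi> t)) :: 'k mpoly)"
    if \<pi>: "\<pi> permutes {0..<Suc p}" for \<pi>
  proof (rule hom_mult[OF hom_signof])
    have "hom (\<Sum>t<Suc p. if t = 0 then e else 0) (\<Prod>t<Suc p. hw_row n p b Var
      (if t = 0 then (\<lambda>i. Var (n + i)) else unit_col (I ! (t - 1))) (\<pi> t) :: 'k mpoly)"
    proof (rule hom_prod)
      fix t assume "t \<in> {..<Suc p}"
      then have "t \<in> {0..<Suc p}" by simp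
      then have "\<pi> t \<in> {0..<Suc p}" using permutes_in_image[OF \<pi>] by blast
      then show "hom (if t = 0 then e else 0) (hw_row n p b Var
          (if t = 0 then (\<lambda>i. Var (n + i)) else unit_col (I ! (t - 1))) (\<pi> t) :: 'k mpoly)"
        using y u by (intro row) auto
    qed
    then show "hom e (\<Prod>t<Suc p. hw_row n p b Var
      (if t = 0 then (\<lambda>i. Var (n + i)) else unit_col (I ! (t - 1))) (\<pi> t) :: 'k mpoly)"
      by (simp del: prod.lessThan_Suc sum.lessThan_Suc)
  qed
  then show ?thesis unfolding hw_minor_def column_det_def by (intro hom_sum) simp
qed

end

text \<open>The degree in the dual variables is \<open>y\<close> from the power and 1 from the
  minor, so the denominator needs exponent \<open>y + 1\<close> and \<open>p\<close> more for the
  differentials.\<close>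

lemma hw_num_numerators:
  assumes n: "n \<ge> 1" and p: "p \<le> n - 1"
  shows "(hw_num n p b x y :: nat list \<Rightarrow> 'k::field_char_0 mpoly) \<in> numerators n p (y + p + 1)"
proof -
  let ?\<Phi> = "hw_num n p b x y :: nat list \<Rightarrow> 'k mpoly"
  let ?m = "\<lambda>I. hw_minor n p b Var (\<lambda>i. Var (n + i)) I :: 'k mpoly"
  have pn: "p < n" using n p by simp
  have "alternating n p ?\<Phi>"
  proof (rule alternatingI)
    fix I i j assume "i < j" "j < p" and I: "I \<in> idx n p"
    then show "?\<Phi> (swap_nth i j I) = - ?\<Phi> I"
      using hw_minor_swap[of i j I p n b "Var :: nat \<Rightarrow> 'k mpoly" "\<lambda>i. Var (n + i)"] swap_nth_idx[of i p j I n]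
      by (simp add: hw_num_def idx_def)
  qed (simp add: hw_num_def)
  moreover have "contraction n ?\<Phi> I = 0" for I
  proof (cases p)
    case 0
    then show ?thesis by (simp add: contraction_def hw_num_def idx_def)
  next
    case (Suc p')
    show ?thesis
    proof (cases "I \<in> idx n p'")
      case True
      have "contraction n ?\<Phi> I = Var 0 ^ x * Var (n + (n - 1)) ^ y * (\<Sum>\<nu><n. Var (n + \<nu>) * ?m (\<nu> # I))"
        unfolding contraction_def sum_distrib_left
        by (intro sum.cong refl) (use True Suc in \<open>simp add: hw_num_def idx_Cons mult_ac\<close>)
      also have "(\<Sum>\<nu><n. Var (n + \<nu>) * ?m (\<nu> # I)) = 0"
        using hw_minor_contraction[of p' n "\<lambda>i. Var (n + i)" b "Var :: nat \<Rightarrow> 'k mpoly" I] pn Suc by simp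
      finally show ?thesis by simp
    next
      case False
      then show ?thesis using Suc by (simp add: contraction_def hw_num_def idx_Cons)
    qed
  qed
  moreover have "dual.hom n (int (y + p + 1) - int p) (?\<Phi> I)" for I
  proof (cases "I \<in> idx n p")
    case True
    have m: "dual.hom n 1 (?m I)"
      by (rule dual.hom_hw_minor[OF _ _ pn]) (simp_all only: dual_degree_single, auto)
    have "dual.hom n (\<Sum>i<x. 0) (\<Prod>i<x. Var 0 :: 'k mpoly)"
    proof (rule dual.hom_prod)
      have "dual_degree n (single 0 1) = 0" unfolding dual_degree_single using n by simp
      then show "dual.hom n 0 (Var 0 :: 'k mpoly)" using dual.hom_Var[of n 0] by metis
    qed
    moreover have "dual.hom n (\<Sum>i<y. 1) (\<Prod>i<y. Var (n + (n - 1)) :: 'k mpoly)"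
    proof (rule dual.hom_prod)
      have c: "n \<le> n + (n - 1) \<and> n + (n - 1) < 2 * n" using n by arith
      have "dual_degree n (single (n + (n - 1)) 1) = 1" unfolding dual_degree_single if_P[OF c] ..
      then show "dual.hom n 1 (Var (n + (n - 1)) :: 'k mpoly)" using dual.hom_Var[of n "n + (n - 1)"] by metis
    qed
    ultimately have "dual.hom n ((\<Sum>i<x. 0) + (\<Sum>i<y. 1) + 1)
        ((\<Prod>i<x. Var 0) * (\<Prod>i<y. Var (n + (n - 1))) * ?m I)"
      using m by (intro dual.hom_mult)
    then show ?thesis using True by (simp add: hw_num_def algebra_simps)
  qed (simp add: hw_num_def dual.hom_0)
  moreover have "other.hom n 0 (?\<Phi> I)" for I
  proof (cases "I \<in> idx n p")
    case True
    have d: "other_degree n (single v 1) = 0" if "v < 2 * n" for v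
      using that by (auto simp: other_degree_def fun_eq_iff lookup_single when_def)
    have m: "other.hom n 0 (?m I)"
      by (rule other.hom_hw_minor[OF _ _ pn]) (use d in auto)
    have v: "other.hom n 0 (Var v :: 'k mpoly)" if "v < 2 * n" for v
      using other.hom_Var[of n v] d[OF that] by metis
    have pw: "other.hom n 0 (Var v ^ k :: 'k mpoly)" if "v < 2 * n" for v k
      using other.hom_prod[of "{..<k}" n "\<lambda>_. 0" "\<lambda>_. Var v :: 'k mpoly"] v[OF that] by simp
    have "other.hom n (0 + 0 + 0) (Var 0 ^ x * Var (n + (n - 1)) ^ y * ?m I)"
      by (intro other.hom_mult m pw) (use n in auto)
    then show ?thesis using True by (simp only: hw_num_def if_True add_0_left)
  qed (simp add: hw_num_def other.hom_0)
  ultimately show ?thesis by (simp add: numerators_def dual_homogeneous_hom poly_zzd_hom)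
qed

lemma integral_hw_num: "integral_poly (hw_num n p b x y I)"
proof -
  have sgn: "integral_poly (signof \<pi> :: 'a mpoly)" for \<pi> :: "nat \<Rightarrow> nat"
    by (simp add: sign_def integral_poly_0_1 integral_poly_uminus)
  have row: "integral_poly (hw_row n p b Var c s :: 'a mpoly)" if "\<And>k. integral_poly (c k)" for c s
    using that by (auto simp: hw_row_def intro!: integral_poly_sum integral_poly_mult integral_poly_Var)
  have unit: "integral_poly (unit_col j k :: 'a mpoly)" for j k
    by (simp add: unit_col_def integral_poly_0_1)
  have "integral_poly (hw_minor n p b Var (\<lambda>i. Var (n + i)) I :: 'a mpoly)"
    unfolding hw_minor_def column_det_def
  proof (intro integral_poly_sum integral_poly_mult integral_poly_prod sgn row)
    show "integral_poly ((if t = 0 then \<lambda>i. Var (n + i) else unit_col (I ! (t - 1))) k :: 'a mpoly)" for t k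
      by (simp add: unit integral_poly_Var)
  qed
  then show ?thesis
    by (auto simp: hw_num_def intro!: integral_poly_mult integral_poly_power integral_poly_Var integral_poly_0_1)
qed

text \<open>At \<open>z\<close> the first unit vector and the dual vector with all entries 1, the
  matrix of this component is lower triangular with 1 on the diagonal.\<close>

lemma hw_num_nonzero:
  assumes n: "n \<ge> 1" and p: "p \<le> n - 1"
  shows "(hw_num n p b x y :: nat list \<Rightarrow> 'k::field_char_0 mpoly) [n - p..<n] \<noteq> 0"
proof -
  let ?x = "\<lambda>v. if v = 0 \<or> n \<le> v then 1 else 0 :: 'k"
  let ?C = "\<lambda>t. hw_row n p b (\<lambda>i. ?x i) (if t = 0 then (\<lambda>i. 1) else unit_col ([n - p..<n] ! (t - 1)))"
  have I: "[n - p..<n] \<in> idx n p" using p n by (auto simp: idx_def)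
  have "eval ?x (hw_minor n p b Var (\<lambda>i. Var (n + i)) [n - p..<n]) = column_det (Suc p) ?C"
    unfolding eval_def hom_id.eval_hw_minor by (simp add: hom_id.eval_Var hw_minor_def)
  also have "\<dots> = det (mat (Suc p) (Suc p) (\<lambda>(s, t). ?C t s))" by (rule column_det_det)
  also have "\<dots> = prod_list (diag_mat (mat (Suc p) (Suc p) (\<lambda>(s, t). ?C t s)))"
  proof (rule det_lower_triangular[where n = "Suc p"])
    fix i j assume "i < j" "j < Suc p"
    then show "mat (Suc p) (Suc p) (\<lambda>(s, t). ?C t s) $$ (i, j) = 0"
      using n p by (auto simp: hw_row_def unit_col_def if_distrib[of "\<lambda>a. _ * a"] cong: if_cong)
  qed simp
  also have "\<dots> = (\<Prod>s<Suc p. ?C s s)"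
    by (simp add: prod_list_diag_prod atLeast0LessThan del: prod.lessThan_Suc)
  also have "\<dots> = (\<Prod>s<Suc p. 1)"
  proof (rule prod.cong)
    fix s assume s: "s \<in> {..<Suc p}"
    show "?C s s = 1"
    proof (cases "s = 0")
      case True
      have "(\<Sum>i<n. ?x i * 1) = (\<Sum>i\<in>{0}. ?x i * 1)"
        using n by (intro sum.mono_neutral_right) auto
      then show ?thesis using True n p by (simp add: hw_row_def)
    next
      case False
      then show ?thesis using n p s by (auto simp: hw_row_def unit_col_def)
    qed
  qed simp
  finally have "eval ?x (hw_num n p b x y [n - p..<n]) = 1" using I n by (simp add: hw_num_def)
  then show ?thesis by auto
qed

text \<open>The first coordinate, the last dual coordinate and the family of minors are each
  multiplied by a character under upper triangular matrices, and the characters multiply to the one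
  of \<open>\<alpha>\<close>.\<close>

lemma hw_num_hw:
  fixes \<alpha> :: "int list"
  assumes n: "n \<ge> 1" and p: "p \<le> n - 1"
    and \<alpha>: "\<And>i. i < n \<Longrightarrow> \<alpha> ! i = (if i = 0 then int x else 0) - (if i = n - 1 then int y else 0)
      - (if (if b then n - p else n - 1 - p) \<le> i then 1 else 0)"
  shows "num_hw n \<alpha> (hw_num n p b x y :: nat list \<Rightarrow> 'k::field_char_0 mpoly)"
  unfolding num_hw_def
proof (intro ballI impI ext)
  fix g :: "'k mat" and I assume g: "g \<in> GL n" "upper_triangular g"
  note inv = upper_triangular_GL[OF g] and c = GL_carrier[OF g(1)] GL_mat_inv[OF g(1)]
  have pn: "p < n" using n p by simp
  let ?\<Phi> = "hw_num n p b x y :: nat list \<Rightarrow> 'k mpoly"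
  let ?k = "if b then n - p else n - 1 - p"
  define T where "T = map_mat Const (mat_inv g)"
  have T: "T \<in> carrier_mat n n" "\<And>i j. i < n \<Longrightarrow> j < n \<Longrightarrow> T $$ (i, j) = Const (mat_inv g $$ (i, j))"
    using c(2) by (auto simp: T_def)
  have utT: "upper_triangular T"
    by (rule upper_triangularI) (use T inv(2) c(2) in \<open>auto dest: upper_triangularD\<close>)
  show "gl_num n g ?\<Phi> I = Const (character n \<alpha> g) * ?\<Phi> I"
  proof (cases "I \<in> idx n p")
    case False
    then show ?thesis using gl_num_not_idx[OF False, of ?\<Phi>] by (simp add: hw_num_def)
  next
    case I: True
    have n0: "0 < n" using n by simp
    have v0: "gl_var n g 0 = Const (g $$ (0, 0)) * Var 0"
    proof -
      have "gl_var n g 0 = (\<Sum>i\<in>{0}. Const (g $$ (i, 0)) * Var i)"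
        unfolding gl_var_simps(1)[OF n0]
        by (rule sum.mono_neutral_right) (use n0 upper_triangularD[OF g(2), of 0] c(1) in auto)
      then show ?thesis by simp
    qed
    have v1: "gl_var n g (n + (n - 1)) = Const (mat_inv g $$ (n - 1, n - 1)) * Var (n + (n - 1))"
    proof -
      have n1: "n - 1 < n" using n by simp
      have "gl_var n g (n + (n - 1)) = (\<Sum>i\<in>{n - 1}. Const (mat_inv g $$ (n - 1, i)) * Var (n + i))"
        unfolding gl_var_simps(2)[OF n1]
        by (rule sum.mono_neutral_right) (use n0 upper_triangularD[OF inv(2), of _ "n - 1"] c(2) in auto)
      then show ?thesis by simp
    qed
    have minor: "subst_gl n g (hw_minor n p b Var (\<lambda>i. Var (n + i)) J) =
        hw_minor n p b (gl_var n g) (\<lambda>k. \<Sum>l<n. T $$ (k, l) * Var (n + l)) J" for J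
    proof -
      have "subst_gl n g (hw_minor n p b Var (\<lambda>i. Var (n + i)) J) = hw_minor n p b (gl_var n g) (\<lambda>i. gl_var n g (n + i)) J"
        unfolding subst_gl_def poly_subst_coeff_eval hom_Const.eval_hw_minor by (simp add: hom_Const.eval_Var)
      also have "\<dots> = hw_minor n p b (gl_var n g) (\<lambda>k. \<Sum>l<n. T $$ (k, l) * Var (n + l)) J"
        by (rule hw_minor_cong[OF pn]) (simp add: gl_var_simps T(2))
      finally show ?thesis .
    qed
    have tensT: "tens T J I = Const (tens (mat_inv g) J I)" if "J \<in> idx n p" for J
      using that I T(2) by (auto simp: tens_def Const_prod idx_def subset_iff intro!: prod.cong)
    \<comment> \<open>Invariance of the pairing: as row vectors, \<open>z g\<close> times the
      inverse of \<open>g\<close> is \<open>z\<close>.\<close>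
    have xT: "(\<Sum>i<n. gl_var n g i * T $$ (i, j)) = Var j" if j: "j < n" for j
    proof -
      have "(\<Sum>i<n. gl_var n g i * T $$ (i, j)) = (\<Sum>i<n. \<Sum>a<n. Const (g $$ (a, i) * mat_inv g $$ (i, j)) * Var a)"
        using j by (intro sum.cong refl) (simp add: gl_var_simps T(2) sum_distrib_left sum_distrib_right mult_ac)
      also have "\<dots> = (\<Sum>a<n. Const (\<Sum>i<n. g $$ (a, i) * mat_inv g $$ (i, j)) * Var a)"
        by (subst sum.swap) (simp add: Const_sum sum_distrib_right)
      also have "\<dots> = (\<Sum>a<n. if a = j then Var a else 0)"
        using mult_mat_index[OF c(1,2) _ j, symmetric] j unfolding c(3) by (intro sum.cong refl) simp
      also have "\<dots> = Var j" using j by simp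
      finally show ?thesis .
    qed
    let ?h = "\<lambda>i. mat_inv g $$ (i, i)"
    have \<Phi>I: "?\<Phi> I = Var 0 ^ x * Var (n + (n - 1)) ^ y * hw_minor n p b Var (\<lambda>i. Var (n + i)) I"
      using I by (simp only: hw_num_def if_True)
    have "gl_num n g ?\<Phi> I = Const (g $$ (0, 0)) ^ x * Const (?h (n - 1)) ^ y * (Var 0 ^ x * Var (n + (n - 1)) ^ y) *
        (\<Sum>J\<in>idx n p. tens T J I * hw_minor n p b (gl_var n g) (\<lambda>k. \<Sum>l<n. T $$ (k, l) * Var (n + l)) J)"
      unfolding gl_num_idx[OF I] sum_distrib_left
    proof (intro sum.cong refl)
      fix J assume J: "J \<in> idx n p"
      have "subst_gl n g (?\<Phi> J) = (Const (g $$ (0, 0)) * Var 0) ^ x * (Const (?h (n - 1)) * Var (n + (n - 1))) ^ y *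
          hw_minor n p b (gl_var n g) (\<lambda>k. \<Sum>l<n. T $$ (k, l) * Var (n + l)) J"
        using J by (simp only: hw_num_def if_True subst_gl_simps v0 v1 minor)
      then show "Const (tens (mat_inv g) J I) * subst_gl n g (?\<Phi> J) =
          Const (g $$ (0, 0)) ^ x * Const (?h (n - 1)) ^ y * (Var 0 ^ x * Var (n + (n - 1)) ^ y) *
          (tens T J I * hw_minor n p b (gl_var n g) (\<lambda>k. \<Sum>l<n. T $$ (k, l) * Var (n + l)) J)"
        by (simp only: tensT[OF J] power_mult_distrib mult_ac)
    qed
    also have "(\<Sum>J\<in>idx n p. tens T J I * hw_minor n p b (gl_var n g) (\<lambda>k. \<Sum>l<n. T $$ (k, l) * Var (n + l)) J) =
        (\<Prod>i\<in>{?k..<n}. T $$ (i, i)) * hw_minor n p b Var (\<lambda>i. Var (n + i)) I"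
      by (rule hw_minor_upper_triangular[OF pn T(1) utT xT I])
    also have "(\<Prod>i\<in>{?k..<n}. T $$ (i, i)) = Const (\<Prod>i\<in>{?k..<n}. ?h i)"
      unfolding Const_prod by (intro prod.cong refl) (simp add: T(2))
    finally have "gl_num n g ?\<Phi> I = Const (g $$ (0, 0) ^ x * ?h (n - 1) ^ y * (\<Prod>i\<in>{?k..<n}. ?h i)) * ?\<Phi> I"
      unfolding \<Phi>I by (simp only: Const_simps Const_power mult_ac)
    moreover have "character n \<alpha> g = g $$ (0, 0) ^ x * ?h (n - 1) ^ y * (\<Prod>i\<in>{?k..<n}. ?h i)"
    proof -
      have "character n \<alpha> g = (\<Prod>i<n. (if i = 0 then g $$ (0, 0) ^ x else 1) *
          (if i = n - 1 then ?h (n - 1) ^ y else 1) * (if ?k \<le> i then ?h i else 1))"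
        unfolding character_def
      proof (intro prod.cong refl)
        fix i assume "i \<in> {..<n}"
        then have i: "i < n" by simp
        have "(g $$ (i, i)) powi (\<alpha> ! i) = (g $$ (i, i)) powi (if i = 0 then int x else 0) *
            (g $$ (i, i)) powi (- (if i = n - 1 then int y else 0)) * (g $$ (i, i)) powi (- (if ?k \<le> i then 1 else 0))"
          unfolding \<alpha>[OF i] using inv(1)[OF i] by (simp add: power_int_diff power_int_minus divide_inverse)
        also have "(g $$ (i, i)) powi (- (if i = n - 1 then int y else 0)) = (if i = n - 1 then ?h (n - 1) ^ y else 1)"
        proof (cases "i = n - 1")
          case True
          then have "?h (n - 1) = inverse (g $$ (i, i))" using inv(3)[OF i] by simp
          then show ?thesis using True by (simp only: power_int_minus power_inverse if_True simp_thms power_int_of_nat)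
        qed simp
        also have "(g $$ (i, i)) powi (- (if ?k \<le> i then 1 else 0)) = (if ?k \<le> i then ?h i else 1)"
          using inv(3)[OF i] by (simp add: power_int_minus)
        also have "(g $$ (i, i)) powi (if i = 0 then int x else 0) = (if i = 0 then g $$ (0, 0) ^ x else 1)" by simp
        finally show "(g $$ (i, i)) powi (\<alpha> ! i) = (if i = 0 then g $$ (0, 0) ^ x else 1) *
            (if i = n - 1 then ?h (n - 1) ^ y else 1) * (if ?k \<le> i then ?h i else 1)" .
      qed
      also have "\<dots> = (\<Prod>i<n. if i = 0 then g $$ (0, 0) ^ x else 1) *
          (\<Prod>i<n. if i = n - 1 then ?h (n - 1) ^ y else 1) * (\<Prod>i<n. if ?k \<le> i then ?h i else 1)"
        by (simp only: prod.distrib)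
      also have "(\<Prod>i<n. if i = 0 then g $$ (0, 0) ^ x else 1) = g $$ (0, 0) ^ x" using n by simp
      also have "(\<Prod>i<n. if i = n - 1 then ?h (n - 1) ^ y else 1) = ?h (n - 1) ^ y" using n by simp
      also have "(\<Prod>i<n. if ?k \<le> i then ?h i else 1) = (\<Prod>i\<in>{?k..<n}. ?h i)"
        by (rule prod.mono_neutral_cong_right) auto
      finally show ?thesis .
    qed
    ultimately show ?thesis by simp
  qed
qed

text \<open>Interlacing fixes all entries except the first, the last and the one in place
  \<open>n - 1 - p\<close>, which lies between a separator 0 and a separator -1. The flag
  \<open>b\<close> records this last choice, and \<open>x\<close> and \<open>y\<close> absorb the
  ends. For \<open>p = 0\<close> and \<open>p = n - 1\<close> the special place is itself an end, so
  \<open>b\<close> is prescribed.\<close>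

lemma interlaces_hw_num:
  assumes n: "n \<ge> 1" and p: "p \<le> n - 1" and int: "interlaces n p \<alpha>"
  obtains b x y where "num_hw n \<alpha> (hw_num n p b x y :: nat list \<Rightarrow> 'k::field_char_0 mpoly)"
proof -
  let ?\<alpha> = "\<lambda>b x y i. (if i = 0 then int x else 0) - (if i = n - 1 then int y else 0)
      - (if (if b then n - p else n - 1 - p) \<le> i then 1 else 0 :: int)"
  have sep: "separators n p ! i = (if i < n - 1 - p then 0 else - 1)" if "i < n - 1" for i
    using that p by (auto simp: separators_def nth_append)
  have ge: "\<alpha> ! i \<ge> (if i < n - 1 - p then 0 else - 1)" if "i < n - 1" for i
    using int that sep[OF that] by (auto simp: interlaces_def)
  have le: "\<alpha> ! i \<le> (if i \<le> n - 1 - p then 0 else - 1)" if "0 < i" "i < n" for i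
  proof -
    have "i - 1 < n - 1" "Suc (i - 1) = i" using that by auto
    then have "separators n p ! (i - 1) \<ge> \<alpha> ! i" using int unfolding interlaces_def by metis
    then show ?thesis using sep[of "i - 1"] that by (auto split: if_splits)
  qed
  have "\<exists>b x y. \<forall>i<n. \<alpha> ! i = ?\<alpha> b x y i"
  proof (cases "n = 1")
    case True
    then have "\<forall>i<n. \<alpha> ! i = ?\<alpha> True (nat (\<alpha> ! 0)) (nat (- (\<alpha> ! 0))) i" using p by auto
    then show ?thesis by blast
  next
    case False
    then have n2: "n \<ge> 2" using n by simp
    show ?thesis
    proof (cases "p = 0")
      case True
      have "\<alpha> ! i = ?\<alpha> True (nat (\<alpha> ! 0)) (nat (- (\<alpha> ! (n - 1)))) i" if "i < n" for i
        using ge[of i] le[of i] True that n2 by (cases "i = 0"; cases "i = n - 1") (auto split: if_splits)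
      then show ?thesis by blast
    next
      case p0: False
      show ?thesis
      proof (cases "p = n - 1")
        case True
        \<comment> \<open>Here \<open>\<alpha> ! 0\<close> may be -1, which needs the minor with -1
          in all \<open>n\<close> places; \<open>x\<close> and \<open>y\<close> are shifted by 1
          accordingly.\<close>
        have "\<alpha> ! i = ?\<alpha> False (nat (\<alpha> ! 0 + 1)) (nat (- 1 - \<alpha> ! (n - 1))) i" if "i < n" for i
          using ge[of i] le[of i] True that n2 by (cases "i = 0"; cases "i = n - 1") (auto split: if_splits)
        then show ?thesis by blast
      next
        case False
        define b where "b \<longleftrightarrow> \<alpha> ! (n - 1 - p) = 0"
        have k: "0 < n - 1 - p" "n - 1 - p < n - 1" using p p0 False by auto
        have ak: "\<alpha> ! (n - 1 - p) = (if b then 0 else - 1)"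
          using ge[OF k(2)] le[OF k(1)] k by (auto simp: b_def)
        have "\<alpha> ! i = ?\<alpha> b (nat (\<alpha> ! 0)) (nat (- 1 - \<alpha> ! (n - 1))) i" if i: "i < n" for i
        proof -
          have kp: "n - p = Suc (n - 1 - p)" using k p by simp
          consider "i = 0" | "0 < i" "i < n - 1 - p" | "i = n - 1 - p" | "n - 1 - p < i" "i < n - 1" | "i = n - 1"
            using i by linarith
          then show ?thesis
          proof cases
            case 1
            then show ?thesis using ge[of 0] k n2 kp by auto
          next
            case 2
            then show ?thesis using ge[of i] le[of i] kp k i by auto
          next
            case 3
            then show ?thesis using ak k kp by auto
          next
            case 4
            then show ?thesis using ge[of i] le[of i] kp k i by auto
          next
            case 5
            then show ?thesis using le[of i] kp k n2 by auto
          qed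
        qed
        then show ?thesis by blast
      qed
    qed
  qed
  then obtain b x y where "\<forall>i<n. \<alpha> ! i = ?\<alpha> b x y i" by blast
  then have "num_hw n \<alpha> (hw_num n p b x y :: nat list \<Rightarrow> 'k mpoly)" by (intro hw_num_hw[OF n p]) blast
  then show ?thesis using that by blast
qed

section \<open>Rationality\<close>

lemma GL_regular_sum: "(\<And>i. i \<in> A \<Longrightarrow> f i \<in> GL_regular n) \<Longrightarrow> (\<lambda>g. \<Sum>i\<in>A. f i g) \<in> GL_regular n"
  by (induction A rule: infinite_finite_induct) (auto intro: GL_regular.const GL_regular.add)

lemma GL_regular_prod: "(\<And>i. i \<in> A \<Longrightarrow> f i \<in> GL_regular n) \<Longrightarrow> (\<lambda>g. \<Prod>i\<in>A. f i g) \<in> GL_regular n"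
  by (induction A rule: infinite_finite_induct) (auto intro: GL_regular.const GL_regular.mult)

lemma GL_regular_sum_list: "(\<And>x. x \<in> set L \<Longrightarrow> f x \<in> GL_regular n) \<Longrightarrow> (\<lambda>g. \<Sum>x\<leftarrow>L. f x g) \<in> GL_regular n"
  by (induction L) (auto intro: GL_regular.const GL_regular.add)

text \<open>Cramer's rule, with the cofactor expanded by the Leibniz formula into entries of
  \<open>g\<close>.\<close>

lemma GL_regular_mat_inv:
  assumes ij: "i < n" "j < n"
  obtains c where "c \<in> GL_regular n" "\<And>g. g \<in> GL n \<Longrightarrow> mat_inv g $$ (i, j) = (c g :: 'k::field)"
proof -
  \<comment> \<open>The renumbering caused by deleting row or column \<open>i\<close>.\<close>
  let ?ins = "\<lambda>i k. if k < i then k else Suc k"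
  define c where "c = (\<lambda>g :: 'k mat. inverse (det g) * ((- 1) ^ (j + i) * (\<Sum>\<pi> | \<pi> permutes {0..<n - 1}.
    signof \<pi> * (\<Prod>k = 0..<n - 1. g $$ (?ins j k, ?ins i (\<pi> k))))))"
  have "c \<in> GL_regular n"
    unfolding c_def
  proof (intro GL_regular.mult GL_regular.inv_det GL_regular.const GL_regular_sum GL_regular_prod)
    fix \<pi> k assume \<pi>: "\<pi> \<in> {\<pi>. \<pi> permutes {0..<n - 1}}" and k: "k \<in> {0..<n - 1}"
    then have "\<pi> k \<in> {0..<n - 1}" using permutes_in_image[of \<pi>] by blast
    then show "(\<lambda>g. g $$ (?ins j k, ?ins i (\<pi> k))) \<in> GL_regular n"
      using k by (intro GL_regular.entry) auto
  qed
  moreover have "mat_inv g $$ (i, j) = c g" if g: "g \<in> GL n" for g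
  proof -
    note cr = GL_carrier[OF g] GL_mat_inv[OF g]
    have "det g * det (mat_inv g) = 1" using det_mult[OF cr(1,2)] cr(3) by simp
    then have d: "det g \<noteq> 0" by auto
    have adj: "adj_mat g \<in> carrier_mat n n" "adj_mat g * g = det g \<cdot>\<^sub>m 1\<^sub>m n" using adj_mat[OF cr(1)] by auto
    have "adj_mat g = adj_mat g * (g * mat_inv g)" using adj(1) cr(3) by simp
    also have "\<dots> = adj_mat g * g * mat_inv g" by (rule mult_mat_assoc) (use adj cr in auto)
    also have "\<dots> = det g \<cdot>\<^sub>m mat_inv g" unfolding adj(2) using mult_smult_assoc_mat[of "1\<^sub>m n" n n "mat_inv g" n] cr(2) by simp
    finally have "adj_mat g $$ (i, j) = det g * mat_inv g $$ (i, j)" using cr(2) ij by simp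
    then have "mat_inv g $$ (i, j) = inverse (det g) * adj_mat g $$ (i, j)" using d by (simp add: field_simps)
    also have "adj_mat g $$ (i, j) = (- 1) ^ (j + i) * det (mat_delete g j i)"
      using cr(1) ij by (simp add: adj_mat_def cofactor_def)
    also have "det (mat_delete g j i) = (\<Sum>\<pi> | \<pi> permutes {0..<n - 1}.
        signof \<pi> * (\<Prod>k = 0..<n - 1. g $$ (?ins j k, ?ins i (\<pi> k))))"
    proof -
      have "mat_delete g j i \<in> carrier_mat (n - 1) (n - 1)" by (rule mat_delete_carrier[OF cr(1)])
      then have "det (mat_delete g j i) = (\<Sum>\<pi> | \<pi> permutes {0..<n - 1}.
          signof \<pi> * (\<Prod>k = 0..<n - 1. mat_delete g j i $$ (k, \<pi> k)))" by (rule det_def')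
      also have "\<dots> = (\<Sum>\<pi> | \<pi> permutes {0..<n - 1}.
          signof \<pi> * (\<Prod>k = 0..<n - 1. g $$ (?ins j k, ?ins i (\<pi> k))))"
      proof (intro sum.cong refl arg_cong2[of _ _ _ _ "(*)"] prod.cong)
        fix \<pi> k assume \<pi>: "\<pi> \<in> {\<pi>. \<pi> permutes {0..<n - 1}}" and k: "k \<in> {0..<n - 1}"
        then have "\<pi> k \<in> {0..<n - 1}" using permutes_in_image[of \<pi>] by blast
        then show "mat_delete g j i $$ (k, \<pi> k) = g $$ (?ins j k, ?ins i (\<pi> k))"
          using k cr(1) by (simp add: mat_delete_def)
      qed
      finally show ?thesis .
    qed
    finally show ?thesis by (simp add: c_def)
  qed
  ultimately show ?thesis using that by blast
qed

text \<open>Polynomials depending on \<open>g\<close> through finitely many regular coefficients.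
  Lists of pairs allow repetitions, so that sums become concatenations.\<close>

definition regular_poly :: "nat \<Rightarrow> ('k::field mat \<Rightarrow> 'k mpoly) \<Rightarrow> bool" where
  "regular_poly n F \<longleftrightarrow> (\<exists>L. (\<forall>(c, e)\<in>set L. c \<in> GL_regular n) \<and>
     (\<forall>g\<in>GL n. F g = (\<Sum>(c, e)\<leftarrow>L. Const (c g) * e)))"

definition regular_num :: "nat \<Rightarrow> ('k::field mat \<Rightarrow> nat list \<Rightarrow> 'k mpoly) \<Rightarrow> bool" where
  "regular_num n F \<longleftrightarrow> (\<exists>L. (\<forall>(c, E)\<in>set L. c \<in> GL_regular n) \<and>
     (\<forall>g\<in>GL n. F g = (\<lambda>I. \<Sum>(c, E)\<leftarrow>L. Const (c g) * E I)))"

lemma regular_poly_cong: "(\<And>g. g \<in> GL n \<Longrightarrow> F g = G g) \<Longrightarrow> regular_poly n F \<Longrightarrow> regular_poly n G"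
  by (auto simp: regular_poly_def)

lemma regular_poly_const: "regular_poly n (\<lambda>g. P)"
  unfolding regular_poly_def by (intro exI[of _ "[(\<lambda>_. 1, P)]"]) (auto intro: GL_regular.const)

lemma regular_poly_add:
  assumes "regular_poly n F" "regular_poly n G"
  shows "regular_poly n (\<lambda>g. F g + G g)"
proof -
  obtain L L' where "\<forall>(c, e)\<in>set L. c \<in> GL_regular n" "\<forall>g\<in>GL n. F g = (\<Sum>(c, e)\<leftarrow>L. Const (c g) * e)"
    "\<forall>(c, e)\<in>set L'. c \<in> GL_regular n" "\<forall>g\<in>GL n. G g = (\<Sum>(c, e)\<leftarrow>L'. Const (c g) * e)"
    using assms unfolding regular_poly_def by blast
  then show ?thesis unfolding regular_poly_def by (intro exI[of _ "L @ L'"]) auto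
qed

lemma regular_poly_sum: "(\<And>i. i \<in> A \<Longrightarrow> regular_poly n (F i)) \<Longrightarrow> regular_poly n (\<lambda>g. \<Sum>i\<in>A. F i g)"
  by (induction A rule: infinite_finite_induct) (auto intro: regular_poly_add regular_poly_const)

lemma regular_poly_term:
  assumes c: "c \<in> GL_regular n" and F: "regular_poly n F"
  shows "regular_poly n (\<lambda>g. Const (c g) * e * F g)"
proof -
  obtain L where L: "\<forall>(c, e)\<in>set L. c \<in> GL_regular n" "\<forall>g\<in>GL n. F g = (\<Sum>(c, e)\<leftarrow>L. Const (c g) * e)"
    using F unfolding regular_poly_def by blast
  have "Const (c g) * e * (\<Sum>(c', e')\<leftarrow>L. Const (c' g) * e') =
      (\<Sum>(c', e')\<leftarrow>map (\<lambda>(c', e'). (\<lambda>g. c g * c' g, e * e')) L. Const (c' g) * e')" for g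
    by (induction L) (auto simp: algebra_simps)
  then show ?thesis
    unfolding regular_poly_def using L c
    by (intro exI[of _ "map (\<lambda>(c', e'). (\<lambda>g. c g * c' g, e * e')) L"]) (auto intro: GL_regular.mult)
qed

lemma regular_poly_mult:
  assumes F: "regular_poly n F" and G: "regular_poly n G"
  shows "regular_poly n (\<lambda>g. F g * G g)"
proof -
  obtain L where L: "\<forall>(c, e)\<in>set L. c \<in> GL_regular n" "\<forall>g\<in>GL n. F g = (\<Sum>(c, e)\<leftarrow>L. Const (c g) * e)"
    using F unfolding regular_poly_def by blast
  have "regular_poly n (\<lambda>g. (\<Sum>(c, e)\<leftarrow>L. Const (c g) * e) * G g)"
    using L(1)
  proof (induction L)
    case Nil
    then show ?case using regular_poly_const[of n 0] by simp
  next
    case (Cons x L)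
    obtain c e where x: "x = (c, e)" by (cases x)
    have "regular_poly n (\<lambda>g. Const (c g) * e * G g + (\<Sum>(c, e)\<leftarrow>L. Const (c g) * e) * G g)"
      using Cons x by (intro regular_poly_add regular_poly_term G) auto
    then show ?case by (simp add: x ring_distribs)
  qed
  then show ?thesis by (rule regular_poly_cong[rotated]) (simp add: L(2))
qed

lemma regular_poly_coeff:
  assumes "c \<in> GL_regular n" "\<And>g. g \<in> GL n \<Longrightarrow> c' g = c g"
  shows "regular_poly n (\<lambda>g. Const (c' g))"
  unfolding regular_poly_def by (rule exI[of _ "[(c, 1)]"]) (use assms in auto)

lemma regular_poly_mat_inv:
  assumes "i < n" "j < n"
  shows "regular_poly n (\<lambda>g. Const (mat_inv g $$ (i, j)) :: 'a::field mpoly)"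
proof -
  obtain c :: "'a mat \<Rightarrow> 'a" where c: "c \<in> GL_regular n" "\<And>g. g \<in> GL n \<Longrightarrow> mat_inv g $$ (i, j) = c g"
    using GL_regular_mat_inv[OF assms] by blast
  show ?thesis by (rule regular_poly_coeff[OF c(1)]) (rule c(2))
qed

lemma regular_poly_gl_var: "regular_poly n (\<lambda>g. gl_var n g v)"
proof (cases rule: var_cases[of v n])
  case 1
  show ?thesis unfolding gl_var_simps(1)[OF 1]
    by (intro regular_poly_sum regular_poly_mult regular_poly_const regular_poly_coeff[OF GL_regular.entry]) (use 1 in auto)
next
  case (2 u)
  show ?thesis unfolding 2(2) gl_var_simps(2)[OF 2(1)]
    by (intro regular_poly_sum regular_poly_mult regular_poly_const regular_poly_mat_inv) (use 2 in auto)
next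
  case 3
  then show ?thesis by (simp add: gl_var_simps regular_poly_const)
qed

lemma regular_poly_subst_gl: "regular_poly n (\<lambda>g. subst_gl n g P)"
  by (induction P rule: mpoly_Var_induct[OF poly_over_UNIV])
     (simp_all add: regular_poly_const regular_poly_add regular_poly_mult regular_poly_gl_var)

lemma regular_poly_tens: "J \<in> idx n p \<Longrightarrow> I \<in> idx n p \<Longrightarrow> regular_poly n (\<lambda>g. Const (tens (mat_inv g) J I))"
proof (induction rule: idx_induct2)
  case Nil
  then show ?case by (simp add: regular_poly_const)
next
  case (Cons p j J i I)
  then show ?case by (simp add: regular_poly_mult regular_poly_mat_inv)
qed

lemma regular_num_sum:
  assumes "finite A" "\<And>i. i \<in> A \<Longrightarrow> regular_num n (F i)"
  shows "regular_num n (\<lambda>g I. \<Sum>i\<in>A. F i g I)"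
  using assms
proof (induction A rule: finite_induct)
  case empty
  show ?case unfolding regular_num_def by (intro exI[of _ "[]"]) auto
next
  case (insert i A)
  then have "regular_num n (F i)" "regular_num n (\<lambda>g I. \<Sum>i\<in>A. F i g I)" by auto
  then obtain L L' where "\<forall>(c, E)\<in>set L. c \<in> GL_regular n" "\<forall>g\<in>GL n. F i g = (\<lambda>I. \<Sum>(c, E)\<leftarrow>L. Const (c g) * E I)"
    "\<forall>(c, E)\<in>set L'. c \<in> GL_regular n" "\<forall>g\<in>GL n. (\<lambda>I. \<Sum>i\<in>A. F i g I) = (\<lambda>I. \<Sum>(c, E)\<leftarrow>L'. Const (c g) * E I)"
    unfolding regular_num_def by blast
  then show ?case unfolding regular_num_def
    using insert.hyps by (intro exI[of _ "L @ L'"]) (auto simp: fun_eq_iff)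
qed

lemma regular_num_single:
  assumes "regular_poly n F"
  shows "regular_num n (\<lambda>g I. if I = I0 then F g else 0)"
proof -
  obtain L where L: "\<forall>(c, e)\<in>set L. c \<in> GL_regular n" "\<forall>g\<in>GL n. F g = (\<Sum>(c, e)\<leftarrow>L. Const (c g) * e)"
    using assms unfolding regular_poly_def by blast
  have "(\<Sum>(c, E)\<leftarrow>map (\<lambda>(c, e). (c, \<lambda>I. if I = I0 then e else 0)) L. Const (c g) * E I) =
      (if I = I0 then \<Sum>(c, e)\<leftarrow>L. Const (c g) * e else 0)" for g I
    by (induction L) auto
  then show ?thesis unfolding regular_num_def
    using L by (intro exI[of _ "map (\<lambda>(c, e). (c, \<lambda>I. if I = I0 then e else 0)) L"]) (auto simp: fun_eq_iff)
qed

lemma regular_num_gl_num: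
  assumes \<Phi>: "\<Phi> \<in> numerators n p r"
  shows "regular_num n (\<lambda>g. gl_num n g \<Phi>)"
proof -
  have "regular_poly n (\<lambda>g. gl_num n g \<Phi> I)" if "I \<in> idx n p" for I
    unfolding gl_num_idx[OF that]
    by (intro regular_poly_sum regular_poly_mult regular_poly_tens regular_poly_subst_gl) (use that in auto)
  then have "regular_num n (\<lambda>g I. \<Sum>I0\<in>idx n p. if I = I0 then gl_num n g \<Phi> I0 else 0)"
    by (intro regular_num_sum regular_num_single finite_idx)
  moreover have "(\<lambda>g I. \<Sum>I0\<in>idx n p. if I = I0 then gl_num n g \<Phi> I0 else 0) = (\<lambda>g. gl_num n g \<Phi>)"
  proof (intro ext)
    fix g I
    show "(\<Sum>I0\<in>idx n p. if I = I0 then gl_num n g \<Phi> I0 else 0) = gl_num n g \<Phi> I"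
      using gl_num_not_idx[of I n p \<Phi> g] numeratorsD(5)[OF \<Phi>] by (cases "I \<in> idx n p") auto
  qed
  ultimately show ?thesis by simp
qed

text \<open>The expansion in \<open>fam\<close> may use vectors outside \<open>W\<close>, whereas
  rationality asks for vectors of \<open>W\<close>. The span of the orbit of \<open>w\<close> is
  finite-dimensional and lies in \<open>W\<close>; a basis of it is extended to the whole space, and
  the coordinates of the given expansion are again regular functions.\<close>

lemma (in vector_space) gl_rationalI:
  fixes \<rho> :: "'a mat \<Rightarrow> 'b \<Rightarrow> 'b"
  assumes W: "gl_submodule n scale \<rho> W"
    and fam: "\<And>w. w \<in> W \<Longrightarrow> \<exists>L. (\<forall>(c, e)\<in>set L. c \<in> GL_regular n) \<and>
      (\<forall>g\<in>GL n. \<rho> g w = (\<Sum>(c, e)\<leftarrow>L. scale (c g) e))"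
  shows "gl_rational n scale \<rho> W"
  unfolding gl_rational_def
proof (intro conjI ballI W)
  fix w assume w: "w \<in> W"
  obtain L where L: "\<forall>(c, e)\<in>set L. c \<in> GL_regular n" "\<forall>g\<in>GL n. \<rho> g w = (\<Sum>(c, e)\<leftarrow>L. scale (c g) e)"
    using fam[OF w] by blast
  define U where "U = span ((\<lambda>g. \<rho> g w) ` GL n)"
  have UW: "U \<subseteq> W"
    unfolding U_def using W w by (intro span_minimal) (auto simp: gl_submodule_def)
  have "(\<Sum>(c, e)\<leftarrow>L'. scale (c g) e) \<in> span (snd ` set L)" if "set L' \<subseteq> set L" for g L'
    using that
  proof (induction L')
    case (Cons x L')
    then have "snd x \<in> span (snd ` set L)" by (intro span_base) auto
    then show ?case using Cons by (auto simp: case_prod_beta intro!: span_add span_scale)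
  qed (simp add: span_zero)
  then have "U \<subseteq> span (snd ` set L)"
    unfolding U_def using L(2) by (intro span_minimal subspace_span) auto
  then obtain B where B: "finite B" "B \<subseteq> U" "U = span B" "independent B"
    using finite_spanning_subset[of U "snd ` set L"] unfolding U_def by auto
  let ?C = "extend_basis B"
  have C: "independent ?C" "span ?C = UNIV" "B \<subseteq> ?C"
    using B(4) by (auto simp: independent_extend_basis span_extend_basis extend_basis_superset)
  define c where "c b = (\<lambda>g. \<Sum>(c, e)\<leftarrow>L. c g * representation ?C e b)" for b
  have rep: "representation ?C (\<Sum>(c, e)\<leftarrow>L'. scale (c g) e) b = (\<Sum>(c, e)\<leftarrow>L'. c g * representation ?C e b)"
    for L' :: "(('a mat \<Rightarrow> 'a) \<times> 'b) list" and g b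
    by (induction L') (auto simp: representation_zero representation_add representation_scale C)
  have "c b \<in> GL_regular n" for b
  proof -
    have "(\<lambda>g. \<Sum>x\<leftarrow>L. fst x g * representation ?C (snd x) b) \<in> GL_regular n"
      by (rule GL_regular_sum_list) (use L(1) in \<open>auto intro!: GL_regular.mult GL_regular.const\<close>)
    then show ?thesis by (simp add: c_def case_prod_unfold)
  qed
  moreover have "\<rho> g w = (\<Sum>b\<in>B. scale (c b g) b)" if g: "g \<in> GL n" for g
  proof -
    have x: "\<rho> g w \<in> span B" using g B(3) unfolding U_def by (auto intro: span_base)
    have "\<rho> g w = (\<Sum>b\<in>B. scale (representation B (\<rho> g w) b) b)"
      using sum_representation_eq[OF B(4) x B(1) subset_refl] by simp
    also have "representation B (\<rho> g w) = representation ?C (\<rho> g w)"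
      using representation_extend[OF C(1) x C(3)] by simp
    also have "representation ?C (\<rho> g w) = (\<lambda>b. c b g)"
      using L(2) g rep by (simp add: c_def fun_eq_iff)
    finally show ?thesis .
  qed
  ultimately show "\<exists>B c. finite B \<and> B \<subseteq> W \<and> (\<forall>b\<in>B. c b \<in> GL_regular n) \<and>
      (\<forall>g\<in>GL n. \<rho> g w = (\<Sum>b\<in>B. scale (c b g) b))"
    using B(1,2) UW by (intro exI[of _ B] exI[of _ c]) auto
qed

section \<open>The module of forms\<close>

context
  fixes n p :: nat
  assumes n: "n \<ge> 1" and p: "p \<le> n - 1"
begin

interpretation forms: vector_space "form_scale :: 'k::field_char_0 \<Rightarrow> 'k form \<Rightarrow> 'k form"
  by (rule vector_space_form_scale)

text \<open>A level consists of the exponent of the denominator and a bound on the total degree. The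
  exponent fixes only the degree in the dual variables; the bound makes the space
  finite-dimensional.\<close>

definition bounded_forms :: "nat \<times> nat \<Rightarrow> 'k::field_char_0 form set" where
  "bounded_forms j = frac_form n (fst j) `
     {\<Phi> \<in> numerators n p (fst j). \<forall>I. \<forall>m\<in>keys (\<Phi> I). total_degree n m \<le> snd j}"

text \<open>Depends on the exponent of the denominator, since enlarging it multiplies the numerators
  by powers of \<open>zz_dual\<close>; this is why the locale has one form per level.\<close>

definition form_pair :: "nat \<times> nat \<Rightarrow> 'k::field_char_0 form \<Rightarrow> 'k form \<Rightarrow> 'k" where
  "form_pair j \<omega> \<eta> = num_pair n p (numer n (fst j) \<omega>) (numer n (fst j) \<eta>)"

lemma frac_form_0: "frac_form n r (\<lambda>I. 0) = (0 :: 'k::field_char_0 form)"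
  using zz_dual_neq_0[OF n, where 'k = 'k] by (simp add: frac_form_def fun_eq_iff Zero_fract_def eq_fract)

lemma bounded_formsE:
  assumes "\<omega> \<in> bounded_forms (r, N)"
  obtains \<Phi> where "\<Phi> \<in> numerators n p r" "\<forall>I. \<forall>m\<in>keys (\<Phi> I). total_degree n m \<le> N" "\<omega> = frac_form n r \<Phi>"
  using assms by (auto simp: bounded_forms_def)

lemma bounded_forms_ex: "\<omega> \<in> bounded_forms (r, N) \<Longrightarrow> \<exists>\<Phi>. \<Phi> \<in> numerators n p r \<and> \<omega> = frac_form n r \<Phi>"
  by (auto simp: bounded_forms_def)

lemma bounded_formsI:
  "\<Phi> \<in> numerators n p r \<Longrightarrow> (\<And>I m. m \<in> keys (\<Phi> I) \<Longrightarrow> total_degree n m \<le> N) \<Longrightarrow> frac_form n r \<Phi> \<in> bounded_forms (r, N)"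
  by (auto simp: bounded_forms_def)

lemma bounded_forms_subset: "bounded_forms j \<subseteq> (jouanolou_forms n p :: 'k::field_char_0 form set)"
  using frac_form_mem[OF n] by (auto simp: bounded_forms_def)

lemma bounded_forms_submodule: "gl_submodule n form_scale (gl_form n) (bounded_forms j :: 'k::field_char_0 form set)"
proof -
  obtain r N where j: "j = (r, N)" by (cases j)
  have "(0 :: 'k form) \<in> bounded_forms (r, N)"
    unfolding frac_form_0[of r, symmetric] by (rule bounded_formsI[OF numerators_zero]) simp
  moreover have "\<omega> + \<eta> \<in> bounded_forms (r, N)" if \<omega>: "\<omega> \<in> bounded_forms (r, N)" and \<eta>: "\<eta> \<in> bounded_forms (r, N)"
    for \<omega> \<eta> :: "'k form"
  proof -
    obtain \<Phi> where \<Phi>: "\<Phi> \<in> numerators n p r" "\<forall>I. \<forall>m\<in>keys (\<Phi> I). total_degree n m \<le> N" "\<omega> = frac_form n r \<Phi>"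
      by (rule bounded_formsE[OF \<omega>])
    obtain \<Psi> where \<Psi>: "\<Psi> \<in> numerators n p r" "\<forall>I. \<forall>m\<in>keys (\<Psi> I). total_degree n m \<le> N" "\<eta> = frac_form n r \<Psi>"
      by (rule bounded_formsE[OF \<eta>])
    have "total_degree n m \<le> N" if m: "m \<in> keys (\<Phi> I + \<Psi> I)" for I m
    proof -
      have "m \<in> keys (\<Phi> I) \<or> m \<in> keys (\<Psi> I)" using m keys_add[of "\<Phi> I" "\<Psi> I"] by blast
      then show ?thesis using \<Phi>(2) \<Psi>(2) by blast
    qed
    then have "frac_form n r (\<lambda>I. \<Phi> I + \<Psi> I) \<in> bounded_forms (r, N)"
      by (rule bounded_formsI[OF numerators_add[OF \<Phi>(1) \<Psi>(1)]])
    then show ?thesis by (simp add: frac_form_add[OF n] \<Phi>(3) \<Psi>(3))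
  qed
  moreover have "form_scale c \<omega> \<in> bounded_forms (r, N)" if \<omega>: "\<omega> \<in> bounded_forms (r, N)" for c and \<omega> :: "'k form"
  proof -
    obtain \<Phi> where \<Phi>: "\<Phi> \<in> numerators n p r" "\<forall>I. \<forall>m\<in>keys (\<Phi> I). total_degree n m \<le> N" "\<omega> = frac_form n r \<Phi>"
      by (rule bounded_formsE[OF \<omega>])
    have "frac_form n r (\<lambda>I. Const c * \<Phi> I) \<in> bounded_forms (r, N)"
      using \<Phi>(2) by (intro bounded_formsI numerators_Const_mult \<Phi>) (auto simp: in_keys_iff)
    then show ?thesis by (simp add: frac_form_scale[OF n] \<Phi>(3))
  qed
  moreover have "gl_form n g \<omega> \<in> bounded_forms (r, N)" if g: "g \<in> GL n" and \<omega>: "\<omega> \<in> bounded_forms (r, N)" for g and \<omega> :: "'k form"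
  proof -
    obtain \<Phi> where \<Phi>: "\<Phi> \<in> numerators n p r" "\<forall>I. \<forall>m\<in>keys (\<Phi> I). total_degree n m \<le> N" "\<omega> = frac_form n r \<Phi>"
      by (rule bounded_formsE[OF \<omega>])
    have "total_degree n m \<in> {..N}" if "m \<in> keys (gl_num n g \<Phi> I)" for I m
      by (rule gl_num_preserves[OF total.grading_axioms hom_gl_var(2) _ that]) (use \<Phi>(2) in auto)
    then have "frac_form n r (gl_num n g \<Phi>) \<in> bounded_forms (r, N)"
      by (intro bounded_formsI gl_num_numerators \<Phi>) auto
    then show ?thesis by (simp add: gl_form_frac_form[OF n g] \<Phi>(3))
  qed
  ultimately show ?thesis unfolding j gl_submodule_def forms.subspace_def by blast
qed

text \<open>Numerator and denominator are multiplied by \<open>zz_dual n ^ k\<close>, of total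
  degree \<open>2 * k\<close>. Different exponents can thus be made equal, which gives
  directedness.\<close>

lemma bounded_forms_shift: "(bounded_forms (r, N) :: 'k::field_char_0 form set) \<subseteq> bounded_forms (k + r, k * 2 + N)"
proof
  fix \<omega> :: "'k form" assume \<omega>: "\<omega> \<in> bounded_forms (r, N)"
  obtain \<Phi> where \<Phi>: "\<Phi> \<in> numerators n p r" "\<forall>I. \<forall>m\<in>keys (\<Phi> I). total_degree n m \<le> N" "\<omega> = frac_form n r \<Phi>"
    by (rule bounded_formsE[OF \<omega>])
  have single: "total_degree n (single v 1) = 1" if "v < 2 * n" for v
    using that by (simp add: total_degree_def lookup_single when_def)
  have "total.hom n 2 (zz_dual n :: 'k mpoly)"
    unfolding zz_dual_def
  proof (intro total.hom_sum)
    fix i assume "i \<in> {..<n}"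
    then have "total_degree n (single i 1) + total_degree n (single (n + i) 1) = 2"
      using single[of i] single[of "n + i"] by simp
    then show "total.hom n 2 (Var i * Var (n + i) :: 'k mpoly)"
      using total.hom_mult[OF total.hom_Var total.hom_Var, of n i "n + i"] by metis
  qed
  then have q: "total.hom n (\<Sum>i<k. 2) (\<Prod>i<k. zz_dual n :: 'k mpoly)" by (intro total.hom_prod)
  have "total_degree n m \<le> k * 2 + N" if "m \<in> keys (zz_dual n ^ k * \<Phi> I)" for I m
  proof -
    obtain a b where ab: "a \<in> keys (zz_dual n ^ k :: 'k mpoly)" "b \<in> keys (\<Phi> I)" "m = a + b"
      using \<open>m \<in> keys (zz_dual n ^ k * \<Phi> I)\<close> keys_mult by blast
    then have "total_degree n a = k * 2" using q by (simp add: total.hom_def)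
    then show ?thesis using ab(3) \<Phi>(2)[rule_format, OF ab(2)] by (simp add: total.deg_add)
  qed
  then have "frac_form n (k + r) (\<lambda>I. zz_dual n ^ k * \<Phi> I) \<in> bounded_forms (k + r, k * 2 + N)"
    by (intro bounded_formsI numerators_hom_mult \<Phi> zz_dual_hom)
  then show "\<omega> \<in> bounded_forms (k + r, k * 2 + N)" by (simp add: frac_form_shift[OF n] \<Phi>(3))
qed

lemma bounded_forms_mono: "N \<le> N' \<Longrightarrow> bounded_forms (r, N) \<subseteq> bounded_forms (r, N')"
  unfolding bounded_forms_def by fastforce

lemma bounded_forms_directed:
  "finite X \<Longrightarrow> X \<subseteq> (jouanolou_forms n p :: 'k::field_char_0 form set) \<Longrightarrow> \<exists>j. X \<subseteq> bounded_forms j"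
proof (induction X rule: finite_induct)
  case (insert \<omega> X)
  then obtain r N where X: "X \<subseteq> bounded_forms (r, N)" by auto
  obtain r' \<Phi> where \<Phi>: "\<Phi> \<in> numerators n p r'" "\<omega> = frac_form n r' \<Phi>"
    using jouanolou_forms_frac_form[OF n] insert.prems by blast
  define N' where "N' = Max (insert 0 (total_degree n ` (\<Union>I\<in>idx n p. keys (\<Phi> I))))"
  have "total_degree n m \<le> N'" if "m \<in> keys (\<Phi> I)" for I m
    unfolding N'_def using that sum_wt(2)[OF \<Phi>(1) that] by (intro Max_ge) auto
  then have "\<omega> \<in> bounded_forms (r', N')" unfolding \<Phi>(2) by (intro bounded_formsI \<Phi>(1))
  then have "\<omega> \<in> bounded_forms (r + r', r * 2 + N')" using bounded_forms_shift by blast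
  moreover have "X \<subseteq> bounded_forms (r + r', r' * 2 + N)"
    using X bounded_forms_shift[of r N r'] by (simp add: add.commute) blast
  ultimately have "insert \<omega> X \<subseteq> bounded_forms (r + r', max (r * 2 + N') (r' * 2 + N))"
    using bounded_forms_mono[of "r * 2 + N'" "max (r * 2 + N') (r' * 2 + N)" "r + r'"]
      bounded_forms_mono[of "r' * 2 + N" "max (r * 2 + N') (r' * 2 + N)" "r + r'"] by auto
  then show ?case by blast
qed auto

text \<open>The spanning vectors have a single monomial in a single component; they need not be
  antisymmetric or lie in the module.\<close>

lemma bounded_forms_finite:
  "\<exists>E. finite E \<and> (bounded_forms j :: 'k::field_char_0 form set) \<subseteq> forms.span E"
proof -
  obtain r N where j: "j = (r, N)" by (cases j)
  define Mon where "Mon = {m :: nat \<Rightarrow>\<^sub>0 nat. keys m \<subseteq> {..<2 * n} \<and> total_degree n m \<le> N}"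
  have "finite Mon"
  proof (rule inj_on_finite[where f = "\<lambda>m. restrict (lookup m) {..<2 * n}" and B = "PiE {..<2 * n} (\<lambda>_. {..N})"])
    show "inj_on (\<lambda>m. restrict (lookup m) {..<2 * n}) Mon"
    proof (rule inj_onI, rule poly_mapping_eqI)
      fix m m' v assume m: "m \<in> Mon" "m' \<in> Mon" and eq: "restrict (lookup m) {..<2 * n} = restrict (lookup m') {..<2 * n}"
      show "lookup m v = lookup m' v"
      proof (cases "v < 2 * n")
        case True
        then show ?thesis using fun_cong[OF eq, of v] by simp
      next
        case False
        then have "v \<notin> keys m" "v \<notin> keys m'" using m by (auto simp: Mon_def)
        then show ?thesis by (simp add: in_keys_iff)
      qed
    qed
    show "(\<lambda>m. restrict (lookup m) {..<2 * n}) ` Mon \<subseteq> PiE {..<2 * n} (\<lambda>_. {..N})"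
    proof -
      have "lookup m v \<le> N" if "v < 2 * n" "m \<in> Mon" for m v
      proof -
        have "lookup m v \<le> total_degree n m"
          unfolding total_degree_def using that(1) by (intro member_le_sum) auto
        then show ?thesis using that(2) by (simp add: Mon_def)
      qed
      then show ?thesis by (intro image_subsetI PiE_I) auto
    qed
  qed (auto intro: finite_PiE)
  define e where "e = (\<lambda>(I0, m). frac_form n r (\<lambda>I. if I = I0 then single m (1 :: 'k) else 0))"
  let ?E = "e ` (idx n p \<times> Mon)"
  have "\<omega> \<in> forms.span ?E" if \<omega>: "\<omega> \<in> bounded_forms (r, N)" for \<omega> :: "'k form"
  proof -
    obtain \<Phi> where \<Phi>: "\<Phi> \<in> numerators n p r" "\<forall>I. \<forall>m\<in>keys (\<Phi> I). total_degree n m \<le> N" "\<omega> = frac_form n r \<Phi>"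
      by (rule bounded_formsE[OF \<omega>])
    have sum: "frac_form n r (\<lambda>I. \<Sum>x\<in>A. f x I) = (\<Sum>x\<in>A. frac_form n r (f x))" if "finite A"
      for A and f :: "nat list \<times> (nat \<Rightarrow>\<^sub>0 nat) \<Rightarrow> nat list \<Rightarrow> 'k mpoly"
      using that by (induction A rule: finite_induct) (simp_all add: frac_form_0 frac_form_add[OF n])
    have keys: "keys (\<Phi> I) \<subseteq> Mon" for I
      using \<Phi>(2) numeratorsD(3)[OF \<Phi>(1), of I] by (auto simp: Mon_def poly_zzd_def)
    have eq: "\<Phi> I = (\<Sum>(I0, m)\<in>idx n p \<times> Mon. Const (lookup (\<Phi> I0) m) * (if I = I0 then single m 1 else 0))" for I
    proof -
      have "(\<Sum>(I0, m)\<in>idx n p \<times> Mon. Const (lookup (\<Phi> I0) m) * (if I = I0 then single m 1 else 0)) =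
          (\<Sum>I0\<in>idx n p. if I = I0 then \<Sum>m\<in>Mon. single m (lookup (\<Phi> I) m) else 0)"
        unfolding sum.cartesian_product[symmetric]
        by (intro sum.cong refl) (auto simp: Const_def mult_single intro!: sum.cong)
      also have "\<dots> = (if I \<in> idx n p then \<Sum>m\<in>Mon. single m (lookup (\<Phi> I) m) else 0)" by simp
      also have "(\<Sum>m\<in>Mon. single m (lookup (\<Phi> I) m)) = (\<Sum>m\<in>keys (\<Phi> I). single m (lookup (\<Phi> I) m))"
        by (rule sum.mono_neutral_right) (use \<open>finite Mon\<close> keys in \<open>auto simp: in_keys_iff\<close>)
      finally show ?thesis using numeratorsD(5)[OF \<Phi>(1), of I] by (simp add: poly_mapping_sum_single)
    qed
    have "\<Phi> = (\<lambda>I. \<Sum>x\<in>idx n p \<times> Mon. Const (lookup (\<Phi> (fst x)) (snd x)) * (if I = fst x then single (snd x) 1 else 0))"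
    proof
      fix I
      show "\<Phi> I = (\<Sum>x\<in>idx n p \<times> Mon. Const (lookup (\<Phi> (fst x)) (snd x)) * (if I = fst x then single (snd x) 1 else 0))"
        by (rule trans[OF eq]) (simp only: case_prod_unfold)
    qed
    then have "\<omega> = frac_form n r (\<lambda>I. \<Sum>x\<in>idx n p \<times> Mon. Const (lookup (\<Phi> (fst x)) (snd x)) * (if I = fst x then single (snd x) 1 else 0))"
      unfolding \<Phi>(3) by (rule arg_cong[of _ _ "frac_form n r"])
    also have "\<dots> = (\<Sum>x\<in>idx n p \<times> Mon. form_scale (lookup (\<Phi> (fst x)) (snd x)) (e x))"
      using \<open>finite Mon\<close> by (simp only: sum finite_cartesian_product finite_idx frac_form_scale[OF n] e_def case_prod_beta)
    also have "\<dots> \<in> forms.span ?E"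
      by (intro forms.span_sum forms.span_scale forms.span_base) auto
    finally show ?thesis .
  qed
  then show ?thesis using \<open>finite Mon\<close> unfolding j by (intro exI[of _ ?E]) auto
qed

lemma hw_vector_frac_form:
  "hw_vector n form_scale (gl_form n) \<alpha> (frac_form n r \<Phi> :: 'k::field_char_0 form) \<longleftrightarrow>
     dominant_weight n \<alpha> \<and> \<Phi> \<noteq> (\<lambda>I. 0) \<and> num_hw n \<alpha> \<Phi>"
proof -
  note inj = inj_frac_form[OF n, of r, where 'k = 'k]
  have "frac_form n r \<Phi> = (0 :: 'k form) \<longleftrightarrow> \<Phi> = (\<lambda>I. 0)"
    unfolding frac_form_0[of r, symmetric] by (rule inj_eq[OF inj])
  moreover have "gl_form n g (frac_form n r \<Phi>) = form_scale (\<Prod>i<n. (g $$ (i, i)) powi (\<alpha> ! i)) (frac_form n r \<Phi>) \<longleftrightarrow>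
      gl_num n g \<Phi> = (\<lambda>I. Const (character n \<alpha> g) * \<Phi> I)" if "g \<in> GL n" for g :: "'k mat"
    unfolding gl_form_frac_form[OF n that] frac_form_scale[OF n, symmetric] character_def by (rule inj_eq[OF inj])
  ultimately show ?thesis by (auto simp: hw_vector_def num_hw_def)
qed

text \<open>It suffices to look at the elements of \<open>W\<close> with one fixed denominator, that
  of some nonzero element; their numerators form a stable space.\<close>

lemma hw_vector_form_exists:
  assumes W: "gl_submodule n form_scale (gl_form n) W" "W \<subseteq> (jouanolou_forms n p :: 'k::field_char_0 form set)" "W \<noteq> {0}"
  shows "\<exists>\<alpha>. \<exists>w\<in>W. hw_vector n form_scale (gl_form n) \<alpha> w"
proof -
  have sub: "forms.subspace W" using W(1) by (simp add: gl_submodule_def)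
  then obtain \<omega> where \<omega>: "\<omega> \<in> W" "\<omega> \<noteq> 0" using W(3) forms.subspace_0 by blast
  obtain r \<Phi> where \<Phi>: "\<Phi> \<in> numerators n p r" "\<omega> = frac_form n r \<Phi>"
    using jouanolou_forms_frac_form[OF n] \<omega>(1) W(2) by blast
  define V where "V = {\<Phi> \<in> numerators n p r. frac_form n r \<Phi> \<in> W}"
  have "num_stable n V"
    unfolding num_stable_def V_def using sub W(1)
    by (auto simp: numerators_add numerators_Const_mult gl_num_numerators frac_form_add[OF n] frac_form_scale[OF n]
        gl_form_frac_form[OF n, symmetric] forms.subspace_add forms.subspace_scale gl_submodule_def)
  moreover have "\<Phi> \<in> V" "\<Phi> \<noteq> (\<lambda>I. 0)" using \<Phi> \<omega> frac_form_0[of r, where 'k = 'k] by (auto simp: V_def)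
  ultimately obtain \<alpha> \<Psi> where \<Psi>: "\<Psi> \<in> V" "\<Psi> \<noteq> (\<lambda>I. 0)" "dominant_weight n \<alpha>" "num_hw n \<alpha> \<Psi>"
    using num_hw_exists[of V n p r \<Phi>] by (auto simp: V_def)
  then have "hw_vector n form_scale (gl_form n) \<alpha> (frac_form n r \<Psi>)" by (simp add: hw_vector_frac_form)
  then show ?thesis using \<Psi>(1) by (auto simp: V_def)
qed

lemma hw_vector_form_unique:
  assumes v: "v \<in> jouanolou_forms n p" "hw_vector n form_scale (gl_form n) \<alpha> (v :: 'k::field_char_0 form)"
    and w: "w \<in> jouanolou_forms n p" "hw_vector n form_scale (gl_form n) \<alpha> w"
  shows "\<exists>c. w = form_scale c v"
proof -
  obtain r N where vw: "v \<in> bounded_forms (r, N)" "w \<in> bounded_forms (r, N)"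
    using bounded_forms_directed[of "{v, w}"] v w by auto
  obtain \<Phi> where \<Phi>: "\<Phi> \<in> numerators n p r" "v = frac_form n r \<Phi>" using bounded_forms_ex[OF vw(1)] by blast
  obtain \<Psi> where \<Psi>: "\<Psi> \<in> numerators n p r" "w = frac_form n r \<Psi>" using bounded_forms_ex[OF vw(2)] by blast
  obtain c where "\<Psi> = (\<lambda>I. Const c * \<Phi> I)"
    using \<Phi> \<Psi> num_hw_unique[OF n \<Phi>(1), of \<alpha> \<Psi>] v(2) w(2) by (auto simp: hw_vector_frac_form)
  then show ?thesis using \<Phi>(2) \<Psi>(2) frac_form_scale[OF n] by blast
qed

lemma integral_poly_zz_dual_power_cancel: "integral_poly (zz_dual n ^ k * P) \<Longrightarrow> integral_poly P"
  by (induction k) (auto simp: mult.assoc dest: integral_poly_zz_dual_cancel[OF n])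

text \<open>Up to a scalar a highest weight vector has an integral numerator, so its square is a positive integer.\<close>
lemma form_pair_anisotropic:
  assumes w: "w \<in> bounded_forms j" "hw_vector n form_scale (gl_form n) \<alpha> (w :: 'k::field_char_0 form)"
  shows "form_pair j w w \<noteq> 0"
proof -
  obtain r N where j: "j = (r, N)" by (cases j)
  obtain \<Phi> where \<Phi>: "\<Phi> \<in> numerators n p r" "w = frac_form n r \<Phi>" using bounded_forms_ex w(1) unfolding j by blast
  have hw: "dominant_weight n \<alpha>" "\<Phi> \<noteq> (\<lambda>I. 0)" "num_hw n \<alpha> \<Phi>" using w(2) by (auto simp: \<Phi>(2) hw_vector_frac_form)
  have "interlaces n p \<alpha>" by (rule num_hw_interlaces[OF n p hw(1) \<Phi>(1) hw(3,2)])
  then obtain b x y where V_hw: "num_hw n \<alpha> (hw_num n p b x y :: nat list \<Rightarrow> 'k mpoly)"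
    using interlaces_hw_num[OF n p] by blast
  let ?V = "hw_num n p b x y :: nat list \<Rightarrow> 'k mpoly"
  define r0 where "r0 = y + p + 1"
  have V: "?V \<in> numerators n p r0" "?V \<noteq> (\<lambda>I. 0)"
    using hw_num_numerators[OF n p] hw_num_nonzero[OF n p] unfolding r0_def by (blast, metis)
  \<comment> \<open>Both vectors are written over the exponent \<open>r + r0\<close>, where
    proportional forms have proportional numerators.\<close>
  have eqs: "frac_form n (r0 + r) (\<lambda>I. zz_dual n ^ r0 * \<Phi> I) = frac_form n r \<Phi>"
    "frac_form n (r + r0) (\<lambda>I. zz_dual n ^ r * ?V I) = frac_form n r0 ?V"
    by (rule frac_form_shift[OF n])+
  have "hw_vector n form_scale (gl_form n) \<alpha> (frac_form n r0 ?V)" using V V_hw hw(1) by (simp add: hw_vector_frac_form)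
  then obtain c where c: "frac_form n r0 ?V = form_scale c (frac_form n r \<Phi>)"
    using hw_vector_form_unique[OF frac_form_mem[OF n \<Phi>(1)] _ frac_form_mem[OF n V(1)]] w(2) \<Phi>(2) by blast
  have "frac_form n (r + r0) (\<lambda>I. zz_dual n ^ r * ?V I) = frac_form n (r + r0) (\<lambda>I. Const c * (zz_dual n ^ r0 * \<Phi> I))"
    using c eqs by (simp add: frac_form_scale[OF n] add.commute)
  then have eq: "zz_dual n ^ r * ?V I = Const c * (zz_dual n ^ r0 * \<Phi> I)" for I
    using inj_frac_form[OF n] by (metis injD)
  have c0: "c \<noteq> 0"
  proof
    assume "c = 0"
    then have "?V I = 0" for I using eq[of I] zz_dual_neq_0[OF n, where 'k = 'k] by simp
    then show False using V(2) by blast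
  qed
  \<comment> \<open>The multiple \<open>c\<close> of \<open>\<Phi>\<close> becomes the integral
    \<open>zz_dual n ^ r * ?V I\<close> after multiplication by a power of \<open>zz_dual\<close>,
    which Gauss' lemma cancels.\<close>
  have "integral_poly (Const c * \<Phi> I)" for I
  proof (rule integral_poly_zz_dual_power_cancel[where k = r0])
    have "integral_poly (zz_dual n ^ r * ?V I)"
      by (intro integral_poly_mult integral_poly_power integral_zz_dual integral_hw_num)
    then show "integral_poly (zz_dual n ^ r0 * (Const c * \<Phi> I))" unfolding eq by (simp add: mult_ac)
  qed
  moreover obtain I0 where "\<Phi> I0 \<noteq> 0" using hw(2) by blast
  moreover from this have "I0 \<in> idx n p" "Const c * \<Phi> I0 \<noteq> 0"
    using numeratorsD(5)[OF \<Phi>(1)] c0 by (auto simp: Const_eq_0_iff)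
  ultimately have "num_pair n p (\<lambda>I. Const c * \<Phi> I) (\<lambda>I. Const c * \<Phi> I) \<noteq> 0"
    using num_pair_self[OF n, of "\<lambda>I. Const c * \<Phi> I" I0 p] by blast
  moreover have "num_pair n p (\<lambda>I. Const c * \<Phi> I) (\<lambda>I. Const c * \<Phi> I) = c * (c * num_pair n p \<Phi> \<Phi>)"
    by (simp add: num_pair_def poly_pair_Const_left poly_pair_Const_right sum_distrib_left)
  ultimately show ?thesis by (auto simp: form_pair_def j \<Phi>(2) numer_frac_form[OF n])
qed

lemma forms_contravariant_module:
  "contravariant_module (form_scale :: 'k::field_char_0 \<Rightarrow> _) n (gl_form n) (jouanolou_forms n p) bounded_forms form_pair"
proof (intro contravariant_module.intro contravariant_module_axioms.intro vector_space_form_scale)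
  have K: "\<exists>j. {v, w} \<subseteq> bounded_forms j" if "v \<in> jouanolou_forms n p" "w \<in> jouanolou_forms n p" for v w :: "'k form"
    using bounded_forms_directed[of "{v, w}"] that by simp
  have sub': "gl_submodule n form_scale (gl_form n) (bounded_forms j :: 'k form set)" for j
    by (rule bounded_forms_submodule)
  then have sub: "forms.subspace (bounded_forms j :: 'k form set)" for j
    by (simp add: gl_submodule_def)
  show "gl_submodule n form_scale (gl_form n) (jouanolou_forms n p :: 'k form set)"
    unfolding gl_submodule_def forms.subspace_def
  proof (intro conjI ballI allI)
    show "(0 :: 'k form) \<in> jouanolou_forms n p" using forms.subspace_0[OF sub] bounded_forms_subset by blast
    fix v w :: "'k form" assume vw: "v \<in> jouanolou_forms n p" "w \<in> jouanolou_forms n p"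
    obtain j where "v \<in> bounded_forms j" "w \<in> bounded_forms j" using K[OF vw] by auto
    then have "v + w \<in> bounded_forms j" by (rule forms.subspace_add[OF sub])
    then show "v + w \<in> jouanolou_forms n p" by (rule subsetD[OF bounded_forms_subset])
  next
    fix c and v :: "'k form" assume v: "v \<in> jouanolou_forms n p"
    obtain j where "v \<in> bounded_forms j" using K[OF v v] by auto
    then have "form_scale c v \<in> bounded_forms j" by (rule forms.subspace_scale[OF sub])
    then show "form_scale c v \<in> jouanolou_forms n p" by (rule subsetD[OF bounded_forms_subset])
  next
    fix g :: "'k mat" and v :: "'k form" assume g: "g \<in> GL n" and v: "v \<in> jouanolou_forms n p"
    obtain j where "v \<in> bounded_forms j" using K[OF v v] by auto
    then have "gl_form n g v \<in> bounded_forms j"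
      using sub'[of j] g by (simp add: gl_submodule_def)
    then show "gl_form n g v \<in> jouanolou_forms n p" by (rule subsetD[OF bounded_forms_subset])
  qed
  fix g :: "'k mat" assume g: "g \<in> GL n"
  show "transpose_mat g \<in> GL n" by (rule GL_transpose(1)[OF g])
  fix c and v w :: "'k form"
  {
    assume "v \<in> jouanolou_forms n p" "w \<in> jouanolou_forms n p"
    then obtain j where "{v, w} \<subseteq> bounded_forms j" using K by blast
    moreover obtain r N where "j = (r, N)" by (cases j)
    ultimately have vw: "v \<in> bounded_forms (r, N)" "w \<in> bounded_forms (r, N)" by auto
    obtain \<Phi> where "v = frac_form n r \<Phi>" using bounded_forms_ex[OF vw(1)] by blast
    moreover obtain \<Psi> where "w = frac_form n r \<Psi>" using bounded_forms_ex[OF vw(2)] by blast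
    ultimately show "gl_form n g (v + w) = gl_form n g v + gl_form n g w"
      by (simp add: frac_form_add[OF n, symmetric] gl_form_frac_form[OF n g] gl_num_add)
  next
    assume "v \<in> jouanolou_forms n p"
    then obtain r \<Phi> where "v = frac_form n r \<Phi>" using jouanolou_forms_frac_form[OF n] by blast
    then show "gl_form n g (form_scale c v) = form_scale c (gl_form n g v)"
      by (simp add: frac_form_scale[OF n, symmetric] gl_form_frac_form[OF n g] gl_num_Const_mult)
  }
next
  fix j :: "nat \<times> nat" and u v w :: "'k form" and c :: 'k and g :: "'k mat"
  obtain r N where j: "j = (r, N)" by (cases j)
  have rep: "\<exists>\<Phi>. \<Phi> \<in> numerators n p r \<and> x = frac_form n r \<Phi>" if "x \<in> bounded_forms j" for x :: "'k form"
    using bounded_forms_ex that unfolding j by blast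
  {
    assume uvw: "u \<in> bounded_forms j" "v \<in> bounded_forms j" "w \<in> bounded_forms j"
    obtain \<Phi> \<Psi> \<Theta> where "u = frac_form n r \<Phi>" "v = frac_form n r \<Psi>" "w = frac_form n r \<Theta>"
      using rep[OF uvw(1)] rep[OF uvw(2)] rep[OF uvw(3)] by blast
    then show "form_pair j (u + v) w = form_pair j u w + form_pair j v w"
      by (simp add: form_pair_def j frac_form_add[OF n, symmetric] numer_frac_form[OF n] num_pair_def poly_pair_add_left sum.distrib)
  next
    assume uv: "u \<in> bounded_forms j" "v \<in> bounded_forms j"
    obtain \<Phi> \<Psi> where *: "\<Phi> \<in> numerators n p r" "\<Psi> \<in> numerators n p r" "u = frac_form n r \<Phi>" "v = frac_form n r \<Psi>"
      using rep[OF uv(1)] rep[OF uv(2)] by blast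
    then show "form_pair j (form_scale c u) v = c * form_pair j u v"
      by (simp add: form_pair_def j frac_form_scale[OF n, symmetric] numer_frac_form[OF n] num_pair_def
          poly_pair_Const_left sum_distrib_left)
    show "form_pair j u v = form_pair j v u"
      unfolding form_pair_def num_pair_def by (intro sum.cong refl poly_pair_commute)
    assume g: "g \<in> GL n"
    show "form_pair j (gl_form n g u) v = form_pair j u (gl_form n (transpose_mat g) v)"
      using * num_pair_contravariant[OF n g *(1,2)]
      by (simp add: form_pair_def j gl_form_frac_form[OF n g] gl_form_frac_form[OF n GL_transpose(1)[OF g]] numer_frac_form[OF n])
  }
next
  fix j :: "nat \<times> nat"
  show "gl_submodule n form_scale (gl_form n) (bounded_forms j :: 'k form set)" by (rule bounded_forms_submodule)
  show "bounded_forms j \<subseteq> (jouanolou_forms n p :: 'k form set)" by (rule bounded_forms_subset)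
  show "\<exists>E. finite E \<and> (bounded_forms j :: 'k form set) \<subseteq> forms.span E" by (rule bounded_forms_finite)
  fix X W :: "'k form set" and v w :: "'k form" and \<alpha>
  show "\<exists>j. X \<subseteq> bounded_forms j" if "finite X" "X \<subseteq> jouanolou_forms n p"
    by (rule bounded_forms_directed[OF that])
  show "\<exists>\<alpha>. \<exists>w\<in>W. hw_vector n form_scale (gl_form n) \<alpha> w"
    if "gl_submodule n form_scale (gl_form n) W" "W \<subseteq> jouanolou_forms n p" "W \<noteq> {0}"
    by (rule hw_vector_form_exists[OF that])
  show "\<exists>c. w = form_scale c v" if "v \<in> jouanolou_forms n p" "w \<in> jouanolou_forms n p"
    "hw_vector n form_scale (gl_form n) \<alpha> v" "hw_vector n form_scale (gl_form n) \<alpha> w"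
    by (rule hw_vector_form_unique[OF that(1,3,2,4)])
  show "form_pair j w w \<noteq> 0" if "w \<in> bounded_forms j" "hw_vector n form_scale (gl_form n) \<alpha> w"
    by (rule form_pair_anisotropic[OF that])
qed

lemma forms_rational:
  assumes W: "gl_submodule n form_scale (gl_form n) W" "W \<subseteq> (jouanolou_forms n p :: 'k::field_char_0 form set)"
  shows "gl_rational n form_scale (gl_form n) W"
proof (rule forms.gl_rationalI[OF W(1)])
  fix w assume "w \<in> W"
  then obtain r \<Phi> where \<Phi>: "\<Phi> \<in> numerators n p r" "w = frac_form n r \<Phi>"
    using jouanolou_forms_frac_form[OF n] W(2) by blast
  obtain L where L: "\<forall>(c, E)\<in>set L. c \<in> GL_regular n" "\<forall>g\<in>GL n. gl_num n g \<Phi> = (\<lambda>I. \<Sum>(c, E)\<leftarrow>L. Const (c g) * E I)"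
    using regular_num_gl_num[OF \<Phi>(1)] unfolding regular_num_def by blast
  have frac: "frac_form n r (\<lambda>I. \<Sum>(c, E)\<leftarrow>L. Const (c g) * E I) =
      (\<Sum>(c, e)\<leftarrow>map (\<lambda>(c, E). (c, frac_form n r E)) L. form_scale (c g) e)"
    for L :: "(('k mat \<Rightarrow> 'k) \<times> (nat list \<Rightarrow> 'k mpoly)) list" and g
  proof (induction L)
    case Nil
    show ?case unfolding list.map sum_list.Nil by (rule frac_form_0)
  next
    case (Cons x L)
    obtain c E where x: "x = (c, E)" by (cases x)
    show ?case
      by (simp only: x list.map sum_list.Cons prod.case frac_form_add[OF n] frac_form_scale[OF n] Cons.IH)
  qed
  show "\<exists>L. (\<forall>(c, e)\<in>set L. c \<in> GL_regular n) \<and> (\<forall>g\<in>GL n. gl_form n g w = (\<Sum>(c, e)\<leftarrow>L. form_scale (c g) e))"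
    using L by (intro exI[of _ "map (\<lambda>(c, E). (c, frac_form n r E)) L"]) (auto simp: \<Phi>(2) gl_form_frac_form[OF n] frac)
qed

lemma hw_vector_iff_interlaces:
  assumes "dominant_weight n \<alpha>"
  shows "(\<exists>w\<in>jouanolou_forms n p. hw_vector n form_scale (gl_form n) \<alpha> (w :: 'k::field_char_0 form)) \<longleftrightarrow> interlaces n p \<alpha>"
proof
  assume "\<exists>w\<in>jouanolou_forms n p. hw_vector n form_scale (gl_form n) \<alpha> (w :: 'k form)"
  then obtain w :: "'k form" where w: "w \<in> jouanolou_forms n p" "hw_vector n form_scale (gl_form n) \<alpha> w" by blast
  then obtain r \<Phi> where \<Phi>: "\<Phi> \<in> numerators n p r" "w = frac_form n r \<Phi>"
    using jouanolou_forms_frac_form[OF n] by blast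
  then show "interlaces n p \<alpha>" using num_hw_interlaces[OF n p assms \<Phi>(1)] w(2) by (simp add: hw_vector_frac_form)
next
  assume "interlaces n p \<alpha>"
  then obtain b x y where V_hw: "num_hw n \<alpha> (hw_num n p b x y :: nat list \<Rightarrow> 'k mpoly)"
    using interlaces_hw_num[OF n p] by blast
  let ?V = "hw_num n p b x y :: nat list \<Rightarrow> 'k mpoly"
  have "?V \<noteq> (\<lambda>I. 0)" using hw_num_nonzero[OF n p] by metis
  then have "hw_vector n form_scale (gl_form n) \<alpha> (frac_form n (y + p + 1) ?V)"
    using V_hw assms by (simp add: hw_vector_frac_form)
  then show "\<exists>w\<in>jouanolou_forms n p. hw_vector n form_scale (gl_form n) \<alpha> (w :: 'k form)"
    using frac_form_mem[OF n hw_num_numerators[OF n p]] by blast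
qed

end

theorem theorem1p4p3:
  fixes n p :: nat
  assumes "n \<ge> 1" and "p \<le> n - 1"
  shows "simple_spectrum n form_scale (gl_form n) (jouanolou_forms n p :: 'k::field_char_0 form set)
    \<and> (\<forall>\<D>. irreducible_decomposition n form_scale (gl_form n)
                (jouanolou_forms n p :: 'k form set) \<D> \<longrightarrow>
         (\<forall>\<alpha>. dominant_weight n \<alpha> \<longrightarrow>
            (\<forall>W\<in>\<D>. \<forall>W'\<in>\<D>. is_Sigma n form_scale (gl_form n) \<alpha> W \<and>
                is_Sigma n form_scale (gl_form n) \<alpha> W' \<longrightarrow> W = W') \<and>
            ((\<exists>W\<in>\<D>. is_Sigma n form_scale (gl_form n) \<alpha> W) \<longleftrightarrow> interlaces n p \<alpha>)))"
proof (intro conjI allI impI)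
  interpret contravariant_module "form_scale :: 'k \<Rightarrow> _" n "gl_form n" "jouanolou_forms n p"
      "bounded_forms n p" "form_pair n p"
    by (rule forms_contravariant_module[OF assms])
  show "simple_spectrum n form_scale (gl_form n) (jouanolou_forms n p :: 'k form set)"
    by (rule simple_spectrum)
  fix \<D> :: "'k form set set" and \<alpha>
  assume \<D>: "irreducible_decomposition n form_scale (gl_form n) (jouanolou_forms n p) \<D>"
    and \<alpha>: "dominant_weight n \<alpha>"
  note weights = decomposition_weights[OF \<D> forms_rational[OF assms]]
  show "\<forall>W\<in>\<D>. \<forall>W'\<in>\<D>. is_Sigma n form_scale (gl_form n) \<alpha> W \<and>
      is_Sigma n form_scale (gl_form n) \<alpha> W' \<longrightarrow> W = W'"
    using weights(1) by blast
  show "(\<exists>W\<in>\<D>. is_Sigma n form_scale (gl_form n) \<alpha> W) \<longleftrightarrow> interlaces n p \<alpha>"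
    using weights(2) hw_vector_iff_interlaces[OF assms \<alpha>] by blast
qed

end
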